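(* Let $f,\phi,g\in L^\infty(0,T;L^2(\Omega))$, $u^0\in H^2_0(\Omega)$, $u^{*0}\in H^1_0(\Omega)$, and $\theta^0,p^0\in H^1_0(\Omega)$. Then the fully discrete scheme (S) is unconditionally stable (no restriction relating $h$ and $\Delta t$ is required). Moreover, for $1\le m\le N-1$, $$E_h(U^{m+1},\Theta^{m+1},P^{m+1})\le C\Big(((U^0,U^1,f))+((\Theta^0,\Theta^1,\phi))+((P^0,P^1,g))\Big),$$ where the constant $C>0$ is independent of $h$ and $\Delta t$ and depends on $T$ and on the model coefficients $a_0,c_1,\alpha,\beta,\kappa$.
   Context: $\Omega\subset\mathbb R^2$ is a bounded polygonal Lipschitz domain, $T>0$; $(\cdot,\cdot)$, $\|\cdot\|$ are the $L^2(\Omega)$ inner product and norm. The coefficients $a_0,d_0,\alpha,\beta,a_1,b_1,c_1,a_2,\kappa$ are positive constants, $\gamma\in\mathbb R$, $a_1a_2-\gamma^2>0$, and $\gamma_0>0$ is fixed with $a_1-|\gamma|/\gamma_0>0$, $a_2-|\gamma|\gamma_0>0$. Space discretization. $\mathcal T$ is a shape-regular triangulation of $\bar\Omega$ with maximal diameter $h$, vertices $\mathcal V=\mathcal V(\Omega)\cup\mathcal V(\partial\Omega)$ and edges $\mathcal E=\mathcal E(\Omega)\cup\mathcal E(\partial\Omega)$ (interior and boundary); $h_e$ is the length of $e$ and $\boldsymbol n$ a fixed unit normal on $e$ (on an interior edge $e=\partial K_+\cap\partial K_-$, pointing from $K_+$ to $K_-$; outward on boundary edges). Jump: $[\![\varphi]\!]=\varphi|_{K_+}-\varphi|_{K_-}$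 on interior edges, $\varphi|_e$ on boundary edges; average: $\{\!\{\varphi\}\!\}=\frac12(\varphi|_{K_+}+\varphi|_{K_-})$ on interior edges, $\varphi|_e$ on boundary edges. $\mathcal P_r(\mathcal T)$ are the piecewise polynomials of degree at most $r$. $V_h=\mathcal P_2(\mathcal T)\cap H^1_0(\Omega)$, $W_h=\mathcal P_1(\mathcal T)\cap H^1_0(\Omega)$. With $D^2_{\rm pw}$ the piecewise Hessian and a penalty parameter $\sigma_{\rm IP}>0$, $$a_h(w,v)=\int_\Omega D^2_{\rm pw}w:D^2_{\rm pw}v\,dx-\sum_{e\in\mathcal E}\int_e[\![\nabla w]\!]\cdot\{\!\{D^2_{\rm pw}v\}\!\}\boldsymbol n\,ds-\sum_{e\in\mathcal E}\int_e[\![\nabla v]\!]\cdot\{\!\{D^2_{\rm pw}w\}\!\}\boldsymbol n\,ds+\sum_{e\in\mathcal E}\frac{\sigma_{\rm IP}}{h_e}\int_e\Big[\!\!\Big[\frac{\partial w}{\partial\boldsymbol n}\Big]\!\!\Big]\Big[\!\!\Big[\frac{\partial v}{\partial\boldsymbol n}\Big]\!\!\Big]ds,$$ $$\|v\|_h^2=\|D^2_{\rm pw}v\|^2+\sum_{e\in\mathcal E}\frac{\sigma_{\rm IP}}{h_e}\int_e\Big[\!\!\Big[\frac{\partial v}{\partial\boldsymbol n}\Big]\!\!\Big]^2ds,$$ and $\sigma_{\rm IP}$ is chosen sufficiently large that there are $C_{\rm Coer},C_{\rm Cont}>0$ with $C_{\rm Coer}\|w_h\|_h^2\le a_h(w_h,w_h)$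 and $a_h(w_h,v_h)\le C_{\rm Cont}\|w_h\|_h\|v_h\|_h$ on $V_h$. Projections. ${\rm M}(\mathcal T)$ is the Morley space: piecewise quadratics continuous at interior vertices with normal derivatives continuous at midpoints of interior edges, vanishing at boundary vertices, and with normal derivatives vanishing at midpoints of boundary edges. $I_{\rm M}:H^2(\mathcal T)\to{\rm M}(\mathcal T)$ (extended Morley interpolation, $H^2(\mathcal T)$ = piecewise $H^2$): $(I_{\rm M}v)(z)$ is the arithmetic mean of $v|_K(z)$ over triangles $K$ containing $z\in\mathcal V(\Omega)$, and the mean of $\partial(I_{\rm M}v)/\partial\boldsymbol n$ over $e\in\mathcal E(\Omega)$ equals that of $\{\!\{\partial v/\partial\boldsymbol n\}\!\}$; the remaining (boundary) degrees of freedom are zero. $J:{\rm M}(\mathcal T)\to({\rm HCT}(\mathcal T)+\mathcal P_8(\mathcal T))\cap H^2_0(\Omega)$ (HCT = Hsieh–Clough–Tocher space) is a fixed linear companion operator that preserves the values at all vertices and the edge means of normal derivatives on all edges, satisfies $\nabla(Jw_{\rm M})(z)=$ arithmetic mean of $\nabla w_{\rm M}|_K(z)$ over $K\ni z$ for $z\in\mathcal V(\Omega)$, $|w_{\rm M}-Jw_{\rm M}|_{H^2(\mathcal T)}\lesssim\min_{v\in H^2_0(\Omega)}|w_{\rm M}-v|_{H^2(\mathcal T)}$, and, with $Q=JI_{\rm M}:V_h\to H^2_0(\Omega)$, $\|v_h-Qv_h\|_{H^s(\mathcal T)}\le C_1h^{2-s}\min_{v\in H^2_0(\Omega)}\|v-v_h\|_h$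 for $v_h\in V_h$, $0\le s\le2$. The modified Ritz projection $\mathcal R_h:H^2_0(\Omega)\to V_h$ is defined by $a_h(\mathcal R_hw,v_h)=(\nabla^2w,\nabla^2Qv_h)$ for all $v_h\in V_h$, and $\Pi_h:H^1_0(\Omega)\to W_h$ by $(\nabla\Pi_h\chi,\nabla\chi_h)=(\nabla\chi,\nabla\chi_h)$ for all $\chi_h\in W_h$. Time discretization. $t_n=n\Delta t$, $\Delta t=T/N$; $\upsilon^n=\upsilon(t_n)$, $\upsilon^{n+1/2}=\frac12(\upsilon^{n+1}+\upsilon^n)$, $\upsilon^{n,1/4}=\frac14(\upsilon^{n+1}+2\upsilon^n+\upsilon^{n-1})$, $\bar\partial_t\upsilon^{n+1/2}=(\upsilon^{n+1}-\upsilon^n)/\Delta t$, $\bar\partial_t^2\upsilon^n=(\upsilon^{n+1}-2\upsilon^n+\upsilon^{n-1})/(\Delta t)^2$. Point values of $f,\phi,g$ at $t_n$ are assumed to be defined and bounded in $L^2(\Omega)$ by the respective $L^\infty(0,T;L^2(\Omega))$ norms. Scheme (S). $(U^0,\Theta^0,P^0)=(\mathcal R_hu^0,\Pi_h\theta^0,\Pi_hp^0)$. $(U^1,\Theta^1,P^1)\in V_h\times W_h\times W_h$ solves, for all $(v_h,\psi_h,q_h)\in V_h\times W_h\times W_h$, $$\tfrac{2}{\Delta t}\big[(\bar\partial_tU^{1/2}-u^{*0},v_h)+a_0(\nabla\bar\partial_tU^{1/2}-\nabla u^{*0},\nabla v_h)\big]+d_0a_h(U^{1/2},v_h)-\alpha(\nabla\Theta^{1/2},\nabla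 v_h)-\beta(\nabla P^{1/2},\nabla v_h)=(f^{1/2},v_h),$$ $$a_1(\bar\partial_t\Theta^{1/2},\psi_h)-\gamma(\bar\partial_tP^{1/2},\psi_h)+b_1(\Theta^{1/2},\psi_h)+c_1(\nabla\Theta^{1/2},\nabla\psi_h)+\alpha(\nabla\bar\partial_tU^{1/2},\nabla\psi_h)=(\phi^{1/2},\psi_h),$$ $$a_2(\bar\partial_tP^{1/2},q_h)-\gamma(\bar\partial_t\Theta^{1/2},q_h)+\kappa(\nabla P^{1/2},\nabla q_h)+\beta(\nabla\bar\partial_tU^{1/2},\nabla q_h)=(g^{1/2},q_h).$$ For $n=1,\dots,N-1$, $(U^{n+1},\Theta^{n+1},P^{n+1})\in V_h\times W_h\times W_h$ solves, for all $(v_h,\psi_h,q_h)\in V_h\times W_h\times W_h$, $$(\bar\partial_t^2U^n,v_h)+a_0(\nabla\bar\partial_t^2U^n,\nabla v_h)+d_0a_h(U^{n,1/4},v_h)-\alpha(\nabla\Theta^{n,1/4},\nabla v_h)-\beta(\nabla P^{n,1/4},\nabla v_h)=(f^{n,1/4},v_h),$$ $$a_1(\bar\partial_t\Theta^{n+1/2},\psi_h)-\gamma(\bar\partial_tP^{n+1/2},\psi_h)+b_1(\Theta^{n+1/2},\psi_h)+c_1(\nabla\Theta^{n+1/2},\nabla\psi_h)+\alpha(\nabla\bar\partial_tU^{n+1/2},\nabla\psi_h)=(\phi^{n+1/2},\psi_h),$$ $$a_2(\bar\partial_tP^{n+1/2},q_h)-\gamma(\bar\partial_t\Theta^{n+1/2},q_h)+\kappa(\nabla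 P^{n+1/2},\nabla q_h)+\beta(\nabla\bar\partial_tU^{n+1/2},\nabla q_h)=(g^{n+1/2},q_h).$$ Quantities in the bound. $$\|(\Theta^m,P^m)\|_H^2=\Delta t\sum_{n=1}^m\big[b_1\|\Theta^{n+1/2}\|^2+c_1\|\nabla\Theta^{n+1/2}\|^2+\kappa\|\nabla P^{n+1/2}\|^2\big],$$ $$E_h(U^{m+1},\Theta^{m+1},P^{m+1})=\|\bar\partial_tU^{m+1/2}\|^2+a_0\|\nabla\bar\partial_tU^{m+1/2}\|^2+d_0C_{\rm Coer}\|U^{m+1/2}\|_h^2+(a_1-|\gamma|/\gamma_0)\|\Theta^{m+1}\|^2+(a_2-|\gamma|\gamma_0)\|P^{m+1}\|^2+\|(\Theta^m,P^m)\|_H^2,$$ $$((U^0,U^1,f))=6\|\bar\partial_tU^{1/2}\|^2+4a_0\|\nabla\bar\partial_tU^{1/2}\|^2+4d_0C_{\rm Cont}\|U^{1/2}\|_h^2+4T^2\|f\|^2_{L^\infty(0,T;L^2(\Omega))},$$ $$((\Theta^0,\Theta^1,\phi))=\tfrac12(3a_1+|\gamma|/\gamma_0)\|\Theta^1\|^2+c_1\Delta t\|\nabla\Theta^{1/2}\|^2+\frac{T^2}{a_1-|\gamma|/\gamma_0}\|\phi\|^2_{L^\infty(0,T;L^2(\Omega))},$$ $$((P^0,P^1,g))=\tfrac12(3a_2+|\gamma|\gamma_0)\|P^1\|^2+\kappa\Delta t\|\nabla P^{1/2}\|^2+\frac{T^2}{a_2-|\gamma|\gamma_0}\|g\|^2_{L^\infty(0,T;L^2(\Omega))}.$$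 *)

theory Defs
  imports "HOL-Analysis.Analysis" "HOL-Probability.Essential_Supremum"
begin

type_synonym pt = "real^2"
type_synonym sfun = "real^2 \<Rightarrow> real"

section \<open>Lebesgue and Sobolev spaces\<close>

text \<open>Elements of function spaces are represented by functions on the whole plane; only their
  values on the set in question, up to a null set, matter.\<close>

definition L2 :: "pt set \<Rightarrow> sfun set" where
  "L2 A = {f. set_borel_measurable lebesgue A f \<and> set_integrable lebesgue A (\<lambda>x. (f x)\<^sup>2)}"

text \<open>The value type is generic: scalars, vector fields, and matrix fields (where
  \<open>\<bullet>\<close> is the Frobenius product).\<close>

definition ip :: "pt set \<Rightarrow> (pt \<Rightarrow> 'b::euclidean_space) \<Rightarrow> (pt \<Rightarrow> 'b) \<Rightarrow> real" where
  "ip A F G = (LINT x:A|lebesgue. F x \<bullet> G x)"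

definition nrm :: "pt set \<Rightarrow> (pt \<Rightarrow> 'b::euclidean_space) \<Rightarrow> real" where
  "nrm A F = sqrt (ip A F F)"

definition pd :: "2 \<Rightarrow> sfun \<Rightarrow> sfun" where
  "pd i f = (\<lambda>x. frechet_derivative f (at x) (axis i 1))"

text \<open>Iterated partial derivatives are indexed by lists of coordinate directions.\<close>

definition pds :: "2 list \<Rightarrow> sfun \<Rightarrow> sfun" where
  "pds is f = foldr pd is f"

definition test_functions :: "pt set \<Rightarrow> sfun set" where
  "test_functions A = {\<phi>. (\<forall>is. pds is \<phi> differentiable_on UNIV) \<and>
     compact (closure {x. \<phi> x \<noteq> 0}) \<and> closure {x. \<phi> x \<noteq> 0} \<subseteq> A}"

definition is_weak_deriv :: "pt set \<Rightarrow> 2 list \<Rightarrow> sfun \<Rightarrow> sfun \<Rightarrow> bool" where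
  "is_weak_deriv A is u g \<longleftrightarrow> g \<in> L2 A \<and>
     (\<forall>\<phi>\<in>test_functions A.
        (LINT x:A|lebesgue. u x * pds is \<phi> x) = (-1) ^ length is * (LINT x:A|lebesgue. g x * \<phi> x))"

text \<open>Square integrable weak derivatives are unique up to null sets. As representative we take
  the classical derivative whenever that is a weak derivative.\<close>

definition weak_deriv :: "pt set \<Rightarrow> 2 list \<Rightarrow> sfun \<Rightarrow> sfun" where
  "weak_deriv A is u =
     (if is_weak_deriv A is u (pds is u) then pds is u else (SOME g. is_weak_deriv A is u g))"

definition sobolev :: "nat \<Rightarrow> pt set \<Rightarrow> sfun set" where
  "sobolev k A = {u \<in> L2 A. \<forall>is. length is \<le> k \<longrightarrow> (\<exists>g. is_weak_deriv A is u g)}"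

text \<open>\<open>sobolev0 k A\<close> is the closure of the test functions in \<open>sobolev k A\<close>.\<close>

definition sobolev0 :: "nat \<Rightarrow> pt set \<Rightarrow> sfun set" where
  "sobolev0 k A = {u \<in> L2 A. \<exists>\<phi>. (\<forall>n. \<phi> n \<in> test_functions A) \<and>
     (\<forall>is. length is \<le> k \<longrightarrow> (\<exists>g. is_weak_deriv A is u g \<and>
        (\<lambda>n. nrm A (\<lambda>x. pds is (\<phi> n) x - g x)) \<longlonglongrightarrow> 0))}"

text \<open>Sobolev--Slobodeckij norm of real order \<open>s \<ge> 0\<close>; for integer \<open>s\<close> the usual norm.\<close>

definition slobodeckij_norm :: "real \<Rightarrow> pt set \<Rightarrow> sfun \<Rightarrow> real" where
  "slobodeckij_norm s A u = (let k = nat \<lfloor>s\<rfloor>; \<theta> = s - real k in sqrt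
     ((\<Sum>is | length is \<le> k. (nrm A (weak_deriv A is u))\<^sup>2) +
      (if \<theta> = 0 then 0 else
        \<Sum>is | length is = k. LINT z:A \<times> A|lebesgue.
          (weak_deriv A is u (fst z) - weak_deriv A is u (snd z))\<^sup>2
            / norm (fst z - snd z) powr (2 + 2 * \<theta>))))"

text \<open>\<open>L\<^sup>\<infinity>(0,T;L\<^sup>2(A))\<close>: strongly measurable (a.e. limit of simple functions) and essentially
  bounded. The norm is the essential supremum.\<close>

definition Linf_L2 :: "real \<Rightarrow> pt set \<Rightarrow> (real \<Rightarrow> sfun) set" where
  "Linf_L2 T A = {f. (AE t in lebesgue_on {0<..<T}. f t \<in> L2 A) \<and>
     (\<exists>s. (\<forall>k. simple_function (lebesgue_on {0<..<T}) (s k) \<and> (\<forall>t\<in>{0<..<T}. s k t \<in> L2 A)) \<and>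
        (AE t in lebesgue_on {0<..<T}. (\<lambda>k. nrm A (\<lambda>x. s k t x - f t x)) \<longlonglongrightarrow> 0)) \<and>
     (\<exists>B. AE t in lebesgue_on {0<..<T}. nrm A (f t) \<le> B)}"

definition Linf_L2_norm :: "real \<Rightarrow> pt set \<Rightarrow> (real \<Rightarrow> sfun) \<Rightarrow> real" where
  "Linf_L2_norm T A f =
     real_of_ereal (esssup (lebesgue_on {0<..<T}) (\<lambda>t. ereal (nrm A (f t))))"


section \<open>Polygonal domains and triangulations\<close>

text \<open>The last conjunct says that near each boundary point, in rotated coordinates, the domain is
  the strict epigraph of a Lipschitz function.\<close>

definition polygonal_lipschitz_domain :: "pt set \<Rightarrow> bool" where
  "polygonal_lipschitz_domain \<Omega> \<longleftrightarrow>
     open \<Omega> \<and> connected \<Omega> \<and> \<Omega> \<noteq> {} \<and> bounded \<Omega> \<and>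
     (\<exists>S. finite S \<and> frontier \<Omega> = (\<Union>(a, b)\<in>S. closed_segment a b)) \<and>
     (\<forall>x\<in>frontier \<Omega>. \<exists>d e r \<eta> L \<phi>.
        norm d = 1 \<and> norm e = 1 \<and> d \<bullet> e = 0 \<and> r > 0 \<and> \<eta> > 0 \<and> L-lipschitz_on {-r<..<r} \<phi> \<and>
        (\<forall>s t. \<bar>s\<bar> < r \<and> \<bar>t\<bar> < \<eta> \<longrightarrow> (x + s *\<^sub>R d + t *\<^sub>R e \<in> \<Omega> \<longleftrightarrow> \<phi> s < t)))"

text \<open>A mesh carries, besides its (closed) triangles, the fixed choice for each edge of
  \<open>K\<^sub>+\<close>, \<open>K\<^sub>-\<close> and the unit normal; for a boundary edge \<open>kplus\<close> is the only adjacent triangle and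
  \<open>kminus\<close> is irrelevant.\<close>

record mesh =
  omega :: "pt set"
  elems :: "pt set set"
  kplus :: "pt set \<Rightarrow> pt set"
  kminus :: "pt set \<Rightarrow> pt set"
  enormal :: "pt set \<Rightarrow> pt"

definition edges :: "mesh \<Rightarrow> pt set set" where
  "edges M = {e. \<exists>K\<in>elems M. e edge_of K}"

definition boundary_edges :: "mesh \<Rightarrow> pt set set" where
  "boundary_edges M = {e \<in> edges M. e \<subseteq> frontier (omega M)}"

definition interior_edges :: "mesh \<Rightarrow> pt set set" where
  "interior_edges M = edges M - boundary_edges M"

definition vertices :: "mesh \<Rightarrow> pt set" where
  "vertices M = {z. \<exists>K\<in>elems M. z extreme_point_of K}"

definition interior_vertices :: "mesh \<Rightarrow> pt set" where
  "interior_vertices M = vertices M \<inter> omega M"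

definition boundary_vertices :: "mesh \<Rightarrow> pt set" where
  "boundary_vertices M = vertices M \<inter> frontier (omega M)"

definition elems_at :: "mesh \<Rightarrow> pt \<Rightarrow> pt set set" where
  "elems_at M z = {K \<in> elems M. z \<in> K}"

definition mesh_size :: "mesh \<Rightarrow> real" where
  "mesh_size M = Max (diameter ` elems M)"

definition is_mesh :: "mesh \<Rightarrow> bool" where
  "is_mesh M \<longleftrightarrow>
     polygonal_lipschitz_domain (omega M) \<and>
     triangulation (elems M) \<and> (\<forall>K\<in>elems M. 2 simplex K) \<and> \<Union>(elems M) = closure (omega M) \<and>
     (\<forall>e\<in>edges M.
        kplus M e \<in> elems M \<and> e edge_of kplus M e \<and> norm (enormal M e) = 1 \<and>
        (\<forall>x\<in>kplus M e. \<forall>y\<in>e. enormal M e \<bullet> (x - y) \<le> 0)) \<and>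
     (\<forall>e\<in>interior_edges M.
        kminus M e \<in> elems M \<and> kminus M e \<noteq> kplus M e \<and>
        e = frontier (kplus M e) \<inter> frontier (kminus M e))"

definition shape_regular :: "real \<Rightarrow> mesh \<Rightarrow> bool" where
  "shape_regular \<rho> M \<longleftrightarrow> (\<forall>K\<in>elems M. \<exists>x r. r > 0 \<and> cball x r \<subseteq> K \<and> diameter K \<le> \<rho> * r)"

definition endpoints :: "pt set \<Rightarrow> pt \<times> pt" where
  "endpoints e = (SOME (a, b). e = closed_segment a b)"

definition edge_length :: "pt set \<Rightarrow> real" where
  "edge_length e = dist (fst (endpoints e)) (snd (endpoints e))"

definition edge_midpoint :: "pt set \<Rightarrow> pt" where
  "edge_midpoint e = midpoint (fst (endpoints e)) (snd (endpoints e))"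

definition edge_integral :: "pt set \<Rightarrow> sfun \<Rightarrow> real" where
  "edge_integral e f =
     edge_length e * (LINT t:{0..1}|lebesgue. f (linepath (fst (endpoints e)) (snd (endpoints e)) t))"

definition edge_mean :: "pt set \<Rightarrow> sfun \<Rightarrow> real" where
  "edge_mean e f = edge_integral e f / edge_length e"


section \<open>Broken derivatives, traces, jumps and averages\<close>

text \<open>Elementwise weak derivatives. For a function in a Sobolev space over the whole domain these
  are, almost everywhere, its weak derivatives there.\<close>

definition broken_deriv :: "mesh \<Rightarrow> 2 list \<Rightarrow> sfun \<Rightarrow> sfun" where
  "broken_deriv M is v =
     (\<lambda>x. \<Sum>K\<in>elems M. indicator (interior K) x * weak_deriv (interior K) is v x)"

definition grad :: "mesh \<Rightarrow> sfun \<Rightarrow> pt \<Rightarrow> real^2" where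
  "grad M v = (\<lambda>x. \<chi> i. broken_deriv M [i] v x)"

definition hess :: "mesh \<Rightarrow> sfun \<Rightarrow> pt \<Rightarrow> real^2^2" where
  "hess M v = (\<lambda>x. \<chi> i j. broken_deriv M [i, j] v x)"

definition broken_sobolev :: "nat \<Rightarrow> mesh \<Rightarrow> sfun set" where
  "broken_sobolev k M = {v. \<forall>K\<in>elems M. v \<in> sobolev k (interior K)}"

text \<open>The trace of \<open>F|\<^sub>K\<close> at \<open>x \<in> K\<close> as the limit of means over small balls. It does not depend on the
  representative, is the value at \<open>x\<close> of the continuous extension of \<open>F|\<^sub>K\<close> if there is one, and for
  \<open>H\<^sup>1(K)\<close> functions it is the Sobolev trace at almost every point of each edge.\<close>

definition trace_from :: "pt set \<Rightarrow> (pt \<Rightarrow> 'b::euclidean_space) \<Rightarrow> pt \<Rightarrow> 'b" where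
  "trace_from K F x = Lim (at_right 0)
     (\<lambda>r. (LINT y:ball x r \<inter> K|lebesgue. F y) /\<^sub>R measure lebesgue (ball x r \<inter> K))"

definition jump :: "mesh \<Rightarrow> pt set \<Rightarrow> (pt \<Rightarrow> 'b::euclidean_space) \<Rightarrow> pt \<Rightarrow> 'b" where
  "jump M e F x = (if e \<in> boundary_edges M then trace_from (kplus M e) F x
     else trace_from (kplus M e) F x - trace_from (kminus M e) F x)"

definition average :: "mesh \<Rightarrow> pt set \<Rightarrow> (pt \<Rightarrow> 'b::euclidean_space) \<Rightarrow> pt \<Rightarrow> 'b" where
  "average M e F x = (if e \<in> boundary_edges M then trace_from (kplus M e) F x
     else (1/2) *\<^sub>R (trace_from (kplus M e) F x + trace_from (kminus M e) F x))"

definition normal_deriv :: "mesh \<Rightarrow> pt set \<Rightarrow> sfun \<Rightarrow> sfun" where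
  "normal_deriv M e v = (\<lambda>x. grad M v x \<bullet> enormal M e)"


section \<open>Discrete spaces, bilinear form and norm\<close>

definition poly_deg_le :: "nat \<Rightarrow> sfun \<Rightarrow> bool" where
  "poly_deg_le r p \<longleftrightarrow>
     (\<exists>c. \<forall>x. p x = (\<Sum>(i, j) | i + j \<le> r. c i j * (x $ 1) ^ i * (x $ 2) ^ j))"

definition piecewise_poly :: "nat \<Rightarrow> pt set set \<Rightarrow> sfun set" where
  "piecewise_poly r \<T> = {v. \<forall>K\<in>\<T>. \<exists>p. poly_deg_le r p \<and> (\<forall>x\<in>interior K. v x = p x)}"

definition Vh :: "mesh \<Rightarrow> sfun set" where
  "Vh M = piecewise_poly 2 (elems M) \<inter> sobolev0 1 (omega M)"

definition Wh :: "mesh \<Rightarrow> sfun set" where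
  "Wh M = piecewise_poly 1 (elems M) \<inter> sobolev0 1 (omega M)"

definition ah :: "mesh \<Rightarrow> real \<Rightarrow> sfun \<Rightarrow> sfun \<Rightarrow> real" where
  "ah M \<sigma> w v =
     ip (omega M) (hess M w) (hess M v)
     - (\<Sum>e\<in>edges M. edge_integral e
          (\<lambda>x. jump M e (grad M w) x \<bullet> (average M e (hess M v) x *v enormal M e)))
     - (\<Sum>e\<in>edges M. edge_integral e
          (\<lambda>x. jump M e (grad M v) x \<bullet> (average M e (hess M w) x *v enormal M e)))
     + (\<Sum>e\<in>edges M. \<sigma> / edge_length e * edge_integral e
          (\<lambda>x. jump M e (normal_deriv M e w) x * jump M e (normal_deriv M e v) x))"

definition hnorm :: "mesh \<Rightarrow> real \<Rightarrow> sfun \<Rightarrow> real" where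
  "hnorm M \<sigma> v = sqrt ((nrm (omega M) (hess M v))\<^sup>2
     + (\<Sum>e\<in>edges M. \<sigma> / edge_length e *
          edge_integral e (\<lambda>x. (jump M e (normal_deriv M e v) x)\<^sup>2)))"

definition ah_coercive_bounded :: "mesh \<Rightarrow> real \<Rightarrow> real \<Rightarrow> real \<Rightarrow> bool" where
  "ah_coercive_bounded M \<sigma> CCoer CCont \<longleftrightarrow> \<sigma> > 0 \<and> CCoer > 0 \<and> CCont > 0 \<and>
     (\<forall>w\<in>Vh M. CCoer * (hnorm M \<sigma> w)\<^sup>2 \<le> ah M \<sigma> w w) \<and>
     (\<forall>w\<in>Vh M. \<forall>v\<in>Vh M. ah M \<sigma> w v \<le> CCont * hnorm M \<sigma> w * hnorm M \<sigma> v)"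


section \<open>Morley interpolation, companion operator, projections\<close>

definition morley :: "mesh \<Rightarrow> sfun set" where
  "morley M = {w \<in> piecewise_poly 2 (elems M).
     (\<forall>z\<in>interior_vertices M. \<forall>K\<in>elems_at M z. \<forall>K'\<in>elems_at M z.
        trace_from K w z = trace_from K' w z) \<and>
     (\<forall>e\<in>interior_edges M. jump M e (normal_deriv M e w) (edge_midpoint e) = 0) \<and>
     (\<forall>z\<in>boundary_vertices M. \<forall>K\<in>elems_at M z. trace_from K w z = 0) \<and>
     (\<forall>e\<in>boundary_edges M. trace_from (kplus M e) (normal_deriv M e w) (edge_midpoint e) = 0)}"

text \<open>The boundary degrees of freedom of the interpolant vanish by membership in \<open>morley M\<close>.\<close>

definition is_morley_interpolant :: "mesh \<Rightarrow> sfun \<Rightarrow> sfun \<Rightarrow> bool" where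
  "is_morley_interpolant M v w \<longleftrightarrow> w \<in> morley M \<and>
     (\<forall>z\<in>interior_vertices M. \<forall>K\<in>elems_at M z. trace_from K w z =
        (\<Sum>K'\<in>elems_at M z. trace_from K' v z) / real (card (elems_at M z))) \<and>
     (\<forall>e\<in>interior_edges M.
        edge_mean e (average M e (normal_deriv M e w)) = edge_mean e (average M e (normal_deriv M e v)))"

text \<open>The interpolant is unique up to its values on the (null) union of the edges.\<close>

definition IM :: "mesh \<Rightarrow> sfun \<Rightarrow> sfun" where
  "IM M v = (SOME w. is_morley_interpolant M v w)"

definition centroid :: "pt set \<Rightarrow> pt" where
  "centroid K = (1/3) *\<^sub>R (\<Sum>z | z extreme_point_of K. z)"

definition hct_split :: "mesh \<Rightarrow> pt set set" where
  "hct_split M = {convex hull (insert (centroid K) e) | K e. K \<in> elems M \<and> e edge_of K}"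

text \<open>For piecewise polynomials, being in \<open>H\<^sup>2\<close> of the domain is the same as being \<open>C\<^sup>1\<close>.\<close>

definition HCT :: "mesh \<Rightarrow> sfun set" where
  "HCT M = piecewise_poly 3 (hct_split M) \<inter> sobolev 2 (omega M)"

definition companion_space :: "mesh \<Rightarrow> sfun set" where
  "companion_space M =
     {(\<lambda>x. h x + p x) | h p. h \<in> HCT M \<and> p \<in> piecewise_poly 8 (elems M)} \<inter> sobolev0 2 (omega M)"

definition companion_operator :: "mesh \<Rightarrow> (sfun \<Rightarrow> sfun) \<Rightarrow> real \<Rightarrow> bool" where
  "companion_operator M J CJ \<longleftrightarrow> CJ > 0 \<and>
     (\<forall>w\<in>morley M. J w \<in> companion_space M) \<and>
     (\<forall>w\<in>morley M. \<forall>w'\<in>morley M. \<forall>a b.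
        AE x in lebesgue_on (omega M). J (\<lambda>y. a * w y + b * w' y) x = a * J w x + b * J w' x) \<and>
     (\<forall>w\<in>morley M. \<forall>z\<in>vertices M. \<forall>K\<in>elems_at M z. trace_from K (J w) z = trace_from K w z) \<and>
     (\<forall>w\<in>morley M. \<forall>e\<in>edges M.
        edge_mean e (average M e (normal_deriv M e (J w))) =
        edge_mean e (average M e (normal_deriv M e w))) \<and>
     (\<forall>w\<in>morley M. \<forall>z\<in>interior_vertices M. \<forall>K\<in>elems_at M z. trace_from K (grad M (J w)) z =
        (\<Sum>K'\<in>elems_at M z. trace_from K' (grad M w) z) /\<^sub>R real (card (elems_at M z))) \<and>
     (\<forall>w\<in>morley M. nrm (omega M) (hess M (\<lambda>x. w x - J w x)) \<le>
        CJ * (INF v\<in>sobolev0 2 (omega M). nrm (omega M) (hess M (\<lambda>x. w x - v x))))"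

definition Qh :: "mesh \<Rightarrow> (sfun \<Rightarrow> sfun) \<Rightarrow> sfun \<Rightarrow> sfun" where
  "Qh M J v = J (IM M v)"

definition broken_norm :: "real \<Rightarrow> mesh \<Rightarrow> sfun \<Rightarrow> real" where
  "broken_norm s M v = sqrt (\<Sum>K\<in>elems M. (slobodeckij_norm s (interior K) v)\<^sup>2)"

text \<open>The constant may depend on \<open>s\<close>: no constant is uniform in \<open>s\<close> for the unnormalised
  Slobodeckij norms, which blow up as \<open>s\<close> approaches 1 or 2 from below.\<close>

definition Q_approximation :: "mesh \<Rightarrow> real \<Rightarrow> (sfun \<Rightarrow> sfun) \<Rightarrow> (real \<Rightarrow> real) \<Rightarrow> bool" where
  "Q_approximation M \<sigma> J C1 \<longleftrightarrow>
     (\<forall>s\<in>{0..2}. C1 s > 0 \<and>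
        (\<forall>v\<in>Vh M. broken_norm s M (\<lambda>x. v x - Qh M J v x) \<le>
           C1 s * mesh_size M powr (2 - s) *
             (INF w\<in>sobolev0 2 (omega M). hnorm M \<sigma> (\<lambda>x. w x - v x))))"

definition is_ritz_projection :: "mesh \<Rightarrow> real \<Rightarrow> (sfun \<Rightarrow> sfun) \<Rightarrow> sfun \<Rightarrow> sfun \<Rightarrow> bool" where
  "is_ritz_projection M \<sigma> J w R \<longleftrightarrow> R \<in> Vh M \<and>
     (\<forall>v\<in>Vh M. ah M \<sigma> R v = ip (omega M) (hess M w) (hess M (Qh M J v)))"

definition is_H1_projection :: "mesh \<Rightarrow> sfun \<Rightarrow> sfun \<Rightarrow> bool" where
  "is_H1_projection M w R \<longleftrightarrow> R \<in> Wh M \<and>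
     (\<forall>v\<in>Wh M. ip (omega M) (grad M R) (grad M v) = ip (omega M) (grad M w) (grad M v))"


section \<open>Fully discrete scheme\<close>

text \<open>\<open>half X n\<close>, \<open>quarter X n\<close>, \<open>dt1 \<tau> X n\<close>, \<open>dt2 \<tau> X n\<close> are \<open>X\<close> at level \<open>n+1/2\<close>, the
  \<open>(n,1/4)\<close>-average, and the first and second difference quotients at levels \<open>n+1/2\<close> and \<open>n\<close>.\<close>

definition half :: "(nat \<Rightarrow> sfun) \<Rightarrow> nat \<Rightarrow> sfun" where
  "half X n = (\<lambda>x. (X (n + 1) x + X n x) / 2)"

definition quarter :: "(nat \<Rightarrow> sfun) \<Rightarrow> nat \<Rightarrow> sfun" where
  "quarter X n = (\<lambda>x. (X (n + 1) x + 2 * X n x + X (n - 1) x) / 4)"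

definition dt1 :: "real \<Rightarrow> (nat \<Rightarrow> sfun) \<Rightarrow> nat \<Rightarrow> sfun" where
  "dt1 \<tau> X n = (\<lambda>x. (X (n + 1) x - X n x) / \<tau>)"

definition dt2 :: "real \<Rightarrow> (nat \<Rightarrow> sfun) \<Rightarrow> nat \<Rightarrow> sfun" where
  "dt2 \<tau> X n = (\<lambda>x. (X (n + 1) x - 2 * X n x + X (n - 1) x) / \<tau>\<^sup>2)"

definition samples :: "real \<Rightarrow> (real \<Rightarrow> sfun) \<Rightarrow> nat \<Rightarrow> sfun" where
  "samples \<tau> f n = f (real n * \<tau>)"

definition displacement_start where
  "displacement_start M \<sigma> a0 d0 \<alpha> \<beta> \<tau> us0 F U \<Theta> P \<longleftrightarrow> (\<forall>v\<in>Vh M.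
     2 / \<tau> * (ip (omega M) (\<lambda>x. dt1 \<tau> U 0 x - us0 x) v
             + a0 * ip (omega M) (\<lambda>x. grad M (dt1 \<tau> U 0) x - grad M us0 x) (grad M v))
     + d0 * ah M \<sigma> (half U 0) v
     - \<alpha> * ip (omega M) (grad M (half \<Theta> 0)) (grad M v)
     - \<beta> * ip (omega M) (grad M (half P 0)) (grad M v)
     = ip (omega M) (half F 0) v)"

definition displacement_step where
  "displacement_step M \<sigma> a0 d0 \<alpha> \<beta> \<tau> F U \<Theta> P n \<longleftrightarrow> (\<forall>v\<in>Vh M.
     ip (omega M) (dt2 \<tau> U n) v
     + a0 * ip (omega M) (grad M (dt2 \<tau> U n)) (grad M v)
     + d0 * ah M \<sigma> (quarter U n) v
     - \<alpha> * ip (omega M) (grad M (quarter \<Theta> n)) (grad M v)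
     - \<beta> * ip (omega M) (grad M (quarter P n)) (grad M v)
     = ip (omega M) (quarter F n) v)"

definition temperature_step where
  "temperature_step M \<alpha> \<gamma> a1 b1 c1 \<tau> \<Phi> U \<Theta> P n \<longleftrightarrow> (\<forall>\<psi>\<in>Wh M.
     a1 * ip (omega M) (dt1 \<tau> \<Theta> n) \<psi>
     - \<gamma> * ip (omega M) (dt1 \<tau> P n) \<psi>
     + b1 * ip (omega M) (half \<Theta> n) \<psi>
     + c1 * ip (omega M) (grad M (half \<Theta> n)) (grad M \<psi>)
     + \<alpha> * ip (omega M) (grad M (dt1 \<tau> U n)) (grad M \<psi>)
     = ip (omega M) (half \<Phi> n) \<psi>)"

definition pressure_step where
  "pressure_step M \<beta> \<gamma> a2 \<kappa> \<tau> G U \<Theta> P n \<longleftrightarrow> (\<forall>q\<in>Wh M.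
     a2 * ip (omega M) (dt1 \<tau> P n) q
     - \<gamma> * ip (omega M) (dt1 \<tau> \<Theta> n) q
     + \<kappa> * ip (omega M) (grad M (half P n)) (grad M q)
     + \<beta> * ip (omega M) (grad M (dt1 \<tau> U n)) (grad M q)
     = ip (omega M) (half G n) q)"

definition scheme where
  "scheme M \<sigma> J a0 d0 \<alpha> \<beta> \<gamma> a1 b1 c1 a2 \<kappa> T N f \<phi> g u0 us0 \<theta>0 p0 U \<Theta> P \<longleftrightarrow>
     (let \<tau> = T / real N in
       (\<forall>n\<le>N. U n \<in> Vh M \<and> \<Theta> n \<in> Wh M \<and> P n \<in> Wh M) \<and>
       is_ritz_projection M \<sigma> J u0 (U 0) \<and>
       is_H1_projection M \<theta>0 (\<Theta> 0) \<and>
       is_H1_projection M p0 (P 0) \<and>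
       displacement_start M \<sigma> a0 d0 \<alpha> \<beta> \<tau> us0 (samples \<tau> f) U \<Theta> P \<and>
       (\<forall>n\<in>{1..<N}. displacement_step M \<sigma> a0 d0 \<alpha> \<beta> \<tau> (samples \<tau> f) U \<Theta> P n) \<and>
       (\<forall>n<N. temperature_step M \<alpha> \<gamma> a1 b1 c1 \<tau> (samples \<tau> \<phi>) U \<Theta> P n) \<and>
       (\<forall>n<N. pressure_step M \<beta> \<gamma> a2 \<kappa> \<tau> (samples \<tau> g) U \<Theta> P n))"

definition admissible_source :: "real \<Rightarrow> nat \<Rightarrow> pt set \<Rightarrow> (real \<Rightarrow> sfun) \<Rightarrow> bool" where
  "admissible_source T N A f \<longleftrightarrow> f \<in> Linf_L2 T A \<and>
     (\<forall>n\<le>N. samples (T / real N) f n \<in> L2 A \<and>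
        nrm A (samples (T / real N) f n) \<le> Linf_L2_norm T A f)"


section \<open>Quantities in the stability bound\<close>

definition dissipation :: "mesh \<Rightarrow> real \<Rightarrow> real \<Rightarrow> real \<Rightarrow> real \<Rightarrow>
    (nat \<Rightarrow> sfun) \<Rightarrow> (nat \<Rightarrow> sfun) \<Rightarrow> nat \<Rightarrow> real" where
  "dissipation M b1 c1 \<kappa> \<tau> \<Theta> P m = \<tau> * (\<Sum>n=1..m.
     b1 * (nrm (omega M) (half \<Theta> n))\<^sup>2
     + c1 * (nrm (omega M) (grad M (half \<Theta> n)))\<^sup>2
     + \<kappa> * (nrm (omega M) (grad M (half P n)))\<^sup>2)"

text \<open>\<open>energy \<dots> m\<close> is the discrete energy at the time levels up to \<open>m+1\<close>.\<close>

definition energy where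
  "energy M \<sigma> CCoer a0 d0 \<gamma> \<gamma>0 a1 b1 c1 a2 \<kappa> \<tau> U \<Theta> P m =
     (nrm (omega M) (dt1 \<tau> U m))\<^sup>2
     + a0 * (nrm (omega M) (grad M (dt1 \<tau> U m)))\<^sup>2
     + d0 * CCoer * (hnorm M \<sigma> (half U m))\<^sup>2
     + (a1 - \<bar>\<gamma>\<bar> / \<gamma>0) * (nrm (omega M) (\<Theta> (m + 1)))\<^sup>2
     + (a2 - \<bar>\<gamma>\<bar> * \<gamma>0) * (nrm (omega M) (P (m + 1)))\<^sup>2
     + dissipation M b1 c1 \<kappa> \<tau> \<Theta> P m"

definition displacement_data where
  "displacement_data M \<sigma> CCont a0 d0 T \<tau> U f =
     6 * (nrm (omega M) (dt1 \<tau> U 0))\<^sup>2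
     + 4 * a0 * (nrm (omega M) (grad M (dt1 \<tau> U 0)))\<^sup>2
     + 4 * d0 * CCont * (hnorm M \<sigma> (half U 0))\<^sup>2
     + 4 * T\<^sup>2 * (Linf_L2_norm T (omega M) f)\<^sup>2"

definition temperature_data where
  "temperature_data M \<gamma> \<gamma>0 a1 c1 T \<tau> \<Theta> \<phi> =
     1/2 * (3 * a1 + \<bar>\<gamma>\<bar> / \<gamma>0) * (nrm (omega M) (\<Theta> 1))\<^sup>2
     + c1 * \<tau> * (nrm (omega M) (grad M (half \<Theta> 0)))\<^sup>2
     + T\<^sup>2 / (a1 - \<bar>\<gamma>\<bar> / \<gamma>0) * (Linf_L2_norm T (omega M) \<phi>)\<^sup>2"

definition pressure_data where
  "pressure_data M \<gamma> \<gamma>0 a2 \<kappa> T \<tau> P g =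
     1/2 * (3 * a2 + \<bar>\<gamma>\<bar> * \<gamma>0) * (nrm (omega M) (P 1))\<^sup>2
     + \<kappa> * \<tau> * (nrm (omega M) (grad M (half P 0)))\<^sup>2
     + T\<^sup>2 / (a2 - \<bar>\<gamma>\<bar> * \<gamma>0) * (Linf_L2_norm T (omega M) g)\<^sup>2"

end

theory Submission
  imports Defs
begin

text \<open>Test the displacement equation at level \<open>n\<close> with the mean of the difference quotients at
  \<open>n + 1/2\<close> and \<open>n - 1/2\<close>, multiply it by \<open>4 \<Delta>t\<close>, and add \<open>\<Delta>t\<close> times the temperature and pressure
  equations tested with their own half-level values. With this weighting the couplings that are implicit in
  both factors cancel. Of the others, those with the old difference quotient are controlled
  explicitly, and in those with the old temperature or pressure gradient and the new difference
  quotient a fraction \<open>K \<Delta>t / (1 + K \<Delta>t) < 1\<close> of the new energy is absorbed, at the price of the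
  factor \<open>1 + K \<Delta>t\<close> on the old gradient energy. A discrete Gronwall argument then gives the bound
  with \<open>K = 1/T + (\<alpha>\<^sup>2/c1 + \<beta>\<^sup>2/\<kappa>)/a0\<close> and \<open>C = 4 exp (2KT)\<close> for every step size.

  For piecewise polynomials the weak derivatives on each triangle are the classical ones, by
  integration by parts, and traces are values of continuous extensions; this makes all forms in the
  scheme bilinear on the discrete spaces.\<close>

section \<open>Partial derivatives and integration by parts\<close>

text \<open>The obstacle is a mismatch of averages: the displacement equation averages
  \<open>\<Theta>\<close> and \<open>P\<close> over three levels, the other two equations over two.
  After testing, the displacement equation contains all four products of a new or old half-level
  gradient with a new or old difference quotient, for temperature and for pressure, while the tested
  temperature and pressure equations contain only the product new with new. Three products of each
  kind therefore remain.

  Put \<open>q = 1 + K \<Delta>t\<close>. The new energy reappears on the right with weight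
  \<open>K \<Delta>t / q\<close>, and \<open>q (1 - K \<Delta>t / q) = 1\<close>, so its absorption
  never asks for a small step. In \<open>K\<close>, the part over \<open>a0\<close> makes
  \<open>K a0\<close> dominate the Young remainders of the couplings, and \<open>1/T\<close> ensures
  \<open>1/K \<le> T\<close>, which turns the accumulated sources into multiples of
  \<open>T^2\<close>. A step costs a factor \<open>q^2 \<le> exp (2 K \<Delta>t)\<close>, and the
  steps together cover at most the time \<open>T\<close>. The leading 4 pays for the smallest weight
  in the controlled quantity, a quarter on the accumulated dissipation.\<close>

lemma pd_eqI: "(f has_derivative D) (at x) \<Longrightarrow> pd i f x = D (axis i 1)"
  by (simp add: pd_def frechet_derivative_at[symmetric])

lemma pd_has_derivative:
  assumes "f differentiable (at x)"
  shows "((\<lambda>t. f (x + t *\<^sub>R axis i 1)) has_real_derivative pd i f x) (at 0)"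
proof -
  have f: "(f has_derivative frechet_derivative f (at x)) (at x)"
    using assms frechet_derivative_works by blast
  then have "bounded_linear (frechet_derivative f (at x))"
    by (rule has_derivative_bounded_linear)
  then have lin: "linear (frechet_derivative f (at x))"
    by (rule bounded_linear.linear)
  have "((f \<circ> (\<lambda>t. x + t *\<^sub>R axis i 1)) has_derivative
      (frechet_derivative f (at x) \<circ> (\<lambda>t. t *\<^sub>R axis i 1))) (at 0)"
    by (rule diff_chain_at) (auto intro!: derivative_eq_intros simp: f)
  then show ?thesis
    unfolding has_field_derivative_def o_def pd_def
    by (simp add: linear_scale[OF lin] mult_commute_abs)
qed

lemma pd_lincomb:
  assumes "f differentiable (at x)" "g differentiable (at x)"
  shows "pd i (\<lambda>x. a * f x + b * g x) x = a * pd i f x + b * pd i g x"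
  by (subst pd_eqI[where D="\<lambda>h. a * frechet_derivative f (at x) h + b * frechet_derivative g (at x) h"])
     (use assms in \<open>auto intro!: derivative_eq_intros simp: frechet_derivative_works pd_def\<close>)

lemma pd_add:
  assumes "f differentiable (at x)" "g differentiable (at x)"
  shows "pd i (\<lambda>x. f x + g x) x = pd i f x + pd i g x"
  using pd_lincomb[OF assms, of i 1 1] by simp

lemma pd_mult:
  assumes "f differentiable (at x)" "g differentiable (at x)"
  shows "pd i (\<lambda>x. f x * g x) x = f x * pd i g x + pd i f x * g x"
  by (subst pd_eqI[where D="\<lambda>h. f x * frechet_derivative g (at x) h + frechet_derivative f (at x) h * g x"])
     (use assms in \<open>auto intro!: derivative_eq_intros simp: frechet_derivative_works pd_def\<close>)

lemma pd_const [simp]: "pd i (\<lambda>x. c) = (\<lambda>x. 0)"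
  by (simp add: pd_def)

lemma pds_Nil [simp]: "pds [] f = f" and pds_Cons [simp]: "pds (i # is) f = pd i (pds is f)"
  by (simp_all add: pds_def)

lemma pds_append: "pds (is @ js) f = pds is (pds js f)"
  by (simp add: pds_def)

lemma pd_linear: "bounded_linear f \<Longrightarrow> pd i f = (\<lambda>x. f (axis i 1))"
  by (auto simp: fun_eq_iff intro!: pd_eqI bounded_linear_imp_has_derivative)

lemma pd_cong_open:
  assumes "open S" "x \<in> S" "\<And>y. y \<in> S \<Longrightarrow> f y = g y" "g differentiable (at x)"
  shows "pd i f x = pd i g x"
  unfolding pd_def
  using frechet_derivative_transform_within_open[OF assms(4,1,2), of f] assms(3) by simp

lemma real_polynomial_function_differentiable:
  "real_polynomial_function p \<Longrightarrow> p differentiable (at x)"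
  by (simp add: differentiable_at_real_polynomial_function)

lemma pd_polynomial:
  assumes "real_polynomial_function p"
  shows "real_polynomial_function (pd i p)"
  using assms
proof induction
  case (add f g)
  then have "pd i (\<lambda>x. f x + g x) = (\<lambda>x. pd i f x + pd i g x)"
    by (auto simp: fun_eq_iff pd_add real_polynomial_function_differentiable)
  with add show ?case by auto
next
  case (mult f g)
  then have "pd i (\<lambda>x. f x * g x) = (\<lambda>x. f x * pd i g x + pd i f x * g x)"
    by (auto simp: fun_eq_iff pd_mult real_polynomial_function_differentiable)
  with mult show ?case by auto
qed (auto simp: pd_linear)

lemma pds_polynomial: "real_polynomial_function p \<Longrightarrow> real_polynomial_function (pds is p)"
  by (induction "is") (auto intro: pd_polynomial)

text \<open>Induction on the construction of a polynomial replaces Schwarz's theorem: the sum and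
  product rules reduce the symmetry to the constituents.\<close>

lemma pd_commute_polynomial:
  assumes "real_polynomial_function p"
  shows "pd i (pd j p) = pd j (pd i p)"
  using assms
proof induction
  case (add f g)
  have "pd i (\<lambda>x. f x + g x) = (\<lambda>x. pd i f x + pd i g x)" for i
    using add by (auto simp: fun_eq_iff pd_add real_polynomial_function_differentiable)
  then show ?case
    using add by (auto simp: fun_eq_iff pd_add real_polynomial_function_differentiable pd_polynomial)
next
  case (mult f g)
  have 1: "pd i (\<lambda>x. f x * g x) = (\<lambda>x. f x * pd i g x + pd i f x * g x)" for i
    using mult by (auto simp: fun_eq_iff pd_mult real_polynomial_function_differentiable)
  have rp: "real_polynomial_function f" "real_polynomial_function g"
    "real_polynomial_function (pd i f)" "real_polynomial_function (pd i g)" for i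
    using mult by (auto intro: pd_polynomial)
  have 2: "pd j (\<lambda>x. f x * pd i g x + pd i f x * g x) =
     (\<lambda>x. (f x * pd j (pd i g) x + pd j f x * pd i g x) + (pd i f x * pd j g x + pd j (pd i f) x * g x))" for i j
    using rp
    by (auto simp: fun_eq_iff pd_add pd_mult real_polynomial_function_differentiable
        intro!: real_polynomial_function_differentiable)
  show ?case unfolding 1 2 using mult by (simp add: algebra_simps)
qed (auto simp: pd_linear)

text \<open>Integration by parts takes the outermost derivative off the test function and applies it
  first to the polynomial, hence innermost. This lemma restores the order of the index list.\<close>

lemma pd_pds_commute_polynomial:
  assumes "real_polynomial_function p"
  shows "pds is (pd i p) = pd i (pds is p)"
  by (induction "is") (use assms pd_commute_polynomial pds_polynomial in auto)

lemma pds_eq_polynomial_on_open: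
  assumes "open S" "real_polynomial_function p" "\<And>y. y \<in> S \<Longrightarrow> v y = p y" "x \<in> S"
  shows "pds is v x = pds is p x"
  using assms(4)
proof (induction "is" arbitrary: x)
  case (Cons i "is")
  then show ?case
    using assms by (auto intro!: pd_cong_open[OF assms(1)] real_polynomial_function_differentiable pds_polynomial)
qed (use assms in auto)

lemma poly_deg_le_polynomial: "poly_deg_le r p \<Longrightarrow> real_polynomial_function p"
proof -
  assume "poly_deg_le r p"
  then obtain c where c: "p = (\<lambda>x. \<Sum>(i, j) | i + j \<le> r. c i j * (x $ 1) ^ i * (x $ 2) ^ j)"
    unfolding poly_deg_le_def by (auto simp: fun_eq_iff)
  have fin: "finite {(i::nat, j::nat). i + j \<le> r}"
    by (rule finite_subset[of _ "{..r} \<times> {..r}"]) auto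
  have co: "real_polynomial_function (\<lambda>x::pt. x $ k)" for k
    by (intro real_polynomial_function.intros(1) bounded_linear_vec_nth)
  have "real_polynomial_function (\<lambda>x::pt. \<Sum>z\<in>{(i, j). i + j \<le> r}. c (fst z) (snd z) * (x $ 1) ^ fst z * (x $ 2) ^ snd z)"
    by (intro real_polynomial_function_sum fin real_polynomial_function.intros(2,4)
        real_polynomial_function_power co)
  then show ?thesis by (simp add: c case_prod_beta)
qed

section \<open>Supports and test functions\<close>

lemma pd_zero_outside_support:
  assumes "x \<notin> closure {x. f x \<noteq> 0}"
  shows "pd i f x = 0"
proof -
  have "pd i f x = pd i (\<lambda>x. 0) x"
    by (rule pd_cong_open[of "- closure {x. f x \<noteq> 0}"])
       (use assms closure_subset[of "{x. f x \<noteq> 0}"] in auto)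
  then show ?thesis by simp
qed

lemma pds_support: "closure {x. pds is f x \<noteq> 0} \<subseteq> closure {x. f x \<noteq> 0}"
proof (induction "is")
  case (Cons i "is")
  have "{x. pd i (pds is f) x \<noteq> 0} \<subseteq> closure {x. pds is f x \<noteq> 0}"
    using pd_zero_outside_support by blast
  from closure_minimal[OF this closed_closure] Cons.IH show ?case by simp
qed auto

lemma pds_test_function:
  assumes "\<phi> \<in> test_functions A"
  shows "pds is \<phi> \<in> test_functions A"
proof -
  have c: "compact (closure {x. \<phi> x \<noteq> 0})"
    using assms by (simp add: test_functions_def)
  have "compact (closure {x. \<phi> x \<noteq> 0} \<inter> closure {x. pds is \<phi> x \<noteq> 0})"
    by (rule compact_Int_closed[OF c closed_closure])
  then have "compact (closure {x. pds is \<phi> x \<noteq> 0})"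
    using pds_support[of "is" \<phi>] by (simp only: Int_absorb1)
  then show ?thesis
    using assms pds_support[of "is" \<phi>] unfolding test_functions_def
    by (auto simp flip: pds_append)
qed

lemma test_function_differentiable: "\<phi> \<in> test_functions A \<Longrightarrow> pds is \<phi> differentiable (at x)"
  unfolding test_functions_def differentiable_on_def by auto

lemma differentiable_continuous: "(\<And>x. f differentiable (at x)) \<Longrightarrow> continuous_on UNIV f"
  by (simp add: continuous_on_eq_continuous_within differentiable_imp_continuous_within)

lemma test_function_continuous: "\<phi> \<in> test_functions A \<Longrightarrow> continuous_on UNIV (pds is \<phi>)"
  using test_function_differentiable by (blast intro: differentiable_continuous)

text \<open>Mean value theorem along a coordinate line. It supplies the bound on difference
  quotients, uniform in the step, that dominated convergence asks for.\<close>

lemma pd_line_bound: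
  fixes \<psi> :: sfun
  assumes "\<And>x. \<psi> differentiable (at x)" "\<And>x. \<bar>pd i \<psi> x\<bar> \<le> B" "t > 0"
  shows "\<bar>\<psi> (x + t *\<^sub>R axis i 1) - \<psi> x\<bar> \<le> t * B"
proof -
  have "((\<lambda>t. \<psi> (x + t *\<^sub>R axis i 1)) has_real_derivative pd i \<psi> (x + s *\<^sub>R axis i 1)) (at s)" for s
  proof -
    have "((\<lambda>t. \<psi> ((x + s *\<^sub>R axis i 1) + t *\<^sub>R axis i 1)) has_real_derivative
        pd i \<psi> (x + s *\<^sub>R axis i 1)) (at 0)"
      by (rule pd_has_derivative) (rule assms)
    then have "((\<lambda>t. \<psi> (x + (s + t) *\<^sub>R axis i 1)) has_real_derivative
        pd i \<psi> (x + s *\<^sub>R axis i 1)) (at 0)"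
      by (simp add: algebra_simps)
    then show ?thesis
      using DERIV_at_within_shift[of "\<lambda>t. \<psi> (x + t *\<^sub>R axis i 1)" _ s 0 UNIV] by simp
  qed
  from MVT2[of 0 t, OF assms(3) this]
  obtain z where "\<psi> (x + t *\<^sub>R axis i 1) - \<psi> x = t * pd i \<psi> (x + z *\<^sub>R axis i 1)"
    by auto
  with assms show ?thesis by (simp add: abs_mult mult_left_mono)
qed

text \<open>The difference quotients of a compactly supported function have zero integral by
  translation invariance, and they converge dominatedly to the derivative.\<close>

lemma integral_pd_compact_support:
  fixes \<psi> :: sfun
  assumes diff: "\<And>x. \<psi> differentiable (at x)" and cont: "continuous_on UNIV (pd i \<psi>)"
    and supp: "compact S" "\<And>x. x \<notin> S \<Longrightarrow> \<psi> x = 0"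
  shows "integral\<^sup>L lborel (pd i \<psi>) = 0"
proof -
  let ?e = "axis i 1 :: pt"
  have cpsi: "continuous_on UNIV \<psi>" using diff by (rule differentiable_continuous)
  have "bounded S" using supp compact_imp_bounded by blast
  then obtain R where R: "\<And>x. x \<in> S \<Longrightarrow> norm x \<le> R" by (auto simp: bounded_iff)
  have pdS: "pd i \<psi> x = 0" if "x \<notin> S" for x
  proof -
    have "closure {x. \<psi> x \<noteq> 0} \<subseteq> S"
      using supp by (intro closure_minimal) (auto simp: compact_imp_closed)
    with that show ?thesis using pd_zero_outside_support by blast
  qed
  have "bounded (pd i \<psi> ` S)"
    using cont supp by (meson compact_continuous_image compact_imp_bounded continuous_on_subset subset_UNIV)
  then obtain B0 where B0: "\<And>x. x \<in> S \<Longrightarrow> \<bar>pd i \<psi> x\<bar> \<le> B0" by (auto simp: bounded_iff)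
  \<comment> \<open>\<open>B0\<close> could be negative if \<open>S\<close> is empty; the dominating
    function must not be.\<close>
  define B where "B = max B0 0"
  have "0 \<le> B" by (simp add: B_def)
  have B: "\<bar>pd i \<psi> x\<bar> \<le> B" for x
    using B0[of x] pdS[of x] by (cases "x \<in> S") (auto simp: B_def)
  define f where "f n x = real (Suc n) * (\<psi> (x + (1 / real (Suc n)) *\<^sub>R ?e) - \<psi> x)" for n x
  have intpsi: "integrable lborel \<psi>"
  proof -
    have "integrable lborel (\<lambda>x. indicator S x *\<^sub>R \<psi> x)"
      using supp cpsi by (intro borel_integrable_compact) (auto intro: continuous_on_subset)
    also have "(\<lambda>x. indicator S x *\<^sub>R \<psi> x) = \<psi>" using supp by (auto simp: indicator_def fun_eq_iff)
    finally show ?thesis .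
  qed
  have shift: "has_bochner_integral lborel (\<lambda>x. \<psi> (x + c)) (integral\<^sup>L lborel \<psi>)" for c
  proof -
    have "has_bochner_integral (distr lborel borel ((+) c)) \<psi> (integral\<^sup>L lborel \<psi>)"
      using intpsi by (simp add: lborel_distr_plus has_bochner_integral_integrable)
    then have "has_bochner_integral lborel (\<lambda>x. \<psi> (c + x)) (integral\<^sup>L lborel \<psi>)"
      using intpsi
      by (subst (asm) has_bochner_integral_iff, subst has_bochner_integral_iff)
         (simp add: integrable_distr_eq integral_distr)
    then show ?thesis by (simp add: add.commute)
  qed
  have f0: "integral\<^sup>L lborel (f n) = 0" for n
  proof -
    have "has_bochner_integral lborel (f n)
        (real (Suc n) * (integral\<^sup>L lborel \<psi> - integral\<^sup>L lborel \<psi>))"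
      unfolding f_def
      by (intro has_bochner_integral_mult_right has_bochner_integral_diff shift
          has_bochner_integral_integrable intpsi)
    then show ?thesis using has_bochner_integral_integral_eq by fastforce
  qed
  \<comment> \<open>The shifts have length at most 1, so all quotients vanish outside the ball of
    radius \<open>R + 1\<close>, and one integrable majorant serves every \<open>n\<close>.\<close>
  have fB: "norm (f n x) \<le> B * indicator (cball 0 (R + 1)) x" for n x
  proof (cases "x \<in> cball 0 (R + 1)")
    case True
    have "\<bar>\<psi> (x + (1 / real (Suc n)) *\<^sub>R ?e) - \<psi> x\<bar> \<le> (1 / real (Suc n)) * B"
      by (rule pd_line_bound[OF diff B]) simp
    then have "real (Suc n) * \<bar>\<psi> (x + (1 / real (Suc n)) *\<^sub>R ?e) - \<psi> x\<bar>
        \<le> real (Suc n) * ((1 / real (Suc n)) * B)"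
      by (rule mult_left_mono) simp
    with True show ?thesis by (simp add: f_def abs_mult)
  next
    case False
    then have n: "norm x > R + 1" by simp
    have "norm x \<le> norm (x + (1 / real (Suc n)) *\<^sub>R ?e) + norm ((1 / real (Suc n)) *\<^sub>R ?e)"
      using norm_triangle_ineq4[of "x + (1 / real (Suc n)) *\<^sub>R ?e" "(1 / real (Suc n)) *\<^sub>R ?e"] by simp
    moreover have "norm ((1 / real (Suc n)) *\<^sub>R ?e) \<le> 1" by (simp add: norm_axis_1)
    ultimately have "norm (x + (1 / real (Suc n)) *\<^sub>R ?e) > R" using n by linarith
    then have "x + (1 / real (Suc n)) *\<^sub>R ?e \<notin> S" "x \<notin> S" using R n by force+
    then show ?thesis using supp \<open>0 \<le> B\<close> by (simp add: f_def)
  qed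
  have lim: "(\<lambda>n. f n x) \<longlonglongrightarrow> pd i \<psi> x" for x
  proof -
    have "((\<lambda>t. (\<psi> (x + t *\<^sub>R ?e) - \<psi> x) / t) \<longlongrightarrow> pd i \<psi> x) (at 0)"
      using pd_has_derivative[OF diff, of x i] by (simp add: DERIV_def)
    moreover have "filterlim (\<lambda>n. 1 / real (Suc n)) (at 0) sequentially"
      unfolding filterlim_at using LIMSEQ_Suc[OF lim_1_over_n[where 'a=real]] by simp
    ultimately have "(\<lambda>n. (\<psi> (x + (1 / real (Suc n)) *\<^sub>R ?e) - \<psi> x) / (1 / real (Suc n))) \<longlonglongrightarrow> pd i \<psi> x"
      by (rule filterlim_compose)
    then show ?thesis by (simp add: f_def mult.commute)
  qed
  have bm: "\<psi> \<in> borel_measurable borel" "pd i \<psi> \<in> borel_measurable borel"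
    using cpsi cont by (auto intro: borel_measurable_continuous_onI)
  have "(\<lambda>n. integral\<^sup>L lborel (f n)) \<longlonglongrightarrow> integral\<^sup>L lborel (pd i \<psi>)"
  proof (rule integral_dominated_convergence)
    show "integrable lborel (\<lambda>x::pt. B * indicator (cball 0 (R + 1)) x :: real)"
      using emeasure_bounded_finite[of "cball (0::pt) (R + 1)"]
      by (intro integrable_mult_right integrable_real_indicator) auto
    show "f n \<in> borel_measurable lborel" for n
      unfolding f_def using bm(1) by measurable
    show "pd i \<psi> \<in> borel_measurable lborel" using bm(2) by simp
    show "AE x in lborel. norm (f n x) \<le> B * indicator (cball 0 (R + 1)) x" for n
      using fB by (intro AE_I2)
  qed (simp add: lim)
  then show ?thesis by (simp add: f0 LIMSEQ_const_iff)
qed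

text \<open>For one derivative, the product of the polynomial and the test function has compact
  support, so its partial derivative integrates to zero and the product rule gives the claim. The
  polynomial stays arbitrary in the induction because it changes to its derivative.\<close>

lemma integral_by_parts_test_function:
  assumes p: "real_polynomial_function p" and \<phi>: "\<phi> \<in> test_functions A"
  shows "integral\<^sup>L lborel (\<lambda>x. p x * pds is \<phi> x)
    = (-1) ^ length is * integral\<^sup>L lborel (\<lambda>x. pds is p x * \<phi> x)"
  using p
proof (induction "is" arbitrary: p)
  case (Cons i "is")
  let ?\<chi> = "pds is \<phi>" and ?S = "closure {x. \<phi> x \<noteq> 0}"
  have diff: "p differentiable (at x)" "?\<chi> differentiable (at x)" for x
    using Cons.prems \<phi> by (auto intro: real_polynomial_function_differentiable test_function_differentiable)
  have cont: "continuous_on UNIV p" "continuous_on UNIV (pd i p)"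
      "continuous_on UNIV ?\<chi>" "continuous_on UNIV (pd i ?\<chi>)"
    using Cons.prems test_function_continuous[OF \<phi>, of "is"] test_function_continuous[OF \<phi>, of "i # is"]
    by (auto intro!: differentiable_continuous real_polynomial_function_differentiable pd_polynomial)
  have S: "compact ?S" using \<phi> by (auto simp: test_functions_def)
  have zero: "?\<chi> x = 0" "pd i ?\<chi> x = 0" if "x \<notin> ?S" for x
    using that pds_support[of "is" \<phi>] pds_support[of "i # is" \<phi>]
      closure_subset[of "{x. pds is \<phi> x \<noteq> 0}"] closure_subset[of "{x. pds (i # is) \<phi> x \<noteq> 0}"] by auto
  have pdeq: "pd i (\<lambda>x. p x * ?\<chi> x) = (\<lambda>x. p x * pd i ?\<chi> x + pd i p x * ?\<chi> x)"
    using diff by (auto simp: fun_eq_iff pd_mult)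
  have "integral\<^sup>L lborel (pd i (\<lambda>x. p x * ?\<chi> x)) = 0"
    by (rule integral_pd_compact_support[OF _ _ S])
       (use diff cont zero in \<open>auto simp: pdeq intro!: continuous_intros differentiable_mult\<close>)
  moreover have int: "integrable lborel (\<lambda>x. f x * g x)"
    if "continuous_on UNIV f" "continuous_on UNIV g" "\<And>x. x \<notin> ?S \<Longrightarrow> g x = 0" for f g :: sfun
  proof -
    have "integrable lborel (\<lambda>x. indicator ?S x *\<^sub>R (f x * g x))"
      by (intro borel_integrable_compact S continuous_intros) (use that in \<open>auto intro: continuous_on_subset\<close>)
    also have "(\<lambda>x. indicator ?S x *\<^sub>R (f x * g x)) = (\<lambda>x. f x * g x)"
      using that by (auto simp: indicator_def fun_eq_iff)
    finally show ?thesis .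
  qed
  ultimately have "integral\<^sup>L lborel (\<lambda>x. p x * pd i ?\<chi> x) = - integral\<^sup>L lborel (\<lambda>x. pd i p x * ?\<chi> x)"
    using int[of p "pd i ?\<chi>"] int[of "pd i p" ?\<chi>] cont zero by (simp add: pdeq)
  then show ?case
    using Cons.IH[of "pd i p"] Cons.prems pd_polynomial by (simp add: pd_pds_commute_polynomial)
qed simp

section \<open>Square integrable fields and traces\<close>

text \<open>The analogue of \<open>L2\<close> for vector and matrix fields, so that functions,
  gradients and Hessians share one calculus for \<open>ip\<close>.\<close>

definition L2v :: "pt set \<Rightarrow> (pt \<Rightarrow> 'b::euclidean_space) set" where
  "L2v A = {F. set_borel_measurable lebesgue A F \<and> set_integrable lebesgue A (\<lambda>x. F x \<bullet> F x)}"

lemma L2_eq_L2v: "L2 A = L2v A"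
  by (simp add: L2_def L2v_def power2_eq_square)

lemma set_borel_measurable_inner:
  fixes F G :: "'a \<Rightarrow> 'b::euclidean_space"
  assumes "set_borel_measurable M A F" "set_borel_measurable M A G"
  shows "set_borel_measurable M A (\<lambda>x. F x \<bullet> G x)"
proof -
  have "(\<lambda>x. (indicator A x *\<^sub>R F x) \<bullet> (indicator A x *\<^sub>R G x)) \<in> borel_measurable M"
    using assms unfolding set_borel_measurable_def by measurable
  also have "(\<lambda>x. (indicator A x *\<^sub>R F x) \<bullet> (indicator A x *\<^sub>R G x)) = (\<lambda>x. indicator A x *\<^sub>R (F x \<bullet> G x))"
    by (auto simp: indicator_def)
  finally show ?thesis by (simp add: set_borel_measurable_def)
qed

lemma set_borel_measurable_lincomb:
  fixes F G :: "'a \<Rightarrow> 'b::euclidean_space"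
  assumes "set_borel_measurable M A F" "set_borel_measurable M A G"
  shows "set_borel_measurable M A (\<lambda>x. a *\<^sub>R F x + b *\<^sub>R G x)"
proof -
  have "(\<lambda>x. a *\<^sub>R (indicator A x *\<^sub>R F x) + b *\<^sub>R (indicator A x *\<^sub>R G x)) \<in> borel_measurable M"
    using assms unfolding set_borel_measurable_def by measurable
  then show ?thesis by (simp add: set_borel_measurable_def scaleR_add_right mult.commute)
qed

lemma L2v_inner_integrable:
  assumes "F \<in> L2v A" "G \<in> L2v A"
  shows "set_integrable lebesgue A (\<lambda>x. F x \<bullet> G x)"
proof (rule set_integrable_bound)
  show "set_integrable lebesgue A (\<lambda>x. F x \<bullet> F x + G x \<bullet> G x)"
    using assms by (auto simp: L2v_def)
  show "set_borel_measurable lebesgue A (\<lambda>x. F x \<bullet> G x)"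
    using assms by (intro set_borel_measurable_inner) (auto simp: L2v_def)
  have "\<bar>F x \<bullet> G x\<bar> \<le> F x \<bullet> F x + G x \<bullet> G x" for x
  proof -
    have "0 \<le> (F x + G x) \<bullet> (F x + G x)" "0 \<le> (F x - G x) \<bullet> (F x - G x)"
      "0 \<le> F x \<bullet> F x" "0 \<le> G x \<bullet> G x" by simp_all
    then show ?thesis by (simp add: inner_add_left inner_add_right inner_diff_left inner_diff_right inner_commute)
  qed
  then show "AE x in lebesgue. x \<in> A \<longrightarrow> norm (F x \<bullet> G x) \<le> norm (F x \<bullet> F x + G x \<bullet> G x)"
    by auto
qed

lemma L2v_lincomb:
  assumes "F \<in> L2v A" "G \<in> L2v A"
  shows "(\<lambda>x. a *\<^sub>R F x + b *\<^sub>R G x) \<in> L2v A"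
proof -
  have "(\<lambda>x. (a *\<^sub>R F x + b *\<^sub>R G x) \<bullet> (a *\<^sub>R F x + b *\<^sub>R G x)) =
     (\<lambda>x. a\<^sup>2 * (F x \<bullet> F x) + (2 * a * b) * (F x \<bullet> G x) + b\<^sup>2 * (G x \<bullet> G x))"
    by (auto simp: fun_eq_iff inner_add_left inner_add_right inner_commute power2_eq_square algebra_simps)
  then show ?thesis
    using assms L2v_inner_integrable[OF assms]
    unfolding L2v_def by (auto intro!: set_borel_measurable_lincomb)
qed

lemma ip_commute: "ip A F G = ip A G F"
  by (simp add: ip_def inner_commute)

lemma ip_lincomb_left:
  assumes "F \<in> L2v A" "G \<in> L2v A" "H \<in> L2v A"
  shows "ip A (\<lambda>x. a *\<^sub>R F x + b *\<^sub>R G x) H = a * ip A F H + b * ip A G H"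
  using L2v_inner_integrable[OF assms(1,3)] L2v_inner_integrable[OF assms(2,3)]
  by (simp add: ip_def inner_add_left)

lemma ip_lincomb_right:
  assumes "F \<in> L2v A" "G \<in> L2v A" "H \<in> L2v A"
  shows "ip A H (\<lambda>x. a *\<^sub>R F x + b *\<^sub>R G x) = a * ip A H F + b * ip A H G"
  using ip_lincomb_left[OF assms] by (simp add: ip_commute)

lemma ip_nonneg: "0 \<le> ip A F F"
  unfolding ip_def set_lebesgue_integral_def by (rule integral_nonneg_AE) simp

lemma nrm_sq: "(nrm A F)\<^sup>2 = ip A F F"
  by (simp add: nrm_def ip_nonneg)

lemma nrm_nonneg: "0 \<le> nrm A F"
  by (simp add: nrm_def ip_nonneg)

text \<open>Expand the nonnegative square of the norm of \<open>c F - G\<close>. This and its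
  variants are how all mixed inner products in the energy argument are estimated.\<close>

lemma ip_young:
  assumes "F \<in> L2v A" "G \<in> L2v A" "c > 0"
  shows "ip A F G \<le> c / 2 * ip A F F + 1 / (2 * c) * ip A G G"
proof -
  let ?H = "\<lambda>x. c *\<^sub>R F x + (-1) *\<^sub>R G x"
  have "0 \<le> ip A ?H ?H" by (rule ip_nonneg)
  also have "\<dots> = c\<^sup>2 * ip A F F - 2 * c * ip A F G + ip A G G"
    unfolding ip_lincomb_left[OF assms(1,2) L2v_lincomb[OF assms(1,2)]]
      ip_lincomb_right[OF assms(1,2,1)] ip_lincomb_right[OF assms(1,2,2)] ip_commute[of A G F]
    by (simp add: power2_eq_square algebra_simps)
  finally have "2 * c * ip A F G \<le> c\<^sup>2 * ip A F F + ip A G G" by simp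
  then have "ip A F G \<le> (c\<^sup>2 * ip A F F + ip A G G) / (2 * c)"
    using assms(3) by (simp add: pos_le_divide_eq mult.commute)
  also have "\<dots> = c / 2 * ip A F F + 1 / (2 * c) * ip A G G"
    using assms(3) by (simp add: field_simps power2_eq_square)
  finally show ?thesis .
qed

text \<open>The parallelogram inequality in place of the triangle inequality: the factors 2 do not
  matter, since the bound is only used to show that norms tend to zero.\<close>

lemma nrm_lincomb_le:
  assumes "F \<in> L2v A" "G \<in> L2v A"
  shows "nrm A (\<lambda>x. a *\<^sub>R F x + b *\<^sub>R G x) \<le> sqrt (2 * a\<^sup>2 * (nrm A F)\<^sup>2 + 2 * b\<^sup>2 * (nrm A G)\<^sup>2)"
proof -
  have exp: "ip A (\<lambda>x. a *\<^sub>R F x + b *\<^sub>R G x) (\<lambda>x. a *\<^sub>R F x + b *\<^sub>R G x) =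
      a\<^sup>2 * ip A F F + 2 * (a * b) * ip A F G + b\<^sup>2 * ip A G G" for a b
    unfolding ip_lincomb_left[OF assms L2v_lincomb[OF assms]]
      ip_lincomb_right[OF assms assms(1)] ip_lincomb_right[OF assms assms(2)] ip_commute[of A G F]
    by (simp add: power2_eq_square algebra_simps)
  have "0 \<le> ip A (\<lambda>x. a *\<^sub>R F x + (-b) *\<^sub>R G x) (\<lambda>x. a *\<^sub>R F x + (-b) *\<^sub>R G x)"
    by (rule ip_nonneg)
  then have "2 * (a * b) * ip A F G \<le> a\<^sup>2 * ip A F F + b\<^sup>2 * ip A G G"
    unfolding exp by simp
  then show ?thesis unfolding nrm_sq unfolding nrm_def exp
    by (intro real_sqrt_le_mono) (simp add: algebra_simps)
qed

section \<open>Bounded Borel fields and their traces\<close>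

lemma set_integrable_bounded:
  fixes f :: "pt \<Rightarrow> 'b::euclidean_space"
  assumes "f \<in> borel_measurable borel" "bounded (range f)" "bounded A" "A \<in> sets lebesgue"
  shows "set_integrable lebesgue A f"
proof -
  obtain B where B: "\<And>x. norm (f x) \<le> B" using assms(2) by (auto simp: bounded_iff)
  have "A \<in> lmeasurable" using assms by (simp add: bounded_set_imp_lmeasurable)
  then have int: "integrable lebesgue (\<lambda>x. B * indicator A x)"
    by (intro integrable_mult_right integrable_real_indicator) (auto simp: fmeasurable_def)
  have [measurable]: "f \<in> borel_measurable lebesgue"
    using assms(1) by (simp add: measurable_completion)
  have [measurable]: "A \<in> sets lebesgue" by fact
  show ?thesis unfolding set_integrable_def
  proof (rule Bochner_Integration.integrable_bound[OF int])
    show "(\<lambda>x. indicator A x *\<^sub>R f x) \<in> borel_measurable lebesgue" by measurable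
    have "norm (f x) \<le> \<bar>B\<bar>" for x using B[of x] by linarith
    then show "AE x in lebesgue. norm (indicator A x *\<^sub>R f x) \<le> norm (B * indicator A x)"
      by (auto simp: indicator_def)
  qed
qed

lemma bounded_borel_L2v:
  fixes F :: "pt \<Rightarrow> 'b::euclidean_space"
  assumes "F \<in> borel_measurable borel" "bounded (range F)" "bounded A" "A \<in> sets lebesgue"
  shows "F \<in> L2v A"
proof -
  obtain B where B: "\<And>x. norm (F x) \<le> B" using assms(2) by (auto simp: bounded_iff)
  have [measurable]: "F \<in> borel_measurable borel" by fact
  have "bounded (range (\<lambda>x. F x \<bullet> F x))"
    unfolding bounded_iff using B by (intro exI[of _ "B\<^sup>2"]) (auto simp: dot_square_norm power_mono)
  moreover have "(\<lambda>x. F x \<bullet> F x) \<in> borel_measurable borel" by measurable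
  ultimately have "set_integrable lebesgue A (\<lambda>x. F x \<bullet> F x)"
    using assms by (intro set_integrable_bounded) auto
  moreover have "set_borel_measurable lebesgue A F"
    using set_integrable_bounded[OF assms] unfolding set_integrable_def set_borel_measurable_def by auto
  ultimately show ?thesis by (simp add: L2v_def)
qed

text \<open>Near \<open>x\<close> the continuous \<open>G\<close> differs little from
  \<open>G x\<close>, so the means over \<open>ball x r \<inter> K\<close> do too. Replacing
  \<open>F\<close> by \<open>G\<close> is harmless because they can differ in \<open>K\<close> only
  on its boundary, a null set by convexity.\<close>

lemma trace_from_eqI:
  fixes F :: "pt \<Rightarrow> 'b::euclidean_space"
  assumes K: "convex K" "closed K" "interior K \<noteq> {}" "x \<in> K"
    and F: "F \<in> borel_measurable borel" "bounded (range F)"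
    and G: "continuous_on UNIV G" "\<And>y. y \<in> interior K \<Longrightarrow> F y = G y"
  shows "trace_from K F x = G x"
proof -
  let ?D = "\<lambda>r. ball x r \<inter> K"
  have D: "?D r \<in> lmeasurable" for r
    using K by (intro bounded_set_imp_lmeasurable) (auto simp: bounded_Int)
  \<comment> \<open>The means divide by this measure. A convex set with interior points lies in the
    closure of its interior, so every ball about \<open>x\<close> meets an open part of
    \<open>K\<close>.\<close>
  have pos: "measure lebesgue (?D r) > 0" if "r > 0" for r
  proof -
    have "x \<in> closure (interior K)" using K by (simp add: convex_closure_interior)
    then obtain y where "y \<in> interior K" "dist y x < r"
      using \<open>0 < r\<close> unfolding closure_approachable by blast
    then have ne: "ball x r \<inter> interior K \<noteq> {}"
      by (auto simp: dist_commute)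
    have "\<not> negligible (ball x r \<inter> interior K)"
      by (rule open_not_negligible) (use ne in auto)
    then have "\<not> negligible (?D r)"
      using interior_subset by (meson Int_mono negligible_subset order_refl)
    then show ?thesis
      using D[of r] by (simp add: negligible_iff_measure0 zero_less_measure_iff order_less_le)
  qed
  have AEF: "AE y in lebesgue. y \<in> K \<longrightarrow> F y = G y"
  proof -
    have "negligible (frontier K)" using K by (simp add: negligible_convex_frontier)
    then have "AE y in lebesgue. y \<notin> frontier K"
      by (intro AE_not_in) (simp add: negligible_iff_null_sets)
    then show ?thesis
      by (rule eventually_mono) (use K G in \<open>auto simp: frontier_def\<close>)
  qed
  have intD: "set_integrable lebesgue (?D r) F" for r
    using D[of r] by (intro set_integrable_bounded F) (auto simp: fmeasurable_def bounded_Int)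
  have intc: "integrable lebesgue (\<lambda>y. indicator (?D r) y *\<^sub>R c)" for r and c :: "'c::euclidean_space"
    using D[of r] by (intro integrable_scaleR_left integrable_real_indicator) (auto simp: fmeasurable_def)
  have "((\<lambda>r. (LINT y:?D r|lebesgue. F y) /\<^sub>R measure lebesgue (?D r)) \<longlongrightarrow> G x) (at_right 0)"
  proof (rule tendstoI)
    fix e :: real assume e: "e > 0"
    have "isCont G x" using G by (simp add: continuous_on_eq_continuous_at)
    then obtain d where d: "d > 0" "\<And>y. dist y x < d \<Longrightarrow> dist (G y) (G x) < e / 2"
      unfolding continuous_at_eps_delta using e by (meson half_gt_zero)
    have main: "dist ((LINT y:?D r|lebesgue. F y) /\<^sub>R measure lebesgue (?D r)) (G x) < e"
      if r: "0 < r" "r < d" for r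
    proof -
      let ?m = "measure lebesgue (?D r)"
      have "norm (integral\<^sup>L lebesgue (\<lambda>y. indicator (?D r) y *\<^sub>R F y - indicator (?D r) y *\<^sub>R G x))
          \<le> integral\<^sup>L lebesgue (\<lambda>y. indicator (?D r) y *\<^sub>R (e / 2))"
      proof (rule order_trans[OF integral_norm_bound], rule integral_mono_AE)
        show "integrable lebesgue (\<lambda>y. norm (indicator (?D r) y *\<^sub>R F y - indicator (?D r) y *\<^sub>R G x))"
          using intD[of r] intc unfolding set_integrable_def
          by (intro integrable_norm Bochner_Integration.integrable_diff)
        show "AE y in lebesgue. norm (indicator (?D r) y *\<^sub>R F y - indicator (?D r) y *\<^sub>R G x)
            \<le> indicator (?D r) y *\<^sub>R (e / 2)"
          using AEF
        proof eventually_elim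
          case (elim y)
          show ?case
          proof (cases "y \<in> ?D r")
            case True
            then have "dist (G y) (G x) < e / 2" using r by (intro d) (auto simp: dist_commute)
            with True elim show ?thesis by (simp add: dist_norm)
          qed simp
        qed
      qed (rule intc)
      also have "integral\<^sup>L lebesgue (\<lambda>y. indicator (?D r) y *\<^sub>R F y - indicator (?D r) y *\<^sub>R G x)
          = (LINT y:?D r|lebesgue. F y) - ?m *\<^sub>R G x"
        using intD[of r] intc[of r "G x"] intc[of r "1::real"] D[of r]
        unfolding set_integrable_def set_lebesgue_integral_def by (simp add: fmeasurable_def)
      also have "integral\<^sup>L lebesgue (\<lambda>y. indicator (?D r) y *\<^sub>R (e / 2)) = ?m * (e / 2)"
        using D[of r] by (simp add: fmeasurable_def)
      finally have *: "norm ((LINT y:?D r|lebesgue. F y) - ?m *\<^sub>R G x) \<le> ?m * (e / 2)" .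
      have "(LINT y:?D r|lebesgue. F y) /\<^sub>R ?m - G x = ((LINT y:?D r|lebesgue. F y) - ?m *\<^sub>R G x) /\<^sub>R ?m"
        using pos[OF r(1)] by (simp add: scaleR_diff_right)
      then have "norm ((LINT y:?D r|lebesgue. F y) /\<^sub>R ?m - G x)
          = norm ((LINT y:?D r|lebesgue. F y) - ?m *\<^sub>R G x) / ?m"
        using pos[OF r(1)] by (simp add: divide_inverse mult.commute)
      also have "\<dots> \<le> (?m * (e / 2)) / ?m"
        using * pos[OF r(1)] by (intro divide_right_mono) auto
      also have "\<dots> < e" using pos[OF r(1)] e by simp
      finally show ?thesis by (simp add: dist_norm)
    qed
    show "\<forall>\<^sub>F r in at_right 0. dist ((LINT y:?D r|lebesgue. F y) /\<^sub>R measure lebesgue (?D r)) (G x) < e"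
      unfolding eventually_at_right_field using main d(1) by blast
  qed
  then show ?thesis unfolding trace_from_def by (intro tendsto_Lim) auto
qed

section \<open>Jumps and averages on a mesh\<close>

lemma mesh_facts:
  assumes "is_mesh M"
  shows mesh_finite: "finite (elems M)"
    and mesh_elem: "\<And>K. K \<in> elems M \<Longrightarrow> convex K \<and> compact K \<and> closed K \<and> interior K \<noteq> {}"
    and mesh_disjoint: "\<And>K L. \<lbrakk>K \<in> elems M; L \<in> elems M; K \<noteq> L\<rbrakk> \<Longrightarrow> interior K \<inter> interior L = {}"
    and mesh_omega: "open (omega M)" "bounded (omega M)"
proof -
  show "finite (elems M)" using assms by (auto simp: is_mesh_def triangulation_def)
  show elem: "convex K \<and> compact K \<and> closed K \<and> interior K \<noteq> {}" if "K \<in> elems M" for K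
  proof -
    have s: "2 simplex K" using assms that by (auto simp: is_mesh_def)
    then have p: "polytope K" by (rule simplex_imp_polytope)
    then have c: "convex K" "compact K" by (simp_all add: polytope_imp_convex polytope_imp_compact)
    \<comment> \<open>A two-dimensional simplex is full-dimensional in the plane, so its relative
      interior, which is never empty, is its interior.\<close>
    have "aff_dim K = 2" using aff_dim_simplex[OF s] by simp
    then have "K \<noteq> {}" "interior K = rel_interior K"
      by (auto simp: interior_rel_interior_gen)
    then have "interior K \<noteq> {}" using rel_interior_eq_empty[OF c(1)] by simp
    with c show ?thesis by (simp add: compact_imp_closed)
  qed
  show "interior K \<inter> interior L = {}" if "K \<in> elems M" "L \<in> elems M" "K \<noteq> L" for K L
  proof (rule ccontr)
    assume ne: "interior K \<inter> interior L \<noteq> {}"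
    have "K \<inter> L face_of K" "L \<inter> K face_of L" using assms that by (auto simp: is_mesh_def triangulation_def)
    \<comment> \<open>The intersection is a face of each triangle, and a proper face misses the
      interior. A common interior point therefore forces equality.\<close>
    then have "K \<inter> L = K" "L \<inter> K = L"
      using ne interior_subset[of K] interior_subset[of L]
        face_of_disjoint_interior[of "K \<inter> L" K] face_of_disjoint_interior[of "L \<inter> K" L] by blast+
    with that show False by auto
  qed
  show "open (omega M)" "bounded (omega M)"
    using assms by (auto simp: is_mesh_def polygonal_lipschitz_domain_def)
qed

text \<open>The trace of a function in this class from a triangle is the value of its continuous
  extension, so jumps and averages are linear on the class.\<close>

definition pw_cont :: "mesh \<Rightarrow> (pt \<Rightarrow> 'b::euclidean_space) \<Rightarrow> bool" where
  "pw_cont M F \<longleftrightarrow> F \<in> borel_measurable borel \<and> bounded (range F) \<and>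
     (\<forall>K\<in>elems M. \<exists>G. continuous_on UNIV G \<and> (\<forall>x\<in>interior K. F x = G x))"

lemma pw_cont_L2v: "is_mesh M \<Longrightarrow> pw_cont M F \<Longrightarrow> F \<in> L2v (omega M)"
  unfolding pw_cont_def using mesh_omega[of M] by (intro bounded_borel_L2v) auto

lemma pw_cont_trace:
  assumes "is_mesh M" "pw_cont M F" "K \<in> elems M" "continuous_on UNIV G"
    "\<And>y. y \<in> interior K \<Longrightarrow> F y = G y" "x \<in> K"
  shows "trace_from K F x = G x"
  using assms mesh_elem[OF assms(1,3)] by (intro trace_from_eqI) (auto simp: pw_cont_def)

lemma pw_cont_trace_continuous:
  fixes F :: "pt \<Rightarrow> 'b::euclidean_space"
  assumes "is_mesh M" "pw_cont M F" "K \<in> elems M"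
  shows "continuous_on K (trace_from K F)"
proof -
  obtain G where G: "continuous_on UNIV G" "\<forall>x\<in>interior K. F x = G x"
    using assms by (auto simp: pw_cont_def)
  then have "trace_from K F x = G x" if "x \<in> K" for x
    using assms that by (intro pw_cont_trace) auto
  with continuous_on_subset[OF G(1) subset_UNIV] show ?thesis by (simp cong: continuous_on_cong)
qed

lemma pw_cont_lincomb:
  fixes F G :: "pt \<Rightarrow> 'b::euclidean_space"
  assumes "pw_cont M F" "pw_cont M G"
  shows "pw_cont M (\<lambda>x. a *\<^sub>R F x + b *\<^sub>R G x)"
  unfolding pw_cont_def
proof (intro conjI ballI)
  show "(\<lambda>x. a *\<^sub>R F x + b *\<^sub>R G x) \<in> borel_measurable borel"
    using assms unfolding pw_cont_def by auto
  obtain B C where "\<And>x. norm (F x) \<le> B" "\<And>x. norm (G x) \<le> C"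
    using assms by (auto simp: pw_cont_def bounded_iff)
  then have "norm (a *\<^sub>R F x + b *\<^sub>R G x) \<le> \<bar>a\<bar> * B + \<bar>b\<bar> * C" for x
    by (intro norm_triangle_le add_mono) (simp_all add: mult_left_mono)
  then show "bounded (range (\<lambda>x. a *\<^sub>R F x + b *\<^sub>R G x))" by (auto simp: bounded_iff)
  fix K assume "K \<in> elems M"
  then obtain F' G' where "continuous_on UNIV F'" "\<forall>x\<in>interior K. F x = F' x"
    "continuous_on UNIV G'" "\<forall>x\<in>interior K. G x = G' x"
    using assms unfolding pw_cont_def by meson
  then show "\<exists>H. continuous_on UNIV H \<and> (\<forall>x\<in>interior K. a *\<^sub>R F x + b *\<^sub>R G x = H x)"
    by (intro exI[of _ "\<lambda>x. a *\<^sub>R F' x + b *\<^sub>R G' x"]) (auto intro!: continuous_intros)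
qed

lemma pw_cont_trace_lincomb:
  fixes F G :: "pt \<Rightarrow> 'b::euclidean_space"
  assumes "is_mesh M" "pw_cont M F" "pw_cont M G" "K \<in> elems M" "x \<in> K"
  shows "trace_from K (\<lambda>x. a *\<^sub>R F x + b *\<^sub>R G x) x = a *\<^sub>R trace_from K F x + b *\<^sub>R trace_from K G x"
proof -
  obtain F' G' where F': "continuous_on UNIV F'" "\<forall>x\<in>interior K. F x = F' x"
    and G': "continuous_on UNIV G'" "\<forall>x\<in>interior K. G x = G' x"
    using assms unfolding pw_cont_def by meson
  have "trace_from K F x = F' x" "trace_from K G x = G' x"
    using assms F' G' by (auto intro!: pw_cont_trace)
  moreover have "trace_from K (\<lambda>x. a *\<^sub>R F x + b *\<^sub>R G x) x = a *\<^sub>R F' x + b *\<^sub>R G' x"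
    using assms F' G' by (intro pw_cont_trace pw_cont_lincomb) (auto intro!: continuous_intros)
  ultimately show ?thesis by simp
qed

lemma edge_adjacent:
  assumes "is_mesh M" "e \<in> edges M"
  shows "kplus M e \<in> elems M" "e \<subseteq> kplus M e"
    "e \<notin> boundary_edges M \<Longrightarrow> kminus M e \<in> elems M \<and> e \<subseteq> kminus M e"
proof -
  show p: "kplus M e \<in> elems M" "e \<subseteq> kplus M e"
    using assms unfolding is_mesh_def by (meson edge_of_imp_subset)+
  assume "e \<notin> boundary_edges M"
  then have "e \<in> interior_edges M" using assms by (simp add: interior_edges_def)
  then have m: "kminus M e \<in> elems M" "e = frontier (kplus M e) \<inter> frontier (kminus M e)"
    using assms unfolding is_mesh_def by blast+
  moreover have "frontier (kminus M e) \<subseteq> kminus M e"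
    using mesh_elem[OF assms(1) m(1)] by (simp add: frontier_subset_closed)
  ultimately show "kminus M e \<in> elems M \<and> e \<subseteq> kminus M e" by blast
qed

lemma
  fixes F G :: "pt \<Rightarrow> 'b::euclidean_space"
  assumes "is_mesh M" "pw_cont M F" "pw_cont M G" "e \<in> edges M" "x \<in> e"
  shows jump_lincomb: "jump M e (\<lambda>x. a *\<^sub>R F x + b *\<^sub>R G x) x = a *\<^sub>R jump M e F x + b *\<^sub>R jump M e G x"
    and average_lincomb:
      "average M e (\<lambda>x. a *\<^sub>R F x + b *\<^sub>R G x) x = a *\<^sub>R average M e F x + b *\<^sub>R average M e G x"
proof -
  note adj = edge_adjacent[OF assms(1,4)]
  have p: "trace_from (kplus M e) (\<lambda>x. a *\<^sub>R F x + b *\<^sub>R G x) x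
      = a *\<^sub>R trace_from (kplus M e) F x + b *\<^sub>R trace_from (kplus M e) G x"
    using assms adj by (intro pw_cont_trace_lincomb) auto
  have m: "trace_from (kminus M e) (\<lambda>x. a *\<^sub>R F x + b *\<^sub>R G x) x
      = a *\<^sub>R trace_from (kminus M e) F x + b *\<^sub>R trace_from (kminus M e) G x"
    if "e \<notin> boundary_edges M"
    using assms adj(3)[OF that] by (intro pw_cont_trace_lincomb) auto
  show "jump M e (\<lambda>x. a *\<^sub>R F x + b *\<^sub>R G x) x = a *\<^sub>R jump M e F x + b *\<^sub>R jump M e G x"
    unfolding jump_def using p m by (simp add: scaleR_diff_right)
  show "average M e (\<lambda>x. a *\<^sub>R F x + b *\<^sub>R G x) x = a *\<^sub>R average M e F x + b *\<^sub>R average M e G x"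
    unfolding average_def using p m by (simp add: scaleR_add_right mult.commute)
qed

lemma
  fixes F :: "pt \<Rightarrow> 'b::euclidean_space"
  assumes "is_mesh M" "pw_cont M F" "e \<in> edges M"
  shows jump_continuous: "continuous_on e (jump M e F)"
    and average_continuous: "continuous_on e (average M e F)"
proof -
  note adj = edge_adjacent[OF assms(1,3)]
  have p: "continuous_on e (trace_from (kplus M e) F)"
    using adj(1,2) pw_cont_trace_continuous[OF assms(1,2)] by (blast intro: continuous_on_subset)
  have m: "continuous_on e (trace_from (kminus M e) F)" if "e \<notin> boundary_edges M"
    using adj(3)[OF that] pw_cont_trace_continuous[OF assms(1,2)] by (blast intro: continuous_on_subset)
  show "continuous_on e (jump M e F)"
    unfolding jump_def using p m by (cases "e \<in> boundary_edges M") (auto intro!: continuous_intros)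
  show "continuous_on e (average M e F)"
    unfolding average_def using p m by (cases "e \<in> boundary_edges M") (auto intro!: continuous_intros)
qed

text \<open>\<open>endpoints\<close> is a choice and means something only once the edge is known to
  be a segment. As a one-dimensional face of a compact convex set, the edge is compact, convex and
  collinear, hence a segment.\<close>

lemma edge_eq_segment:
  assumes "is_mesh M" "e \<in> edges M"
  shows "e = closed_segment (fst (endpoints e)) (snd (endpoints e))"
proof -
  obtain K where K: "K \<in> elems M" "e face_of K" "aff_dim e = 1"
    using assms by (auto simp: edges_def edge_of_def)
  have "convex K" "compact K" using mesh_elem[OF assms(1) K(1)] by auto
  then have "convex e" "compact e" "e \<noteq> {}" "collinear e"
    using K by (auto simp: face_of_imp_convex face_of_imp_compact collinear_aff_dim)
  then obtain a b where "e = closed_segment a b"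
    using compact_convex_collinear_segment by blast
  then have "case (a, b) of (a, b) \<Rightarrow> e = closed_segment a b" by simp
  then have "case (endpoints e) of (a, b) \<Rightarrow> e = closed_segment a b"
    unfolding endpoints_def by (rule someI)
  then show ?thesis by (simp add: case_prod_beta)
qed

lemma edge_point:
  assumes "is_mesh M" "e \<in> edges M" "t \<in> {0..1}"
  shows "linepath (fst (endpoints e)) (snd (endpoints e)) t \<in> e"
  using edge_eq_segment[OF assms(1,2)] linepath_in_path[OF assms(3)] by blast

lemma edge_integral_cong:
  assumes "is_mesh M" "e \<in> edges M" "\<And>x. x \<in> e \<Longrightarrow> f x = g x"
  shows "edge_integral e f = edge_integral e g"
proof -
  have "(LINT t:{0..1}|lebesgue. f (linepath (fst (endpoints e)) (snd (endpoints e)) t))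
      = (LINT t:{0..1}|lebesgue. g (linepath (fst (endpoints e)) (snd (endpoints e)) t))"
    unfolding set_lebesgue_integral_def
    by (rule Bochner_Integration.integral_cong)
       (use assms edge_point[OF assms(1,2)] in \<open>auto simp: indicator_def\<close>)
  then show ?thesis by (simp add: edge_integral_def)
qed

text \<open>Additivity needs both integrals to exist; continuity along the compact edge provides
  this. It is the reason why continuity of jumps and averages is established at all.\<close>

lemma edge_integral_lincomb:
  assumes "is_mesh M" "e \<in> edges M" "continuous_on e f" "continuous_on e g"
  shows "edge_integral e (\<lambda>x. a * f x + b * g x) = a * edge_integral e f + b * edge_integral e g"
proof -
  let ?l = "linepath (fst (endpoints e)) (snd (endpoints e))"
  have int: "set_integrable lebesgue {0..1} (\<lambda>t. f (?l t))" if "continuous_on e f" for f :: sfun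
  proof -
    have "continuous_on {0..1} (f \<circ> ?l)"
      using edge_point[OF assms(1,2)] that
      by (intro continuous_on_compose) (auto intro: continuous_on_subset)
    then have "set_integrable lborel {0..1} (\<lambda>t. f (?l t))"
      by (intro borel_integrable_atLeastAtMost') (simp add: o_def)
    then show ?thesis
      unfolding set_integrable_def by (subst integrable_completion) auto
  qed
  show ?thesis
    unfolding edge_integral_def using int[OF assms(3)] int[OF assms(4)] by (simp add: algebra_simps)
qed

section \<open>Piecewise polynomials and the finite element spaces\<close>

lemma L2v_cong:
  assumes "\<And>x. x \<in> A \<Longrightarrow> F x = G x"
  shows "F \<in> L2v A \<longleftrightarrow> G \<in> L2v A"
proof -
  have "(\<lambda>x. indicator A x *\<^sub>R F x) = (\<lambda>x. indicator A x *\<^sub>R G x)"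
    "(\<lambda>x. indicator A x *\<^sub>R (F x \<bullet> F x)) = (\<lambda>x. indicator A x *\<^sub>R (G x \<bullet> G x) :: real)"
    using assms by (auto simp: indicator_def fun_eq_iff)
  then show ?thesis
    by (simp add: L2v_def set_borel_measurable_def set_integrable_def)
qed

lemma polynomial_lincomb:
  "real_polynomial_function p \<Longrightarrow> real_polynomial_function q \<Longrightarrow>
    real_polynomial_function (\<lambda>x. a * p x + b * q x)"
  by (intro real_polynomial_function.intros(2-4))

lemma polynomial_borel: "real_polynomial_function (p :: sfun) \<Longrightarrow> p \<in> borel_measurable borel"
  by (intro borel_measurable_continuous_onI differentiable_continuous real_polynomial_function_differentiable)

lemma
  fixes q :: sfun
  assumes "real_polynomial_function q" "open S" "bounded S"
  shows indicator_polynomial_borel: "(\<lambda>x. indicator S x * q x) \<in> borel_measurable borel"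
    and indicator_polynomial_bounded: "bounded (range (\<lambda>x. indicator S x * q x))"
proof -
  have [measurable]: "q \<in> borel_measurable borel" "S \<in> sets borel"
    using assms polynomial_borel by auto
  show "(\<lambda>x. indicator S x * q x) \<in> borel_measurable borel" by measurable
  have "continuous_on (closure S) q"
    by (rule continuous_on_subset[OF differentiable_continuous])
       (use assms in \<open>auto intro: real_polynomial_function_differentiable\<close>)
  then have "bounded (q ` closure S)"
    using assms by (intro compact_imp_bounded compact_continuous_image) auto
  then obtain B where B: "\<And>x. x \<in> S \<Longrightarrow> norm (q x) \<le> B"
    using closure_subset[of S] by (auto simp: bounded_iff)
  have "norm (indicator S x * q x) \<le> max B 0" for x
    using B[of x] by (auto simp: indicator_def)
  then show "bounded (range (\<lambda>x. indicator S x * q x))" by (auto simp: bounded_iff)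
qed

text \<open>The aim is that the definition takes its first branch. On the open set \<open>S\<close>
  the classical derivatives of \<open>v\<close> are those of \<open>p\<close>; test functions vanish
  off \<open>S\<close>, so the integrals extend to the whole plane with \<open>p\<close> in place of
  \<open>v\<close>, where integration by parts applies.\<close>

lemma weak_deriv_polynomial:
  assumes S: "open S" "bounded S" and p: "real_polynomial_function p" "\<And>x. x \<in> S \<Longrightarrow> v x = p x"
  shows "weak_deriv S is v = pds is v"
proof -
  have eq: "pds is v x = pds is p x" if "x \<in> S" for x
    by (rule pds_eq_polynomial_on_open[OF S(1) p(1) _ that]) (rule p(2))
  have "(\<lambda>x. indicator S x * pds is p x) \<in> L2v S"
    using S p by (intro bounded_borel_L2v indicator_polynomial_borel indicator_polynomial_bounded
        pds_polynomial) auto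
  then have L2: "pds is v \<in> L2 S"
    unfolding L2_eq_L2v by (subst L2v_cong[where G="\<lambda>x. indicator S x * pds is p x"]) (auto simp: eq)
  have by_parts: "(LINT x:S|lebesgue. v x * pds is \<phi> x) = (-1) ^ length is * (LINT x:S|lebesgue. pds is v x * \<phi> x)"
    if \<phi>: "\<phi> \<in> test_functions S" for \<phi>
  proof -
    have zero: "\<phi> x = 0" "pds is \<phi> x = 0" if "x \<notin> S" for x
    proof -
      have "closure {x. \<phi> x \<noteq> 0} \<subseteq> S" using \<phi> by (simp add: test_functions_def)
      then show "\<phi> x = 0" "pds is \<phi> x = 0"
        using that closure_subset[of "{x. \<phi> x \<noteq> 0}"] closure_subset[of "{x. pds is \<phi> x \<noteq> 0}"]
          pds_support[of "is" \<phi>] by auto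
    qed
    have [measurable]: "p \<in> borel_measurable borel" "pds is p \<in> borel_measurable borel"
      "\<phi> \<in> borel_measurable borel" "pds is \<phi> \<in> borel_measurable borel"
      using p pds_polynomial polynomial_borel test_function_continuous[OF \<phi>, of "is"]
        test_function_continuous[OF \<phi>, of "[]"] by (auto intro: borel_measurable_continuous_onI)
    have "(LINT x:S|lebesgue. v x * pds is \<phi> x) = integral\<^sup>L lebesgue (\<lambda>x. p x * pds is \<phi> x)"
      unfolding set_lebesgue_integral_def
      by (rule Bochner_Integration.integral_cong) (auto simp: indicator_def zero p)
    also have "\<dots> = integral\<^sup>L lborel (\<lambda>x. p x * pds is \<phi> x)" by (rule integral_completion) simp
    also have "\<dots> = (-1) ^ length is * integral\<^sup>L lborel (\<lambda>x. pds is p x * \<phi> x)"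
      by (rule integral_by_parts_test_function[OF p(1) \<phi>])
    also have "integral\<^sup>L lborel (\<lambda>x. pds is p x * \<phi> x) = integral\<^sup>L lebesgue (\<lambda>x. pds is p x * \<phi> x)"
      by (rule integral_completion[symmetric]) simp
    also have "\<dots> = (LINT x:S|lebesgue. pds is v x * \<phi> x)"
      unfolding set_lebesgue_integral_def
      by (rule Bochner_Integration.integral_cong) (auto simp: indicator_def zero eq)
    finally show ?thesis .
  qed
  show ?thesis using L2 by_parts by (simp add: weak_deriv_def is_weak_deriv_def)
qed

text \<open>Without the degree bound and the boundary condition this is one linear space containing
  \<open>Vh\<close> and \<open>Wh\<close>, on which the broken gradient and Hessian are
  linear.\<close>

definition pw_poly :: "mesh \<Rightarrow> sfun set" where
  "pw_poly M = {v. \<forall>K\<in>elems M. \<exists>p. real_polynomial_function p \<and> (\<forall>x\<in>interior K. v x = p x)}"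

lemma Vh_pw_poly: "Vh M \<subseteq> pw_poly M" and Wh_pw_poly: "Wh M \<subseteq> pw_poly M"
  unfolding Vh_def Wh_def pw_poly_def piecewise_poly_def using poly_deg_le_polynomial by blast+

lemma broken_deriv_pds:
  assumes "is_mesh M" "v \<in> pw_poly M"
  shows "broken_deriv M is v = (\<lambda>x. \<Sum>K\<in>elems M. indicator (interior K) x * pds is v x)"
proof -
  have "weak_deriv (interior K) is v = pds is v" if K: "K \<in> elems M" for K
  proof -
    obtain p where "real_polynomial_function p" "\<forall>x\<in>interior K. v x = p x"
      using assms K by (auto simp: pw_poly_def)
    moreover have "bounded (interior K)"
      using mesh_elem[OF assms(1) K] by (meson bounded_subset compact_imp_bounded interior_subset)
    ultimately show ?thesis by (intro weak_deriv_polynomial) auto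
  qed
  then show ?thesis by (simp add: broken_deriv_def)
qed

lemma broken_deriv_interior:
  assumes "is_mesh M" "v \<in> pw_poly M" "K \<in> elems M" "x \<in> interior K"
  shows "broken_deriv M is v x = pds is v x"
proof -
  have "(\<Sum>L\<in>elems M. indicator (interior L) x * pds is v x) = (\<Sum>L\<in>elems M. if L = K then pds is v x else 0)"
    by (rule sum.cong) (use assms mesh_disjoint[OF assms(1,3)] in \<open>auto simp: indicator_def\<close>)
  then show ?thesis using assms mesh_finite by (simp add: broken_deriv_pds)
qed

text \<open>The differentiated polynomial pieces are the continuous extensions. The broken
  derivative is zero outside the open triangles, so it is a finite sum of polynomials cut off to
  bounded open sets, which is Borel and bounded on the whole plane.\<close>

lemma broken_deriv_pw_cont:
  assumes "is_mesh M" "v \<in> pw_poly M"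
  shows "pw_cont M (broken_deriv M is v)"
proof -
  obtain p where p: "\<And>K. K \<in> elems M \<Longrightarrow> real_polynomial_function (p K)"
      "\<And>K x. K \<in> elems M \<Longrightarrow> x \<in> interior K \<Longrightarrow> v x = p K x"
    using assms(2) unfolding pw_poly_def mem_Collect_eq by metis
  have eq: "pds is v x = pds is (p K) x" if "K \<in> elems M" "x \<in> interior K" for K x
    using pds_eq_polynomial_on_open[OF open_interior p(1) p(2)] that by blast
  have bd: "broken_deriv M is v = (\<lambda>x. \<Sum>K\<in>elems M. indicator (interior K) x * pds is (p K) x)"
    unfolding broken_deriv_pds[OF assms]
    by (intro ext sum.cong) (auto simp: indicator_def eq)
  have bdd: "bounded (interior K)" if "K \<in> elems M" for K
    using mesh_elem[OF assms(1) that] by (meson bounded_subset compact_imp_bounded interior_subset)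
  have "broken_deriv M is v \<in> borel_measurable borel"
    unfolding bd using p bdd
    by (intro borel_measurable_sum indicator_polynomial_borel pds_polynomial) auto
  moreover have "bounded (range (broken_deriv M is v))"
  proof -
    have "\<exists>B. \<forall>x. norm (indicator (interior K) x * pds is (p K) x) \<le> B" if "K \<in> elems M" for K
      using indicator_polynomial_bounded[OF pds_polynomial[OF p(1)[OF that]] open_interior bdd[OF that]]
      by (auto simp: bounded_iff)
    then obtain B where "\<And>K x. K \<in> elems M \<Longrightarrow> norm (indicator (interior K) x * pds is (p K) x) \<le> B K"
      by metis
    then have "norm (broken_deriv M is v x) \<le> sum B (elems M)" for x
      unfolding bd by (intro sum_norm_le) auto
    then show ?thesis by (auto simp: bounded_iff)
  qed
  moreover have "\<exists>G. continuous_on UNIV G \<and> (\<forall>x\<in>interior K. broken_deriv M is v x = G x)"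
    if K: "K \<in> elems M" for K
    using assms K p by (intro exI[of _ "pds is (p K)"])
      (auto simp: broken_deriv_interior eq
        intro!: differentiable_continuous real_polynomial_function_differentiable pds_polynomial)
  ultimately show ?thesis by (simp add: pw_cont_def)
qed

lemma pw_poly_lincomb:
  assumes "u \<in> pw_poly M" "v \<in> pw_poly M"
  shows "(\<lambda>x. a * u x + b * v x) \<in> pw_poly M"
  unfolding pw_poly_def
proof (intro CollectI ballI)
  fix K assume "K \<in> elems M"
  then obtain p q where "real_polynomial_function p" "\<forall>x\<in>interior K. u x = p x"
    "real_polynomial_function q" "\<forall>x\<in>interior K. v x = q x"
    using assms unfolding pw_poly_def by blast
  then show "\<exists>p. real_polynomial_function p \<and> (\<forall>x\<in>interior K. a * u x + b * v x = p x)"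
    by (intro exI[of _ "\<lambda>x. a * p x + b * q x"]) (auto intro: polynomial_lincomb)
qed

lemma pds_lincomb_polynomial:
  assumes "real_polynomial_function p" "real_polynomial_function q"
  shows "pds is (\<lambda>x. a * p x + b * q x) = (\<lambda>x. a * pds is p x + b * pds is q x)"
proof (induction "is")
  case (Cons i "is")
  show ?case
    unfolding pds_Cons Cons.IH
    using assms by (intro ext pd_lincomb real_polynomial_function_differentiable pds_polynomial)
qed simp

lemma broken_deriv_lincomb:
  assumes "is_mesh M" "u \<in> pw_poly M" "v \<in> pw_poly M"
  shows "broken_deriv M is (\<lambda>x. a * u x + b * v x) = (\<lambda>x. a * broken_deriv M is u x + b * broken_deriv M is v x)"
proof -
  have "pds is (\<lambda>x. a * u x + b * v x) x = a * pds is u x + b * pds is v x"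
    if K: "K \<in> elems M" and x: "x \<in> interior K" for K x
  proof -
    obtain p q where p: "real_polynomial_function p" "\<forall>x\<in>interior K. u x = p x"
      and q: "real_polynomial_function q" "\<forall>x\<in>interior K. v x = q x"
      using assms K unfolding pw_poly_def by blast
    have "pds is (\<lambda>x. a * u x + b * v x) x = pds is (\<lambda>x. a * p x + b * q x) x"
      by (rule pds_eq_polynomial_on_open[OF open_interior _ _ x]) (use p q in \<open>auto intro: polynomial_lincomb\<close>)
    moreover have "pds is u x = pds is p x" "pds is v x = pds is q x"
      using p q x by (auto intro!: pds_eq_polynomial_on_open[OF open_interior])
    ultimately show ?thesis using p q by (simp add: pds_lincomb_polynomial)
  qed
  then have "indicator (interior K) x * pds is (\<lambda>x. a * u x + b * v x) x =
      a * (indicator (interior K) x * pds is u x) + b * (indicator (interior K) x * pds is v x)"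
    if "K \<in> elems M" for K x
    using that by (auto simp: indicator_def)
  then show ?thesis
    using assms by (auto simp: broken_deriv_pds pw_poly_lincomb sum.distrib sum_distrib_left)
qed

lemma pw_cont_vec:
  fixes F :: "pt \<Rightarrow> 'b::euclidean_space^'n"
  assumes "\<And>i. pw_cont M (\<lambda>x. F x $ i)"
  shows "pw_cont M F"
  unfolding pw_cont_def
proof (intro conjI ballI)
  have [measurable]: "(\<lambda>x. F x $ i) \<in> borel_measurable borel" for i
    using assms by (simp add: pw_cont_def)
  show "F \<in> borel_measurable borel"
    by (subst borel_measurable_euclidean_space) (auto simp: Basis_vec_def inner_axis)
  have "\<forall>i. \<exists>B. \<forall>x. norm (F x $ i) \<le> B" using assms by (simp add: pw_cont_def bounded_iff)
  then obtain B where B: "\<And>i x. norm (F x $ i) \<le> B i" by metis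
  have "norm (F x) \<le> sum B UNIV" for x
  proof -
    have "norm (F x) \<le> (\<Sum>i\<in>UNIV. norm (F x $ i))" by (simp add: norm_vec_def L2_set_le_sum)
    also have "\<dots> \<le> sum B UNIV" by (intro sum_mono B)
    finally show ?thesis .
  qed
  then show "bounded (range F)" by (auto simp: bounded_iff)
  fix K assume "K \<in> elems M"
  then have "\<forall>i. \<exists>G. continuous_on UNIV G \<and> (\<forall>x\<in>interior K. F x $ i = G x)"
    using assms by (simp add: pw_cont_def)
  then obtain G where "\<And>i. continuous_on UNIV (G i)" "\<And>i x. x \<in> interior K \<Longrightarrow> F x $ i = G i x"
    by metis
  then show "\<exists>G. continuous_on UNIV G \<and> (\<forall>x\<in>interior K. F x = G x)"
    by (intro exI[of _ "\<lambda>x. \<chi> i. G i x"]) (auto simp: vec_eq_iff intro!: continuous_on_vec_lambda)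
qed

lemma continuous_on_matrix_vector_mult:
  fixes A :: "'a::topological_space \<Rightarrow> real^'n^'m"
  shows "continuous_on S A \<Longrightarrow> continuous_on S (\<lambda>x. A x *v v)"
  unfolding matrix_vector_mult_def by (intro continuous_intros)

text \<open>The two consistency sums change places and the other terms are symmetric. Linearity in
  the first argument thus yields bilinearity.\<close>

lemma ah_commute: "ah M \<sigma> u v = ah M \<sigma> v u"
  by (simp add: ah_def ip_commute mult.commute)

section \<open>Linearity of gradient, Hessian and \<open>ah\<close> on piecewise polynomials\<close>

context
  fixes M :: mesh
  assumes mesh: "is_mesh M"
begin

lemma grad_pw_cont: "v \<in> pw_poly M \<Longrightarrow> pw_cont M (grad M v)"
  unfolding grad_def by (rule pw_cont_vec) (simp add: broken_deriv_pw_cont[OF mesh])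

lemma hess_pw_cont: "v \<in> pw_poly M \<Longrightarrow> pw_cont M (hess M v)"
  unfolding hess_def by (intro pw_cont_vec) (simp add: broken_deriv_pw_cont[OF mesh])

lemma grad_L2v: "v \<in> pw_poly M \<Longrightarrow> grad M v \<in> L2v (omega M)"
  by (intro pw_cont_L2v grad_pw_cont mesh)

lemma grad_lincomb:
  assumes "u \<in> pw_poly M" "v \<in> pw_poly M"
  shows "grad M (\<lambda>x. a * u x + b * v x) = (\<lambda>x. a *\<^sub>R grad M u x + b *\<^sub>R grad M v x)"
  using broken_deriv_lincomb[OF mesh assms] by (auto simp: grad_def vec_eq_iff fun_eq_iff)

lemma hess_lincomb:
  assumes "u \<in> pw_poly M" "v \<in> pw_poly M"
  shows "hess M (\<lambda>x. a * u x + b * v x) = (\<lambda>x. a *\<^sub>R hess M u x + b *\<^sub>R hess M v x)"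
  using broken_deriv_lincomb[OF mesh assms] by (auto simp: hess_def vec_eq_iff fun_eq_iff)

lemma normal_deriv_lincomb:
  assumes "u \<in> pw_poly M" "v \<in> pw_poly M"
  shows "normal_deriv M e (\<lambda>x. a * u x + b * v x) =
     (\<lambda>x. a *\<^sub>R normal_deriv M e u x + b *\<^sub>R normal_deriv M e v x)"
  using grad_lincomb[OF assms] by (auto simp: normal_deriv_def inner_add_left)

lemma normal_deriv_pw_cont:
  assumes "v \<in> pw_poly M"
  shows "pw_cont M (normal_deriv M e v)"
proof -
  have "normal_deriv M e v = (\<lambda>x. enormal M e $ 1 *\<^sub>R broken_deriv M [1] v x + enormal M e $ 2 *\<^sub>R broken_deriv M [2] v x)"
    by (auto simp: normal_deriv_def grad_def inner_vec_def sum_2)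
  then show ?thesis using pw_cont_lincomb broken_deriv_pw_cont[OF mesh assms] by metis
qed

text \<open>Each of the four terms is treated separately. In the edge terms linearity holds
  pointwise on the edge, by the linearity of traces, and then passes to the integral because the
  integrands are continuous there.\<close>

lemma ah_lincomb_left:
  assumes "u \<in> pw_poly M" "v \<in> pw_poly M" "w \<in> pw_poly M"
  shows "ah M \<sigma> (\<lambda>x. a * u x + b * v x) w = a * ah M \<sigma> u w + b * ah M \<sigma> v w"
proof -
  let ?l = "\<lambda>x. a * u x + b * v x"
  have 1: "ip (omega M) (hess M ?l) (hess M w) = a * ip (omega M) (hess M u) (hess M w) + b * ip (omega M) (hess M v) (hess M w)"
    using assms by (simp add: hess_lincomb ip_lincomb_left pw_cont_L2v[OF mesh] hess_pw_cont)
  have 2: "edge_integral e (\<lambda>x. jump M e (grad M ?l) x \<bullet> (average M e (hess M w) x *v enormal M e)) =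
     a * edge_integral e (\<lambda>x. jump M e (grad M u) x \<bullet> (average M e (hess M w) x *v enormal M e)) +
     b * edge_integral e (\<lambda>x. jump M e (grad M v) x \<bullet> (average M e (hess M w) x *v enormal M e))"
    if e: "e \<in> edges M" for e
  proof -
    have "edge_integral e (\<lambda>x. jump M e (grad M ?l) x \<bullet> (average M e (hess M w) x *v enormal M e)) =
      edge_integral e (\<lambda>x. a * (jump M e (grad M u) x \<bullet> (average M e (hess M w) x *v enormal M e)) +
        b * (jump M e (grad M v) x \<bullet> (average M e (hess M w) x *v enormal M e)))"
      by (rule edge_integral_cong[OF mesh e])
         (use assms e in \<open>simp add: grad_lincomb jump_lincomb[OF mesh] grad_pw_cont inner_add_left\<close>)
    also have "\<dots> = a * edge_integral e (\<lambda>x. jump M e (grad M u) x \<bullet> (average M e (hess M w) x *v enormal M e)) +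
     b * edge_integral e (\<lambda>x. jump M e (grad M v) x \<bullet> (average M e (hess M w) x *v enormal M e))"
      using assms e
      by (intro edge_integral_lincomb[OF mesh e] continuous_on_inner jump_continuous[OF mesh]
          continuous_on_matrix_vector_mult
          average_continuous[OF mesh] grad_pw_cont hess_pw_cont) auto
    finally show ?thesis .
  qed
  have 3: "edge_integral e (\<lambda>x. jump M e (grad M w) x \<bullet> (average M e (hess M ?l) x *v enormal M e)) =
     a * edge_integral e (\<lambda>x. jump M e (grad M w) x \<bullet> (average M e (hess M u) x *v enormal M e)) +
     b * edge_integral e (\<lambda>x. jump M e (grad M w) x \<bullet> (average M e (hess M v) x *v enormal M e))"
    if e: "e \<in> edges M" for e
  proof -
    have "edge_integral e (\<lambda>x. jump M e (grad M w) x \<bullet> (average M e (hess M ?l) x *v enormal M e)) =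
      edge_integral e (\<lambda>x. a * (jump M e (grad M w) x \<bullet> (average M e (hess M u) x *v enormal M e)) +
        b * (jump M e (grad M w) x \<bullet> (average M e (hess M v) x *v enormal M e)))"
      by (rule edge_integral_cong[OF mesh e])
         (use assms e in \<open>simp add: hess_lincomb average_lincomb[OF mesh] hess_pw_cont inner_add_right
            matrix_vector_mult_add_rdistrib scaleR_matrix_vector_assoc[symmetric]\<close>)
    also have "\<dots> = a * edge_integral e (\<lambda>x. jump M e (grad M w) x \<bullet> (average M e (hess M u) x *v enormal M e)) +
     b * edge_integral e (\<lambda>x. jump M e (grad M w) x \<bullet> (average M e (hess M v) x *v enormal M e))"
      using assms e
      by (intro edge_integral_lincomb[OF mesh e] continuous_on_inner jump_continuous[OF mesh]
          continuous_on_matrix_vector_mult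
          average_continuous[OF mesh] grad_pw_cont hess_pw_cont) auto
    finally show ?thesis .
  qed
  have 4: "edge_integral e (\<lambda>x. jump M e (normal_deriv M e ?l) x * jump M e (normal_deriv M e w) x) =
     a * edge_integral e (\<lambda>x. jump M e (normal_deriv M e u) x * jump M e (normal_deriv M e w) x) +
     b * edge_integral e (\<lambda>x. jump M e (normal_deriv M e v) x * jump M e (normal_deriv M e w) x)"
    if e: "e \<in> edges M" for e
  proof -
    have "edge_integral e (\<lambda>x. jump M e (normal_deriv M e ?l) x * jump M e (normal_deriv M e w) x) =
      edge_integral e (\<lambda>x. a * (jump M e (normal_deriv M e u) x * jump M e (normal_deriv M e w) x) +
        b * (jump M e (normal_deriv M e v) x * jump M e (normal_deriv M e w) x))"
      by (rule edge_integral_cong[OF mesh e])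
         (use assms e jump_lincomb[OF mesh normal_deriv_pw_cont normal_deriv_pw_cont e, of u v] in
           \<open>simp add: normal_deriv_lincomb algebra_simps\<close>)
    also have "\<dots> = a * edge_integral e (\<lambda>x. jump M e (normal_deriv M e u) x * jump M e (normal_deriv M e w) x) +
     b * edge_integral e (\<lambda>x. jump M e (normal_deriv M e v) x * jump M e (normal_deriv M e w) x)"
      using assms e
      by (intro edge_integral_lincomb[OF mesh e] continuous_on_mult jump_continuous[OF mesh] normal_deriv_pw_cont)
    finally show ?thesis .
  qed
  let ?A = "\<lambda>u w. \<Sum>e\<in>edges M. edge_integral e
      (\<lambda>x. jump M e (grad M u) x \<bullet> (average M e (hess M w) x *v enormal M e))"
  let ?B = "\<lambda>u. \<Sum>e\<in>edges M. \<sigma> / edge_length e * edge_integral e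
      (\<lambda>x. jump M e (normal_deriv M e u) x * jump M e (normal_deriv M e w) x)"
  have A: "?A ?l w = a * ?A u w + b * ?A v w" "?A w ?l = a * ?A w u + b * ?A w v"
    using 2 3 by (simp_all add: sum_distrib_left sum.distrib)
  have B: "?B ?l = a * ?B u + b * ?B v"
    using 4 by (simp add: sum_distrib_left sum.distrib[symmetric] algebra_simps)
  show ?thesis unfolding ah_def 1 A B by (simp add: algebra_simps)
qed

end

section \<open>Linearity of the Sobolev and finite element spaces\<close>

lemma test_function_L2:
  assumes "\<phi> \<in> test_functions B" "A \<in> sets lebesgue" "bounded A"
  shows "pds is \<phi> \<in> L2v A"
proof (rule bounded_borel_L2v[OF _ _ assms(3,2)])
  have c: "continuous_on UNIV (pds is \<phi>)" by (rule test_function_continuous[OF assms(1)])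
  then show "pds is \<phi> \<in> borel_measurable borel" by (rule borel_measurable_continuous_onI)
  let ?S = "closure {x. pds is \<phi> x \<noteq> 0}"
  have "compact ?S" using pds_test_function[OF assms(1)] by (auto simp: test_functions_def)
  then have "bounded (pds is \<phi> ` ?S)"
    using c by (intro compact_imp_bounded compact_continuous_image) (auto intro: continuous_on_subset)
  moreover have "range (pds is \<phi>) \<subseteq> insert 0 (pds is \<phi> ` ?S)"
    using closure_subset[of "{x. pds is \<phi> x \<noteq> 0}"] by auto
  ultimately show "bounded (range (pds is \<phi>))" by (meson bounded_insert bounded_subset)
qed

lemma pds_lincomb_test_function:
  assumes "\<phi> \<in> test_functions A" "\<psi> \<in> test_functions B"
  shows "pds is (\<lambda>x. a * \<phi> x + b * \<psi> x) = (\<lambda>x. a * pds is \<phi> x + b * pds is \<psi> x)"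
proof (induction "is")
  case (Cons i "is")
  show ?case
    unfolding pds_Cons Cons.IH using assms by (intro ext pd_lincomb test_function_differentiable)
qed simp

lemma test_function_lincomb:
  assumes "\<phi> \<in> test_functions A" "\<psi> \<in> test_functions A"
  shows "(\<lambda>x. a * \<phi> x + b * \<psi> x) \<in> test_functions A"
proof -
  let ?S = "closure {x. \<phi> x \<noteq> 0} \<union> closure {x. \<psi> x \<noteq> 0}"
  have S: "compact ?S" "?S \<subseteq> A" using assms by (auto simp: test_functions_def)
  have "{x. a * \<phi> x + b * \<psi> x \<noteq> 0} \<subseteq> ?S"
  proof -
    have "{x. a * \<phi> x + b * \<psi> x \<noteq> 0} \<subseteq> {x. \<phi> x \<noteq> 0} \<union> {x. \<psi> x \<noteq> 0}" by auto
    also have "\<dots> \<subseteq> ?S" by (intro Un_mono closure_subset)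
    finally show ?thesis .
  qed
  then have sub: "closure {x. a * \<phi> x + b * \<psi> x \<noteq> 0} \<subseteq> ?S"
    by (rule closure_minimal) auto
  have "compact (?S \<inter> closure {x. a * \<phi> x + b * \<psi> x \<noteq> 0})"
    by (rule compact_Int_closed[OF S(1) closed_closure])
  then have "compact (closure {x. a * \<phi> x + b * \<psi> x \<noteq> 0})"
    using sub by (simp only: Int_absorb1)
  moreover have "pds is (\<lambda>x. a * \<phi> x + b * \<psi> x) differentiable_on UNIV" for "is"
    unfolding pds_lincomb_test_function[OF assms] using assms test_function_differentiable
    by (auto simp: differentiable_on_def intro!: derivative_intros)
  ultimately show ?thesis using sub S by (auto simp: test_functions_def)
qed

lemma is_weak_deriv_lincomb:
  assumes A: "A \<in> sets lebesgue" "bounded A" and u: "u \<in> L2 A" "v \<in> L2 A"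
    and g: "is_weak_deriv A is u g" "is_weak_deriv A is v h"
  shows "is_weak_deriv A is (\<lambda>x. a * u x + b * v x) (\<lambda>x. a * g x + b * h x)"
proof -
  have gh: "g \<in> L2v A" "h \<in> L2v A" using g by (auto simp: is_weak_deriv_def L2_eq_L2v)
  have lin: "(LINT x:A|lebesgue. (a * f1 x + b * f2 x) * \<phi> x)
      = a * (LINT x:A|lebesgue. f1 x * \<phi> x) + b * (LINT x:A|lebesgue. f2 x * \<phi> x)"
    if "f1 \<in> L2v A" "f2 \<in> L2v A" "\<phi> \<in> L2v A" for f1 f2 \<phi> :: sfun
    using ip_lincomb_left[OF that, of a b] by (simp add: ip_def)
  have "(LINT x:A|lebesgue. (a * u x + b * v x) * pds is \<phi> x)
      = (-1) ^ length is * (LINT x:A|lebesgue. (a * g x + b * h x) * \<phi> x)"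
    if \<phi>: "\<phi> \<in> test_functions A" for \<phi>
  proof -
    have t: "pds is \<phi> \<in> L2v A" "\<phi> \<in> L2v A"
      using test_function_L2[OF \<phi> A, of "is"] test_function_L2[OF \<phi> A, of "[]"] by simp_all
    show ?thesis
      unfolding lin[OF u[unfolded L2_eq_L2v] t(1)] lin[OF gh t(2)]
      using g \<phi> by (simp add: is_weak_deriv_def distrib_left)
  qed
  moreover have "(\<lambda>x. a * g x + b * h x) \<in> L2 A"
    using L2v_lincomb[OF gh, of a b] by (simp add: L2_eq_L2v)
  ultimately show ?thesis by (simp add: is_weak_deriv_def)
qed

text \<open>Needed so that difference quotients and averages of discrete solutions are admissible as
  test functions. The same combination of the approximating sequences converges, derivative by
  derivative.\<close>

lemma sobolev0_lincomb:
  assumes A: "A \<in> sets lebesgue" "bounded A" and u: "u \<in> sobolev0 k A" "v \<in> sobolev0 k A"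
  shows "(\<lambda>x. a * u x + b * v x) \<in> sobolev0 k A"
proof -
  have L2: "u \<in> L2v A" "v \<in> L2v A" using u by (auto simp: sobolev0_def L2_eq_L2v)
  obtain \<phi> \<psi> where \<phi>: "\<And>n. \<phi> n \<in> test_functions A" "\<And>is. length is \<le> k \<Longrightarrow>
      \<exists>g. is_weak_deriv A is u g \<and> (\<lambda>n. nrm A (\<lambda>x. pds is (\<phi> n) x - g x)) \<longlonglongrightarrow> 0"
    and \<psi>: "\<And>n. \<psi> n \<in> test_functions A" "\<And>is. length is \<le> k \<Longrightarrow>
      \<exists>g. is_weak_deriv A is v g \<and> (\<lambda>n. nrm A (\<lambda>x. pds is (\<psi> n) x - g x)) \<longlonglongrightarrow> 0"
    using u by (auto simp: sobolev0_def)
  have "\<exists>f. is_weak_deriv A is (\<lambda>x. a * u x + b * v x) f \<and>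
      (\<lambda>n. nrm A (\<lambda>x. pds is (\<lambda>x. a * \<phi> n x + b * \<psi> n x) x - f x)) \<longlonglongrightarrow> 0"
    if len: "length is \<le> k" for "is"
  proof -
    obtain g h where g: "is_weak_deriv A is u g" "(\<lambda>n. nrm A (\<lambda>x. pds is (\<phi> n) x - g x)) \<longlonglongrightarrow> 0"
      and h: "is_weak_deriv A is v h" "(\<lambda>n. nrm A (\<lambda>x. pds is (\<psi> n) x - h x)) \<longlonglongrightarrow> 0"
      using \<phi>(2)[OF len] \<psi>(2)[OF len] by blast
    have gh: "g \<in> L2v A" "h \<in> L2v A" using g h by (auto simp: is_weak_deriv_def L2_eq_L2v)
    have err: "(\<lambda>x. pds is (\<phi> n) x - g x) \<in> L2v A" "(\<lambda>x. pds is (\<psi> n) x - h x) \<in> L2v A" for n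
      using L2v_lincomb[OF test_function_L2[OF \<phi>(1) A] gh(1), where a=1 and b="-1"]
        L2v_lincomb[OF test_function_L2[OF \<psi>(1) A] gh(2), where a=1 and b="-1"] by simp_all
    have le: "nrm A (\<lambda>x. pds is (\<lambda>x. a * \<phi> n x + b * \<psi> n x) x - (a * g x + b * h x))
        \<le> sqrt (2 * a\<^sup>2 * (nrm A (\<lambda>x. pds is (\<phi> n) x - g x))\<^sup>2 + 2 * b\<^sup>2 * (nrm A (\<lambda>x. pds is (\<psi> n) x - h x))\<^sup>2)" for n
      using nrm_lincomb_le[OF err(1)[of n] err(2)[of n], of a b]
      by (simp add: pds_lincomb_test_function[OF \<phi>(1) \<psi>(1)] algebra_simps)
    have "(\<lambda>n. sqrt (2 * a\<^sup>2 * (nrm A (\<lambda>x. pds is (\<phi> n) x - g x))\<^sup>2 + 2 * b\<^sup>2 * (nrm A (\<lambda>x. pds is (\<psi> n) x - h x))\<^sup>2))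
        \<longlonglongrightarrow> sqrt (2 * a\<^sup>2 * 0\<^sup>2 + 2 * b\<^sup>2 * 0\<^sup>2)"
      by (intro tendsto_intros g h)
    also have "sqrt (2 * a\<^sup>2 * 0\<^sup>2 + 2 * b\<^sup>2 * 0\<^sup>2) = 0" by simp
    finally have "(\<lambda>n. nrm A (\<lambda>x. pds is (\<lambda>x. a * \<phi> n x + b * \<psi> n x) x - (a * g x + b * h x))) \<longlonglongrightarrow> 0"
      by (rule Lim_null_comparison[rotated])
         (intro always_eventually allI, unfold real_norm_def abs_of_nonneg[OF nrm_nonneg], rule le)
    then show ?thesis
      using is_weak_deriv_lincomb[OF A _ _ g(1) h(1), of a b] L2 by (auto simp: L2_eq_L2v)
  qed
  moreover have "(\<lambda>x. a * u x + b * v x) \<in> L2 A"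
    using L2v_lincomb[OF L2, of a b] by (simp add: L2_eq_L2v)
  ultimately show ?thesis
    unfolding sobolev0_def using test_function_lincomb[OF \<phi>(1) \<psi>(1), where a=a and b=b] 
    by (intro CollectI conjI exI[of _ "\<lambda>n x. a * \<phi> n x + b * \<psi> n x"]) auto
qed

lemma piecewise_poly_lincomb:
  assumes "u \<in> piecewise_poly r T" "v \<in> piecewise_poly r T"
  shows "(\<lambda>x. a * u x + b * v x) \<in> piecewise_poly r T"
  unfolding piecewise_poly_def
proof (intro CollectI ballI)
  fix K assume "K \<in> T"
  then obtain p q where p: "poly_deg_le r p" "\<forall>x\<in>interior K. u x = p x"
    and q: "poly_deg_le r q" "\<forall>x\<in>interior K. v x = q x"
    using assms unfolding piecewise_poly_def by blast
  obtain c d where "\<And>x. p x = (\<Sum>(i, j) | i + j \<le> r. c i j * (x $ 1) ^ i * (x $ 2) ^ j)"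
    "\<And>x. q x = (\<Sum>(i, j) | i + j \<le> r. d i j * (x $ 1) ^ i * (x $ 2) ^ j)"
    using p q by (auto simp: poly_deg_le_def)
  then have "poly_deg_le r (\<lambda>x. a * p x + b * q x)"
    unfolding poly_deg_le_def
    by (intro exI[of _ "\<lambda>i j. a * c i j + b * d i j"])
       (simp add: sum_distrib_left sum.distrib[symmetric] case_prod_beta algebra_simps)
  with p q show "\<exists>p. poly_deg_le r p \<and> (\<forall>x\<in>interior K. a * u x + b * v x = p x)"
    by (intro exI[of _ "\<lambda>x. a * p x + b * q x"]) auto
qed

lemma
  assumes "is_mesh M"
  shows Vh_lincomb: "u \<in> Vh M \<Longrightarrow> v \<in> Vh M \<Longrightarrow> (\<lambda>x. a * u x + b * v x) \<in> Vh M"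
    and Wh_lincomb: "u \<in> Wh M \<Longrightarrow> v \<in> Wh M \<Longrightarrow> (\<lambda>x. a * u x + b * v x) \<in> Wh M"
  using mesh_omega[OF assms] unfolding Vh_def Wh_def
  by (auto intro!: piecewise_poly_lincomb sobolev0_lincomb)

lemma Vh_L2v: "u \<in> Vh M \<Longrightarrow> u \<in> L2v (omega M)" and Wh_L2v: "u \<in> Wh M \<Longrightarrow> u \<in> L2v (omega M)"
  by (auto simp: Vh_def Wh_def sobolev0_def L2_eq_L2v)

section \<open>Energy identities\<close>

lemma ip_young_abs:
  assumes "F \<in> L2v A" "G \<in> L2v A" "c > 0"
  shows "\<bar>ip A F G\<bar> \<le> c / 2 * ip A F F + 1 / (2 * c) * ip A G G"
proof -
  \<comment> \<open>This is \<open>-G\<close>, written as a linear combination so that the lemmas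
    for combinations apply; Young's inequality for it bounds the product from below.\<close>
  have G: "(\<lambda>x. 0 *\<^sub>R F x + (-1) *\<^sub>R G x) \<in> L2v A" by (rule L2v_lincomb[OF assms(1,2)])
  have "- ip A F G \<le> c / 2 * ip A F F + 1 / (2 * c) * ip A G G"
    using ip_young[OF assms(1) G assms(3)]
    unfolding ip_lincomb_left[OF assms(1,2) G] ip_lincomb_right[OF assms(1,2,1)]
      ip_lincomb_right[OF assms(1,2,2)] by simp
  with ip_young[OF assms] show ?thesis by linarith
qed

lemma ip_lincomb_lincomb:
  assumes "F \<in> L2v A" "G \<in> L2v A" "H \<in> L2v A" "I \<in> L2v A"
  shows "ip A (\<lambda>x. a *\<^sub>R F x + b *\<^sub>R G x) (\<lambda>x. c *\<^sub>R H x + d *\<^sub>R I x) =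
     a * c * ip A F H + a * d * ip A F I + b * c * ip A G H + b * d * ip A G I"
  using assms by (simp add: ip_lincomb_left ip_lincomb_right L2v_lincomb algebra_simps)

lemma half_lincomb: "half X n = (\<lambda>x. 1/2 * X (Suc n) x + 1/2 * X n x)"
  by (auto simp: half_def add_divide_distrib)

lemma dt1_lincomb: "dt1 \<tau> X n = (\<lambda>x. 1/\<tau> * X (Suc n) x + (-1/\<tau>) * X n x)"
  by (auto simp: dt1_def diff_divide_distrib)

lemma dt2_lincomb: "dt2 \<tau> X (Suc n) = (\<lambda>x. 1/\<tau> * dt1 \<tau> X (Suc n) x + (-1/\<tau>) * dt1 \<tau> X n x)"
  by (auto simp: dt1_def dt2_def diff_divide_distrib add_divide_distrib power2_eq_square)

lemma quarter_lincomb: "quarter X (Suc n) = (\<lambda>x. 1/2 * half X (Suc n) x + 1/2 * half X n x)"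
  by (auto simp: quarter_def half_def diff_divide_distrib add_divide_distrib)

text \<open>The mechanism of energy conservation: one test function, read as a sum of velocities
  against the inertia terms and as a difference of midpoint values against the elastic form.\<close>

lemma dt1_half: "\<tau> \<noteq> 0 \<Longrightarrow>
    (\<lambda>x. \<tau> * dt1 \<tau> X (Suc n) x + \<tau> * dt1 \<tau> X n x) = (\<lambda>x. 2 * half X (Suc n) x + (-2) * half X n x)"
  by (auto simp: dt1_def half_def field_simps)

lemma
  assumes "is_mesh M"
  shows Vh_half: "X (Suc n) \<in> Vh M \<Longrightarrow> X n \<in> Vh M \<Longrightarrow> half X n \<in> Vh M"
    and Vh_dt1: "X (Suc n) \<in> Vh M \<Longrightarrow> X n \<in> Vh M \<Longrightarrow> dt1 \<tau> X n \<in> Vh M"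
    and Wh_half: "X (Suc n) \<in> Wh M \<Longrightarrow> X n \<in> Wh M \<Longrightarrow> half X n \<in> Wh M"
  unfolding half_lincomb dt1_lincomb by (intro Vh_lincomb[OF assms] Wh_lincomb[OF assms]; assumption)+

context
  fixes M :: mesh and \<tau> :: real
  assumes mesh: "is_mesh M" and \<tau>: "\<tau> > 0"
begin

text \<open>Every quadratic term becomes the product of a difference and a sum of the same two
  quantities, and so a difference of squares. The couplings pair a sum of two gradients with a sum
  of two quotients, which leaves four products each.\<close>

lemma displacement_identity:
  assumes U: "U n \<in> Vh M" "U (Suc n) \<in> Vh M" "U (Suc (Suc n)) \<in> Vh M"
    and \<Theta>: "\<Theta> n \<in> Wh M" "\<Theta> (Suc n) \<in> Wh M" "\<Theta> (Suc (Suc n)) \<in> Wh M"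
    and P: "P n \<in> Wh M" "P (Suc n) \<in> Wh M" "P (Suc (Suc n)) \<in> Wh M"
    and F: "quarter F (Suc n) \<in> L2v (omega M)"
    and step: "displacement_step M \<sigma> a0 d0 \<alpha> \<beta> \<tau> F U \<Theta> P (Suc n)"
  defines "D \<equiv> dt1 \<tau> U" and "S \<equiv> half \<Theta>" and "Q \<equiv> half P"
  defines "W \<equiv> \<lambda>k. ip (omega M) (D k) (D k) + a0 * ip (omega M) (grad M (D k)) (grad M (D k))
      + d0 * ah M \<sigma> (half U k) (half U k)"
    and "c \<equiv> \<lambda>X i j. ip (omega M) (grad M (X i)) (grad M (D j))"
  shows "2 * W (Suc n) - 2 * W n =
     \<tau> * \<alpha> * (c S (Suc n) (Suc n) + c S (Suc n) n + c S n (Suc n) + c S n n)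
     + \<tau> * \<beta> * (c Q (Suc n) (Suc n) + c Q (Suc n) n + c Q n (Suc n) + c Q n n)
     + 2 * \<tau> * (ip (omega M) (quarter F (Suc n)) (D (Suc n)) + ip (omega M) (quarter F (Suc n)) (D n))"
proof -
  have DV: "D n \<in> Vh M" "D (Suc n) \<in> Vh M" and HV: "half U n \<in> Vh M" "half U (Suc n) \<in> Vh M"
    using U by (auto simp: D_def intro: Vh_half[OF mesh] Vh_dt1[OF mesh])
  have SW: "S n \<in> Wh M" "S (Suc n) \<in> Wh M" "Q n \<in> Wh M" "Q (Suc n) \<in> Wh M"
    using \<Theta> P by (auto simp: S_def Q_def intro: Wh_half[OF mesh])
  have pp: "D n \<in> pw_poly M" "D (Suc n) \<in> pw_poly M" "half U n \<in> pw_poly M" "half U (Suc n) \<in> pw_poly M"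
    "S n \<in> pw_poly M" "S (Suc n) \<in> pw_poly M" "Q n \<in> pw_poly M" "Q (Suc n) \<in> pw_poly M"
    using DV HV SW Vh_pw_poly Wh_pw_poly by blast+
  note L = DV[THEN Vh_L2v] pp[THEN grad_L2v[OF mesh]]
  \<comment> \<open>This is \<open>2 \<tau>\<close> times the mean of the two quotients; twice the
    equation tested with it is the weighting \<open>4 \<tau>\<close>, and explains the factors 2 in
    front of \<open>W\<close>.\<close>
  define v where "v = (\<lambda>x. \<tau> * D (Suc n) x + \<tau> * D n x)"
  have v2: "v = (\<lambda>x. 2 * half U (Suc n) x + (-2) * half U n x)"
    unfolding v_def D_def using dt1_half \<tau> by simp
  have vV: "v \<in> Vh M" unfolding v_def by (rule Vh_lincomb[OF mesh DV(2,1)])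
  then have vp: "v \<in> pw_poly M" using Vh_pw_poly by blast
  have gv: "grad M v = (\<lambda>x. \<tau> *\<^sub>R grad M (D (Suc n)) x + \<tau> *\<^sub>R grad M (D n) x)"
    unfolding v_def by (rule grad_lincomb[OF mesh pp(2,1)])
  have d2: "dt2 \<tau> U (Suc n) = (\<lambda>x. 1/\<tau> * D (Suc n) x + (-1/\<tau>) * D n x)"
    unfolding D_def by (rule dt2_lincomb)
  have g2: "grad M (dt2 \<tau> U (Suc n)) = (\<lambda>x. (1/\<tau>) *\<^sub>R grad M (D (Suc n)) x + (-1/\<tau>) *\<^sub>R grad M (D n) x)"
    unfolding d2 by (rule grad_lincomb[OF mesh pp(2,1)])
  have gq: "grad M (quarter \<Theta> (Suc n)) = (\<lambda>x. (1/2) *\<^sub>R grad M (S (Suc n)) x + (1/2) *\<^sub>R grad M (S n) x)"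
    "grad M (quarter P (Suc n)) = (\<lambda>x. (1/2) *\<^sub>R grad M (Q (Suc n)) x + (1/2) *\<^sub>R grad M (Q n) x)"
    unfolding quarter_lincomb S_def[symmetric] Q_def[symmetric]
    by (rule grad_lincomb[OF mesh pp(6,5)], rule grad_lincomb[OF mesh pp(8,7)])
  have 1: "ip (omega M) (dt2 \<tau> U (Suc n)) v = ip (omega M) (D (Suc n)) (D (Suc n)) - ip (omega M) (D n) (D n)"
    using ip_lincomb_lincomb[OF L(2,1,2,1), of "1/\<tau>" "-1/\<tau>" \<tau> \<tau>] \<tau>
    by (simp add: d2 v_def ip_commute[of _ "D n" "D (Suc n)"])
  have 2: "ip (omega M) (grad M (dt2 \<tau> U (Suc n))) (grad M v) =
     ip (omega M) (grad M (D (Suc n))) (grad M (D (Suc n))) - ip (omega M) (grad M (D n)) (grad M (D n))"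
    unfolding g2 gv ip_lincomb_lincomb[OF L(4,3,4,3)]
    using \<tau> by (simp add: ip_commute[of _ "grad M (D n)" "grad M (D (Suc n))"])
  \<comment> \<open>The mixed terms cancel by the symmetry of \<open>ah\<close>.\<close>
  have 3: "ah M \<sigma> (quarter U (Suc n)) v =
     ah M \<sigma> (half U (Suc n)) (half U (Suc n)) - ah M \<sigma> (half U n) (half U n)"
  proof -
    have "ah M \<sigma> w v = 2 * ah M \<sigma> w (half U (Suc n)) - 2 * ah M \<sigma> w (half U n)" if "w \<in> pw_poly M" for w
      using ah_lincomb_left[OF mesh pp(4,3) that, where \<sigma>=\<sigma> and a=2 and b="-2"]
        ah_commute[of M \<sigma> v w] ah_commute[of M \<sigma> "half U n" w] ah_commute[of M \<sigma> "half U (Suc n)" w]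
      unfolding v2[symmetric] by linarith
    then show ?thesis
      unfolding quarter_lincomb ah_lincomb_left[OF mesh pp(4,3) vp]
      using pp by (simp add: ah_commute[of M \<sigma> "half U n" "half U (Suc n)"] diff_divide_distrib)
  qed
  have 4: "ip (omega M) (quarter F (Suc n)) v =
      \<tau> * ip (omega M) (quarter F (Suc n)) (D (Suc n)) + \<tau> * ip (omega M) (quarter F (Suc n)) (D n)"
    unfolding v_def using ip_lincomb_right[OF L(2,1) F, of \<tau> \<tau>] by simp
  have "ip (omega M) (dt2 \<tau> U (Suc n)) v
     + a0 * ip (omega M) (grad M (dt2 \<tau> U (Suc n))) (grad M v)
     + d0 * ah M \<sigma> (quarter U (Suc n)) v
     - \<alpha> * ip (omega M) (grad M (quarter \<Theta> (Suc n))) (grad M v)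
     - \<beta> * ip (omega M) (grad M (quarter P (Suc n))) (grad M v)
     = ip (omega M) (quarter F (Suc n)) v"
    using step vV by (simp add: displacement_step_def)
  then show ?thesis
    unfolding 1 2 3 4 unfolding gq gv ip_lincomb_lincomb[OF L(8,7,4,3)] ip_lincomb_lincomb[OF L(10,9,4,3)]
      W_def c_def by (simp add: algebra_simps)
qed

text \<open>Neither of the two \<open>\<gamma>\<close> terms is a difference of squares alone. Their
  sum is, by the discrete product rule, the increment of the mixed term in the quadratic form
  \<open>A\<close>; this is why both equations are added before any estimate.\<close>

lemma coupling_identity:
  assumes U: "U n \<in> Vh M" "U (Suc n) \<in> Vh M"
    and \<Theta>: "\<Theta> n \<in> Wh M" "\<Theta> (Suc n) \<in> Wh M" and P: "P n \<in> Wh M" "P (Suc n) \<in> Wh M"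
    and steps: "temperature_step M \<alpha> \<gamma> a1 b1 c1 \<tau> \<Phi> U \<Theta> P n" "pressure_step M \<beta> \<gamma> a2 \<kappa> \<tau> G U \<Theta> P n"
  defines "S \<equiv> half \<Theta> n" and "Q \<equiv> half P n"
  defines "A \<equiv> \<lambda>k. a1 * ip (omega M) (\<Theta> k) (\<Theta> k) - 2 * \<gamma> * ip (omega M) (\<Theta> k) (P k)
      + a2 * ip (omega M) (P k) (P k)"
  shows "A (Suc n) / 2 - A n / 2 + \<tau> * (b1 * ip (omega M) S S
      + c1 * ip (omega M) (grad M S) (grad M S) + \<kappa> * ip (omega M) (grad M Q) (grad M Q))
     + \<tau> * \<alpha> * ip (omega M) (grad M S) (grad M (dt1 \<tau> U n))
     + \<tau> * \<beta> * ip (omega M) (grad M Q) (grad M (dt1 \<tau> U n))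
     = \<tau> * (ip (omega M) (half \<Phi> n) S + ip (omega M) (half G n) Q)"
proof -
  have W: "S \<in> Wh M" "Q \<in> Wh M" using \<Theta> P by (auto simp: S_def Q_def intro: Wh_half[OF mesh])
  note L = \<Theta>[THEN Wh_L2v] P[THEN Wh_L2v]
  have i: "ip (omega M) (dt1 \<tau> X n) (half Y n) = 1 / (2 * \<tau>) *
      (ip (omega M) (X (Suc n)) (Y (Suc n)) + ip (omega M) (X (Suc n)) (Y n)
       - ip (omega M) (X n) (Y (Suc n)) - ip (omega M) (X n) (Y n))"
    if "X n \<in> L2v (omega M)" "X (Suc n) \<in> L2v (omega M)" "Y n \<in> L2v (omega M)" "Y (Suc n) \<in> L2v (omega M)"
    for X Y :: "nat \<Rightarrow> sfun"
    unfolding dt1_lincomb half_lincomb ip_lincomb_lincomb[OF that(2,1,4,3), unfolded real_scaleR_def]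
    using \<tau> by (simp add: field_simps)
  have e1: "a1 * ip (omega M) (dt1 \<tau> \<Theta> n) S - \<gamma> * ip (omega M) (dt1 \<tau> P n) S
     + b1 * ip (omega M) S S + c1 * ip (omega M) (grad M S) (grad M S)
     + \<alpha> * ip (omega M) (grad M (dt1 \<tau> U n)) (grad M S) = ip (omega M) (half \<Phi> n) S"
    using steps(1) W by (simp add: temperature_step_def S_def)
  have e2: "a2 * ip (omega M) (dt1 \<tau> P n) Q - \<gamma> * ip (omega M) (dt1 \<tau> \<Theta> n) Q
     + \<kappa> * ip (omega M) (grad M Q) (grad M Q)
     + \<beta> * ip (omega M) (grad M (dt1 \<tau> U n)) (grad M Q) = ip (omega M) (half G n) Q"
    using steps(2) W by (simp add: pressure_step_def Q_def)
  have "a1 * ip (omega M) (dt1 \<tau> \<Theta> n) S - \<gamma> * ip (omega M) (dt1 \<tau> P n) S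
      + (a2 * ip (omega M) (dt1 \<tau> P n) Q - \<gamma> * ip (omega M) (dt1 \<tau> \<Theta> n) Q)
      = 1 / (2 * \<tau>) * (A (Suc n) - A n)"
    unfolding S_def Q_def i[of \<Theta> \<Theta>, OF L(1,2,1,2)] i[of P \<Theta>, OF L(3,4,1,2)]
      i[of P P, OF L(3,4,3,4)] i[of \<Theta> P, OF L(1,2,3,4)]
      ip_commute[of _ "P _" "\<Theta> _"] ip_commute[of _ "\<Theta> (Suc n)" "\<Theta> n"] ip_commute[of _ "P (Suc n)" "P n"] A_def
    by (simp add: algebra_simps)
  then have "1 / (2 * \<tau>) * (A (Suc n) - A n) + b1 * ip (omega M) S S + c1 * ip (omega M) (grad M S) (grad M S)
     + \<kappa> * ip (omega M) (grad M Q) (grad M Q)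
     + \<alpha> * ip (omega M) (grad M S) (grad M (dt1 \<tau> U n)) + \<beta> * ip (omega M) (grad M Q) (grad M (dt1 \<tau> U n))
     = ip (omega M) (half \<Phi> n) S + ip (omega M) (half G n) Q"
    using e1 e2 by (simp add: ip_commute[of _ "grad M (dt1 \<tau> U n)"])
  note scaled = arg_cong[OF this, of "\<lambda>z. \<tau> * z"]
  have "\<tau> * (1 / (2 * \<tau>) * (A (Suc n) - A n)) = A (Suc n) / 2 - A n / 2"
    using \<tau> by (simp add: field_simps)
  with scaled show ?thesis by (simp add: distrib_left mult.assoc)
qed

end

text \<open>The increment stands inside the factor, so the induction needs no sign of
  \<open>Z\<close>.\<close>

lemma discrete_gronwall:
  fixes Z :: "nat \<Rightarrow> real"
  assumes "Q \<ge> 1" "r \<ge> 0" "\<And>k. k < m \<Longrightarrow> Z (Suc k) \<le> Q * (Z k + r)"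
  shows "Z m \<le> Q ^ m * (Z 0 + real m * r)"
  using assms(3)
proof (induction m)
  case (Suc m)
  have "Z (Suc m) \<le> Q * (Z m + r)" using Suc.prems by simp
  \<comment> \<open>The new increment is enlarged by \<open>Q ^ m\<close>, which is at least 1, so
    that a common power factors out.\<close>
  also have "\<dots> \<le> Q * (Q ^ m * (Z 0 + real m * r) + Q ^ m * r)"
    using Suc assms(1,2) by (intro mult_left_mono add_mono) (auto simp: mult_le_cancel_right1)
  also have "\<dots> = Q ^ Suc m * (Z 0 + real (Suc m) * r)" by (simp add: algebra_simps)
  finally show ?case .
qed simp

section \<open>Estimates for the sources and for one time step\<close>

lemma half_L2v: "X n \<in> L2v A \<Longrightarrow> X (Suc n) \<in> L2v A \<Longrightarrow> half X n \<in> L2v A"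
  and quarter_L2v: "half X n \<in> L2v A \<Longrightarrow> half X (Suc n) \<in> L2v A \<Longrightarrow> quarter X (Suc n) \<in> L2v A"
  using L2v_lincomb[of "X (Suc n)" A "X n" "1/2" "1/2"]
    L2v_lincomb[of "half X (Suc n)" A "half X n" "1/2" "1/2"]
  by (simp_all add: half_lincomb[of X n] quarter_lincomb)

lemma ip_half_left:
  assumes "X n \<in> L2v A" "X (Suc n) \<in> L2v A" "Y \<in> L2v A"
  shows "ip A (half X n) Y = (ip A (X (Suc n)) Y + ip A (X n) Y) / 2"
  unfolding half_lincomb using ip_lincomb_left[OF assms(2,1,3), of "1/2" "1/2"]
  by (simp add: add_divide_distrib)

lemma ip_quarter_left:
  assumes "half X n \<in> L2v A" "half X (Suc n) \<in> L2v A" "Y \<in> L2v A"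
  shows "ip A (quarter X (Suc n)) Y = (ip A (half X (Suc n)) Y + ip A (half X n) Y) / 2"
  unfolding quarter_lincomb using ip_lincomb_left[OF assms(2,1,3), of "1/2" "1/2"]
  by (simp add: add_divide_distrib)

text \<open>Young's inequality is applied to each sample before averaging, so bounds on the single
  samples suffice.\<close>

lemma source_half_bound:
  assumes "X n \<in> L2v A" "X (Suc n) \<in> L2v A" "Y \<in> L2v A" "c > 0"
    and "ip A (X n) (X n) \<le> B" "ip A (X (Suc n)) (X (Suc n)) \<le> B"
  shows "ip A (half X n) Y \<le> c / 2 * B + 1 / (2 * c) * ip A Y Y"
proof -
  have "ip A (X k) Y \<le> c / 2 * B + 1 / (2 * c) * ip A Y Y"
    if "X k \<in> L2v A" "ip A (X k) (X k) \<le> B" for k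
  proof -
    have "c / 2 * ip A (X k) (X k) \<le> c / 2 * B" using that assms(4) by (intro mult_left_mono) auto
    with ip_young[OF that(1) assms(3,4)] show ?thesis by linarith
  qed
  from this[of n] this[of "Suc n"] show ?thesis using assms by (simp add: ip_half_left)
qed

lemma source_quarter_bound:
  assumes "\<And>k. k \<in> {n, Suc n, Suc (Suc n)} \<Longrightarrow> X k \<in> L2v A \<and> ip A (X k) (X k) \<le> B"
    and "Y \<in> L2v A" "c > 0"
  shows "ip A (quarter X (Suc n)) Y \<le> c / 2 * B + 1 / (2 * c) * ip A Y Y"
proof -
  have "half X n \<in> L2v A" "half X (Suc n) \<in> L2v A" using assms(1) by (auto intro: half_L2v)
  then show ?thesis
    using source_half_bound[of X n A Y c B] source_half_bound[of X "Suc n" A Y c B] assms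
    by (simp add: ip_quarter_left)
qed

text \<open>The implicit terms carry the weight \<open>K / (1 + K \<tau>)\<close>, so they can be absorbed for every step
  size \<open>\<tau>\<close>; this is what keeps the estimate unconditional.\<close>

lemma energy_step:
  fixes \<tau> K q a0 c1 \<kappa> A1 A2 :: real
  assumes pos: "K > 0" "\<tau> > 0" "a0 > 0" "c1 > 0" "\<kappa> > 0" and q: "q = 1 + K * \<tau>"
    and K: "\<alpha>\<^sup>2 / c1 + \<beta>\<^sup>2 / \<kappa> \<le> K * a0"
    and id1: "2 * W - 2 * W' = \<tau> * \<alpha> * (c11 + c10 + c01 + c00) + \<tau> * \<beta> * (d11 + d10 + d01 + d00)
      + 2 * \<tau> * (f1 + f0)"
    and id2: "A / 2 - A' / 2 + \<tau> * (B + G) + \<tau> * \<alpha> * c11 + \<tau> * \<beta> * d11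
      = \<tau> * ((\<phi>1 + \<phi>0) / 2 + (g1 + g0) / 2)"
    and W: "W \<ge> s + a0 * w" "W' \<ge> s' + a0 * w'"
    and A: "A \<ge> A1 * t + A2 * p" "A' \<ge> A1 * t' + A2 * p'"
    and G: "G = c1 * \<theta> + \<kappa> * \<pi>" "G' = c1 * \<theta>' + \<kappa> * \<pi>'"
    and nonneg: "w \<ge> 0" "w' \<ge> 0" "G \<ge> 0" "G' \<ge> 0" "B \<ge> 0" "F \<ge> 0" "\<Phi> \<ge> 0" "\<Gamma> \<ge> 0"
    and yc: "\<alpha> * c10 \<le> c1 / 4 * \<theta> + \<alpha>\<^sup>2 / c1 * w'"
      "\<alpha> * c00 \<le> c1 / 4 * \<theta>' + \<alpha>\<^sup>2 / c1 * w'"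
      "\<alpha> * c01 \<le> q * c1 / 4 * \<theta>' + \<alpha>\<^sup>2 / (q * c1) * w"
    and yd: "\<beta> * d10 \<le> \<kappa> / 4 * \<pi> + \<beta>\<^sup>2 / \<kappa> * w'"
      "\<beta> * d00 \<le> \<kappa> / 4 * \<pi>' + \<beta>\<^sup>2 / \<kappa> * w'"
      "\<beta> * d01 \<le> q * \<kappa> / 4 * \<pi>' + \<beta>\<^sup>2 / (q * \<kappa>) * w"
    and yf: "f1 \<le> q / 4 * F + K / q * s" "f0 \<le> 1 / 4 * F + K * s'"
    and yp: "\<phi>1 \<le> q / 4 * \<Phi> + K / q * (A1 * t)" "\<phi>0 \<le> 1 / 4 * \<Phi> + K * (A1 * t')"
    and yg: "g1 \<le> q / 4 * \<Gamma> + K / q * (A2 * p)" "g0 \<le> 1 / 4 * \<Gamma> + K * (A2 * p')"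
  shows "2 * W + A / 2 + \<tau> / 2 * G + \<tau> / 4 * (B + G)
    \<le> q\<^sup>2 * (2 * W' + A' / 2 + \<tau> / 2 * G' + \<tau> * (F + (\<Phi> + \<Gamma>) / 4))"
proof -
  define X where "X = 2 * W + A / 2"
  define X' where "X' = 2 * W' + A' / 2"
  define S where "S = F + (\<Phi> + \<Gamma>) / 4"
  \<comment> \<open>The weight allowed on new quantities: \<open>q * k = K\<close>, hence
    \<open>q * (1 - k * \<tau>) = 1\<close>.\<close>
  define k where "k = K / q"
  have q1: "q \<ge> 1" using pos q by simp
  have k: "k > 0" using pos q1 by (simp add: k_def)
  have w': "(\<alpha>\<^sup>2 / c1) * w' + (\<beta>\<^sup>2 / \<kappa>) * w' \<le> K * (a0 * w')"
    using mult_right_mono[OF K nonneg(2)] by (simp add: algebra_simps)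
  have w: "\<alpha>\<^sup>2 / (q * c1) * w + \<beta>\<^sup>2 / (q * \<kappa>) * w \<le> k * (a0 * w)"
  proof -
    have "(\<alpha>\<^sup>2 / c1 + \<beta>\<^sup>2 / \<kappa>) * w / q \<le> (K * a0) * w / q"
      using q1 nonneg by (intro divide_right_mono mult_right_mono K) auto
    also have "(\<alpha>\<^sup>2 / c1 + \<beta>\<^sup>2 / \<kappa>) * w / q = \<alpha>\<^sup>2 / (q * c1) * w + \<beta>\<^sup>2 / (q * \<kappa>) * w"
      using q1 pos by (simp add: field_simps)
    finally show ?thesis by (simp add: k_def mult.assoc)
  qed
  \<comment> \<open>All Young remainders at the new level must fit into \<open>k * X\<close>. The
    displacement source takes the full share of \<open>s\<close>, the temperature and pressure
    sources those of \<open>t\<close> and \<open>p\<close>, and the couplings half the share of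
    \<open>w\<close>.\<close>
  have kX: "2 * (k * s) + 2 * (k * (a0 * w)) + k * (A1 * t) / 2 + k * (A2 * p) / 2 \<le> k * X"
  proof -
    have "k * (2 * s + 2 * (a0 * w) + (A1 * t) / 2 + (A2 * p) / 2) \<le> k * X"
      using W A k unfolding X_def by (intro mult_left_mono) auto
    then show ?thesis by (simp add: distrib_left mult.left_commute)
  qed
  have KX': "2 * (K * s') + 2 * (K * (a0 * w')) + K * (A1 * t') / 2 + K * (A2 * p') / 2 \<le> K * X'"
  proof -
    have "K * (2 * s' + 2 * (a0 * w') + (A1 * t') / 2 + (A2 * p') / 2) \<le> K * X'"
      using W A pos unfolding X'_def by (intro mult_left_mono) auto
    then show ?thesis by (simp add: distrib_left mult.left_commute)
  qed
  have nn: "0 \<le> k * (a0 * w)" "0 \<le> K * (a0 * w')" using k pos nonneg by auto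
  have qG: "q * c1 / 4 * \<theta>' + q * \<kappa> / 4 * \<pi>' = q / 4 * G'" unfolding G by (simp add: algebra_simps)
  have qS: "q / 2 * S = q / 2 * F + q / 8 * \<Phi> + q / 8 * \<Gamma>" by (simp add: S_def algebra_simps)
  have S2: "S / 2 = F / 2 + \<Phi> / 8 + \<Gamma> / 8" by (simp add: S_def)
  have sum: "\<alpha> * c10 + \<alpha> * c00 + \<alpha> * c01 + (\<beta> * d10 + \<beta> * d00 + \<beta> * d01) + 2 * (f1 + f0)
      + (\<phi>1 / 2 + \<phi>0 / 2 + (g1 / 2 + g0 / 2))
      \<le> G / 4 + G' / 4 + q / 4 * G' + k * X + K * X' + (q / 2 * S + S / 2)"
  proof -
    have "\<alpha> * c10 + \<beta> * d10 \<le> G / 4 + K * (a0 * w')" "\<alpha> * c00 + \<beta> * d00 \<le> G' / 4 + K * (a0 * w')"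
      using yc(1,2) yd(1,2) w' unfolding G add_divide_distrib times_divide_eq_left by linarith+
    moreover have "\<alpha> * c01 + \<beta> * d01 \<le> q / 4 * G' + k * (a0 * w)"
      using yc(3) yd(3) w qG by linarith
    moreover have "2 * f1 + \<phi>1 / 2 + g1 / 2 \<le> q / 2 * S + (2 * (k * s) + k * (A1 * t) / 2 + k * (A2 * p) / 2)"
      using yf(1) yp(1) yg(1) unfolding qS k_def[symmetric] by linarith
    moreover have "2 * f0 + \<phi>0 / 2 + g0 / 2 \<le> S / 2 + (2 * (K * s') + K * (A1 * t') / 2 + K * (A2 * p') / 2)"
      using yf(2) yp(2) yg(2) unfolding S2 by linarith
    ultimately show ?thesis using kX KX' nn by argo
  qed
  have "X - X' + \<tau> * (B + G) = \<tau> * (\<alpha> * c10 + \<alpha> * c00 + \<alpha> * c01 + (\<beta> * d10 + \<beta> * d00 + \<beta> * d01)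
      + 2 * (f1 + f0) + (\<phi>1 / 2 + \<phi>0 / 2 + (g1 / 2 + g0 / 2)))"
    using id1 id2 unfolding X_def X'_def by (simp add: algebra_simps add_divide_distrib)
  also have "\<dots> \<le> \<tau> * (G / 4 + G' / 4 + q / 4 * G' + k * X + K * X' + (q / 2 * S + S / 2))"
    using pos by (intro mult_left_mono sum) auto
  finally have "q * (X - X' + \<tau> * (B + G))
      \<le> q * (\<tau> * (G / 4 + G' / 4 + q / 4 * G' + k * X + K * X' + (q / 2 * S + S / 2)))"
    using q1 by (intro mult_left_mono) auto
  also have "\<dots> = q * \<tau> / 4 * G + \<tau> / 4 * (q * (1 + q)) * G' + \<tau> * K * X + \<tau> * K * q * X' + \<tau> / 2 * (q * (1 + q)) * S"
    using q1 by (simp add: k_def field_simps)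
  finally have 1: "q * X - \<tau> * K * X + q * \<tau> * B + 3 / 4 * (q * \<tau> * G)
      \<le> q * X' + \<tau> * K * q * X' + \<tau> / 4 * (q * (1 + q)) * G' + \<tau> / 2 * (q * (1 + q)) * S"
    by (simp add: algebra_simps)
  \<comment> \<open>The absorption: after multiplication by \<open>q\<close> exactly the unweighted
    new energy is left.\<close>
  have 2: "q * X - \<tau> * K * X = X" "q * X' + \<tau> * K * q * X' = q\<^sup>2 * X'"
    by (simp_all add: q algebra_simps power2_eq_square)
  \<comment> \<open>This rounding gives the old gradient energy the factor \<open>q\<^sup>2\<close>
    times \<open>\<tau> / 2\<close>, the same share \<open>\<tau> / 2\<close> that the new one keeps
    on the left, so the estimate can be iterated.\<close>
  have qq: "q * (1 + q) \<le> 2 * q\<^sup>2" using mult_left_mono[of "1 + q" "2 * q" q] q1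
    by (simp add: power2_eq_square)
  have S0: "S \<ge> 0" using nonneg by (simp add: S_def)
  have 3: "\<tau> / 4 * (q * (1 + q)) * G' \<le> \<tau> / 4 * (2 * q\<^sup>2) * G'" "\<tau> / 2 * (q * (1 + q)) * S \<le> \<tau> / 2 * (2 * q\<^sup>2) * S"
    using qq pos nonneg S0 by (intro mult_right_mono mult_left_mono; simp)+
  have 4: "\<tau> * B \<le> q * \<tau> * B" "\<tau> * G \<le> q * \<tau> * G"
    using q1 pos nonneg mult_right_mono[of 1 q "\<tau> * B"] mult_right_mono[of 1 q "\<tau> * G"]
    by (simp_all add: mult.assoc)
  have 5: "0 \<le> \<tau> * B" using pos nonneg by simp
  \<comment> \<open>Budget of the new \<open>\<tau> * G\<close>: a quarter was spent on the coupling
    with the old quotient, a half is kept for the next step, and the last quarter is recorded as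
    dissipation.\<close>
  have "X + \<tau> / 2 * G + \<tau> / 4 * (B + G) \<le> X + q * \<tau> * B + 3 / 4 * (q * \<tau> * G)"
  proof -
    have "\<tau> / 2 * G + \<tau> / 4 * (B + G) = 1 / 4 * (\<tau> * B) + 3 / 4 * (\<tau> * G)" by (simp add: field_simps)
    with 4 5 show ?thesis by linarith
  qed
  also have "\<dots> \<le> q\<^sup>2 * X' + \<tau> / 4 * (2 * q\<^sup>2) * G' + \<tau> / 2 * (2 * q\<^sup>2) * S"
    using 1 2 3 by linarith
  also have "\<dots> = q\<^sup>2 * (X' + \<tau> / 2 * G' + \<tau> * S)" by (simp add: algebra_simps)
  finally show ?thesis by (simp add: X_def X'_def S_def)
qed

text \<open>Young's inequality with weight \<open>1 / \<gamma>0\<close> on the mixed term. The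
  reduced coefficients of the energy and the enlarged ones of the data originate here.\<close>

lemma coupled_form_bounds:
  fixes a1 a2 \<gamma> \<gamma>0 :: real
  assumes L: "F \<in> L2v A" "H \<in> L2v A" and g: "\<gamma>0 > 0"
  defines "a \<equiv> a1 * ip A F F - 2 * \<gamma> * ip A F H + a2 * ip A H H"
  shows "(a1 - \<bar>\<gamma>\<bar> / \<gamma>0) * ip A F F + (a2 - \<bar>\<gamma>\<bar> * \<gamma>0) * ip A H H \<le> a"
    and "a \<le> (a1 + \<bar>\<gamma>\<bar> / \<gamma>0) * ip A F F + (a2 + \<bar>\<gamma>\<bar> * \<gamma>0) * ip A H H"
proof -
  have "\<bar>ip A F H\<bar> \<le> (1 / \<gamma>0) / 2 * ip A F F + 1 / (2 * (1 / \<gamma>0)) * ip A H H"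
    using g by (intro ip_young_abs L) auto
  then have "\<bar>2 * \<gamma> * ip A F H\<bar> \<le> 2 * \<bar>\<gamma>\<bar> * ((1 / \<gamma>0) / 2 * ip A F F + 1 / (2 * (1 / \<gamma>0)) * ip A H H)"
    unfolding abs_mult by (intro mult_mono) auto
  also have "\<dots> = \<bar>\<gamma>\<bar> / \<gamma>0 * ip A F F + \<bar>\<gamma>\<bar> * \<gamma>0 * ip A H H"
    using g by (simp add: algebra_simps)
  finally have "\<bar>2 * \<gamma> * ip A F H\<bar> \<le> \<bar>\<gamma>\<bar> / \<gamma>0 * ip A F F + \<bar>\<gamma>\<bar> * \<gamma>0 * ip A H H" .
  then show "(a1 - \<bar>\<gamma>\<bar> / \<gamma>0) * ip A F F + (a2 - \<bar>\<gamma>\<bar> * \<gamma>0) * ip A H H \<le> a"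
    and "a \<le> (a1 + \<bar>\<gamma>\<bar> / \<gamma>0) * ip A F F + (a2 + \<bar>\<gamma>\<bar> * \<gamma>0) * ip A H H"
    unfolding a_def by (simp_all add: algebra_simps abs_le_iff)
qed

text \<open>The parameter \<open>x\<close> shifts weight between gradient and quotient: 1 for old
  quotients, \<open>q\<close> for the product of an old gradient with a new quotient, whose
  remainder must be absorbed.\<close>

lemma coupling_young:
  assumes "F \<in> L2v A" "H \<in> L2v A" "c > 0" "x > 0"
  shows "\<alpha> * ip A F H \<le> x * c / 4 * ip A F F + \<alpha>\<^sup>2 / (x * c) * ip A H H"
proof (cases "\<alpha> = 0")
  case False
  \<comment> \<open>Chosen so that the gradient term gets exactly \<open>x * c / 4\<close> after
    multiplication by \<open>\<bar>\<alpha>\<bar>\<close>.\<close>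
  define z where "z = x * c / (2 * \<bar>\<alpha>\<bar>)"
  have "\<bar>\<alpha>\<bar> * \<bar>ip A F H\<bar> \<le> \<bar>\<alpha>\<bar> * (z / 2 * ip A F F + 1 / (2 * z) * ip A H H)"
    using False assms by (intro mult_left_mono ip_young_abs) (auto simp: z_def)
  also have "\<dots> = x * c / 4 * ip A F F + \<bar>\<alpha>\<bar>\<^sup>2 / (x * c) * ip A H H"
    using False assms by (simp add: z_def field_simps power2_eq_square)
  finally show ?thesis using abs_ge_self[of "\<alpha> * ip A F H"] by (simp add: abs_mult)
qed (use assms ip_nonneg[of A F] in auto)

text \<open>Fixing the constant explicitly makes its independence of the mesh, of \<open>N\<close>
  and of the solution visible, so the quantifiers of the theorem need no further argument.\<close>

lemma stability_bound:
  fixes T a0 c1 \<alpha> \<beta> \<kappa> d0 a1 b1 a2 \<gamma> \<gamma>0 :: real and N m :: nat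
  assumes pos: "T > 0" "a0 > 0" "c1 > 0" "\<kappa> > 0" "d0 > 0" "a1 > 0" "b1 > 0" "a2 > 0" "\<gamma>0 > 0"
    and A1: "a1 - \<bar>\<gamma>\<bar> / \<gamma>0 > 0" and A2: "a2 - \<bar>\<gamma>\<bar> * \<gamma>0 > 0"
    and mesh: "is_mesh M" and ah: "ah_coercive_bounded M \<sigma> CCoer CCont"
    and src: "admissible_source T N (omega M) f" "admissible_source T N (omega M) \<phi>"
      "admissible_source T N (omega M) g"
    and scheme: "scheme M \<sigma> J a0 d0 \<alpha> \<beta> \<gamma> a1 b1 c1 a2 \<kappa> T N f \<phi> g u0 us0 \<theta>0 p0 U \<Theta> P"
    and m: "1 \<le> m" "m \<le> N - 1"
  defines "K \<equiv> 1 / T + (\<alpha>\<^sup>2 / c1 + \<beta>\<^sup>2 / \<kappa>) / a0"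
  shows "energy M \<sigma> CCoer a0 d0 \<gamma> \<gamma>0 a1 b1 c1 a2 \<kappa> (T / real N) U \<Theta> P m
    \<le> 4 * exp (2 * K * T) * (displacement_data M \<sigma> CCont a0 d0 T (T / real N) U f
         + temperature_data M \<gamma> \<gamma>0 a1 c1 T (T / real N) \<Theta> \<phi>
         + pressure_data M \<gamma> \<gamma>0 a2 \<kappa> T (T / real N) P g)"
proof -
  define \<tau> where "\<tau> = T / real N"
  define q where "q = 1 + K * \<tau>"
  define \<Omega> where "\<Omega> = omega M"
  define L where "L f = (Linf_L2_norm T \<Omega> f)\<^sup>2" for f
  define A1 where "A1 = a1 - \<bar>\<gamma>\<bar> / \<gamma>0"
  define A2 where "A2 = a2 - \<bar>\<gamma>\<bar> * \<gamma>0"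
  have N: "N \<ge> 1" "m < N" using m by auto
  have \<tau>: "\<tau> > 0" using pos N by (simp add: \<tau>_def)
  have Apos: "A1 > 0" "A2 > 0" using A1 A2 by (auto simp: A1_def A2_def)
  have "0 \<le> (\<alpha>\<^sup>2 / c1 + \<beta>\<^sup>2 / \<kappa>) / a0" using pos by auto
  \<comment> \<open>Besides the positivity of \<open>K\<close>, this gives the factor
    \<open>T\<close> in place of \<open>1 / K\<close> in the source terms.\<close>
  then have KT: "1 / T \<le> K" by (simp add: K_def)
  then have K: "K > 0" using pos by (meson divide_pos_pos less_le_trans zero_less_one)
  have Ka0: "\<alpha>\<^sup>2 / c1 + \<beta>\<^sup>2 / \<kappa> \<le> K * a0" using pos by (simp add: K_def field_simps)
  have q1: "q \<ge> 1" using K \<tau> by (simp add: q_def)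
  have L0: "L f \<ge> 0" for f by (simp add: L_def)

  have sp: "U n \<in> Vh M" "\<Theta> n \<in> Wh M" "P n \<in> Wh M" if "n \<le> N" for n
    using scheme that by (auto simp: scheme_def Let_def)
  have dstep: "displacement_step M \<sigma> a0 d0 \<alpha> \<beta> \<tau> (samples \<tau> f) U \<Theta> P n" if "1 \<le> n" "n < N" for n
    using scheme that by (auto simp: scheme_def Let_def \<tau>_def)
  have tstep: "temperature_step M \<alpha> \<gamma> a1 b1 c1 \<tau> (samples \<tau> \<phi>) U \<Theta> P n"
    and pstep: "pressure_step M \<beta> \<gamma> a2 \<kappa> \<tau> (samples \<tau> g) U \<Theta> P n" if "n < N" for n
    using scheme that by (auto simp: scheme_def Let_def \<tau>_def)
  have sample: "samples \<tau> h n \<in> L2v \<Omega> \<and> ip \<Omega> (samples \<tau> h n) (samples \<tau> h n) \<le> L h"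
    if "admissible_source T N (omega M) h" "n \<le> N" for h n
  proof -
    have "samples \<tau> h n \<in> L2v \<Omega>" "nrm \<Omega> (samples \<tau> h n) \<le> Linf_L2_norm T \<Omega> h"
      using that by (auto simp: admissible_source_def L2_eq_L2v \<tau>_def \<Omega>_def)
    then show ?thesis
      using power_mono[of "nrm \<Omega> (samples \<tau> h n)" _ 2] nrm_nonneg by (auto simp: nrm_sq L_def)
  qed

  define D where "D = dt1 \<tau> U"
  define S where "S = half \<Theta>"
  define Q where "Q = half P"
  define s where "s n = ip \<Omega> (D n) (D n)" for n
  define w where "w n = ip \<Omega> (grad M (D n)) (grad M (D n))" for n
  define W where "W n = s n + a0 * w n + d0 * ah M \<sigma> (half U n) (half U n)" for n
  define t where "t n = ip \<Omega> (\<Theta> n) (\<Theta> n)" for n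
  define p where "p n = ip \<Omega> (P n) (P n)" for n
  define A where "A n = a1 * t n - 2 * \<gamma> * ip \<Omega> (\<Theta> n) (P n) + a2 * p n" for n
  define \<theta> where "\<theta> n = ip \<Omega> (grad M (S n)) (grad M (S n))" for n
  define \<pi> where "\<pi> n = ip \<Omega> (grad M (Q n)) (grad M (Q n))" for n
  define G where "G n = c1 * \<theta> n + \<kappa> * \<pi> n" for n
  define B where "B n = b1 * ip \<Omega> (S n) (S n)" for n
  \<comment> \<open>\<open>W n\<close> belongs to the level \<open>n + 1/2\<close>, hence it is
    paired with \<open>A\<close> at \<open>n + 1\<close>. The sum starts at 1, so \<open>Z 0\<close>
    consists of first-step quantities only, those that appear in the data of the bound.\<close>
  define Z where "Z n = 2 * W n + A (Suc n) / 2 + \<tau> / 2 * G n + \<tau> / 4 * (\<Sum>k=1..n. B k + G k)" for n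
  \<comment> \<open>The divisors \<open>K\<close>, \<open>K * A1\<close>, \<open>K * A2\<close> come
    from giving the Young partners of the sources the weights with which they occur in
    \<open>K\<close> times the energy.\<close>
  define r where "r = \<tau> * (L f / K + (L \<phi> / (K * A1) + L g / (K * A2)) / 4)"

  have DV: "D n \<in> Vh M" and HV: "half U n \<in> Vh M" and SW: "S n \<in> Wh M" and QW: "Q n \<in> Wh M"
    if "n < N" for n
    using sp[of n] sp[of "Suc n"] that
    by (auto simp: D_def S_def Q_def intro: Vh_half[OF mesh] Vh_dt1[OF mesh] Wh_half[OF mesh])
  have DL: "D n \<in> L2v \<Omega>" "grad M (D n) \<in> L2v \<Omega>" "grad M (S n) \<in> L2v \<Omega>" "grad M (Q n) \<in> L2v \<Omega>"
    if "n < N" for n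
    using DV[OF that] SW[OF that] QW[OF that] Vh_L2v grad_L2v[OF mesh] Vh_pw_poly Wh_pw_poly
    unfolding \<Omega>_def by blast+
  have TL: "\<Theta> n \<in> L2v \<Omega>" "P n \<in> L2v \<Omega>" if "n \<le> N" for n
    using sp[OF that] Wh_L2v by (auto simp: \<Omega>_def)
  have coer: "CCoer * (hnorm M \<sigma> (half U n))\<^sup>2 \<le> ah M \<sigma> (half U n) (half U n)"
    and cont: "ah M \<sigma> (half U n) (half U n) \<le> CCont * (hnorm M \<sigma> (half U n))\<^sup>2" if "n < N" for n
    using ah HV[OF that] by (auto simp: ah_coercive_bounded_def power2_eq_square mult.assoc)
  have ah0: "0 \<le> ah M \<sigma> (half U n) (half U n)" if "n < N" for n
    using coer[OF that] ah by (rule_tac order_trans[rotated]) (auto simp: ah_coercive_bounded_def)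
  have nn: "0 \<le> s n" "0 \<le> w n" "0 \<le> t n" "0 \<le> p n" "0 \<le> \<theta> n" "0 \<le> \<pi> n" "0 \<le> G n" "0 \<le> B n" for n
    using pos by (auto simp: s_def w_def t_def p_def \<theta>_def \<pi>_def G_def B_def ip_nonneg)
  have Alow: "A1 * t n + A2 * p n \<le> A n" and Aup: "A n \<le> (a1 + \<bar>\<gamma>\<bar> / \<gamma>0) * t n + (a2 + \<bar>\<gamma>\<bar> * \<gamma>0) * p n"
    if "n \<le> N" for n
    using coupled_form_bounds[OF TL[OF that] pos(9), of a1 \<gamma> a2]
    by (auto simp: A_def A1_def A2_def t_def p_def)
  have Wlow: "s n + a0 * w n \<le> W n" if "n < N" for n
    using ah0[OF that] pos by (simp add: W_def)

  have src_half: "ip \<Omega> (half (samples \<tau> h) n) Y \<le> c / 2 * L h + 1 / (2 * c) * ip \<Omega> Y Y"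
    if "admissible_source T N (omega M) h" "n < N" "Y \<in> L2v \<Omega>" "c > 0" for h n Y c
    using that sample[OF that(1), of n] sample[OF that(1), of "Suc n"]
    by (intro source_half_bound) auto
  have src_quarter: "ip \<Omega> (quarter (samples \<tau> h) (Suc n)) Y \<le> c / 2 * L h + 1 / (2 * c) * ip \<Omega> Y Y"
    if "admissible_source T N (omega M) h" "Suc n < N" "Y \<in> L2v \<Omega>" "c > 0" for h n Y c
    using that sample[OF that(1)]
    by (intro source_quarter_bound) auto
  have half_L2: "half (samples \<tau> h) n \<in> L2v \<Omega>" if "admissible_source T N (omega M) h" "n < N" for h n
    using that sample[OF that(1), of n] sample[OF that(1), of "Suc n"] by (intro half_L2v) auto
  have split: "ip \<Omega> (half (samples \<tau> h) n) (half X n) =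
      (ip \<Omega> (half (samples \<tau> h) n) (X (Suc n)) + ip \<Omega> (half (samples \<tau> h) n) (X n)) / 2"
    if "admissible_source T N (omega M) h" "n < N" "X n \<in> L2v \<Omega>" "X (Suc n) \<in> L2v \<Omega>" for h n X
    using ip_half_left[OF that(3,4) half_L2[OF that(1,2)]] by (simp add: ip_commute)

  \<comment> \<open>All three equations are taken at index \<open>k + 1\<close>. The displacement
    equation then links \<open>W k\<close> to \<open>W (k + 1)\<close>, the other two link
    \<open>A (k + 1)\<close> to \<open>A (k + 2)\<close>.\<close>
  have step: "2 * W (Suc k) + A (Suc (Suc k)) / 2 + \<tau> / 2 * G (Suc k) + \<tau> / 4 * (B (Suc k) + G (Suc k))
     \<le> q\<^sup>2 * (2 * W k + A (Suc k) / 2 + \<tau> / 2 * G k + r)" if k: "Suc k < N" for k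
  proof -
    have k': "k < N" "k \<le> N" "Suc k \<le> N" "Suc (Suc k) \<le> N" using k by auto
    let ?c = "\<lambda>i j. ip \<Omega> (grad M (S i)) (grad M (D j))" and ?d = "\<lambda>i j. ip \<Omega> (grad M (Q i)) (grad M (D j))"
    let ?f = "\<lambda>j. ip \<Omega> (quarter (samples \<tau> f) (Suc k)) (D j)"
    let ?\<phi> = "\<lambda>j. ip \<Omega> (half (samples \<tau> \<phi>) (Suc k)) (\<Theta> j)"
    let ?g = "\<lambda>j. ip \<Omega> (half (samples \<tau> g) (Suc k)) (P j)"
    have F: "quarter (samples \<tau> f) (Suc k) \<in> L2v (omega M)"
      using half_L2[OF src(1) k'(1)] half_L2[OF src(1) k] by (simp add: quarter_L2v \<Omega>_def)
    have id1: "2 * W (Suc k) - 2 * W k = \<tau> * \<alpha> * (?c (Suc k) (Suc k) + ?c (Suc k) k + ?c k (Suc k) + ?c k k)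
        + \<tau> * \<beta> * (?d (Suc k) (Suc k) + ?d (Suc k) k + ?d k (Suc k) + ?d k k) + 2 * \<tau> * (?f (Suc k) + ?f k)"
      using displacement_identity[OF mesh \<tau> sp(1)[OF k'(2)] sp(1)[OF k'(3)] sp(1)[OF k'(4)]
          sp(2)[OF k'(2)] sp(2)[OF k'(3)] sp(2)[OF k'(4)] sp(3)[OF k'(2)] sp(3)[OF k'(3)] sp(3)[OF k'(4)]
          F dstep[OF _ k]]
      by (simp add: W_def s_def w_def D_def S_def Q_def \<Omega>_def)
    have id2: "A (Suc (Suc k)) / 2 - A (Suc k) / 2 + \<tau> * (B (Suc k) + G (Suc k))
        + \<tau> * \<alpha> * ?c (Suc k) (Suc k) + \<tau> * \<beta> * ?d (Suc k) (Suc k)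
        = \<tau> * ((?\<phi> (Suc (Suc k)) + ?\<phi> (Suc k)) / 2 + (?g (Suc (Suc k)) + ?g (Suc k)) / 2)"
      using coupling_identity[OF mesh \<tau> sp(1)[OF k'(3)] sp(1)[OF k'(4)] sp(2)[OF k'(3)] sp(2)[OF k'(4)]
          sp(3)[OF k'(3)] sp(3)[OF k'(4)] tstep[OF k] pstep[OF k]]
      unfolding split[OF src(2) k TL(1)[OF k'(3)] TL(1)[OF k'(4)], unfolded \<Omega>_def]
        split[OF src(3) k TL(2)[OF k'(3)] TL(2)[OF k'(4)], unfolded \<Omega>_def]
      by (simp add: A_def t_def p_def B_def G_def \<theta>_def \<pi>_def D_def S_def Q_def \<Omega>_def add.assoc)
    have yc: "\<alpha> * ?c i j \<le> x * c1 / 4 * \<theta> i + \<alpha>\<^sup>2 / (x * c1) * w j"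
      and yd: "\<beta> * ?d i j \<le> x * \<kappa> / 4 * \<pi> i + \<beta>\<^sup>2 / (x * \<kappa>) * w j"
      if "i < N" "j < N" "x > 0" for i j x
      unfolding \<theta>_def \<pi>_def w_def using that DL pos by (intro coupling_young; simp)+
    \<comment> \<open>The Young weight \<open>x / (2 * K)\<close> leaves \<open>K / x\<close> on the
      unknown, with \<open>x = q\<close> at the new level and \<open>x = 1\<close> at the old one;
      the weights for \<open>\<phi>\<close> and \<open>g\<close> also include \<open>A1\<close> and
      \<open>A2\<close>.\<close>
    have yf: "?f j \<le> x / 4 * (L f / K) + K / x * s j" if "j < N" "x > 0" for j x
      using src_quarter[OF src(1) k DL(1)[OF that(1)], of "x / (2 * K)"] that K
      by (simp add: s_def mult.commute)
    have yp: "?\<phi> j \<le> x / 4 * (L \<phi> / (K * A1)) + K / x * (A1 * t j)" if "j \<le> N" "x > 0" for j x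
      using src_half[OF src(2) k TL(1)[OF that(1)], of "x / (2 * K * A1)"] that K Apos
      by (simp add: t_def mult.commute mult.left_commute)
    have yg: "?g j \<le> x / 4 * (L g / (K * A2)) + K / x * (A2 * p j)" if "j \<le> N" "x > 0" for j x
      using src_half[OF src(3) k TL(2)[OF that(1)], of "x / (2 * K * A2)"] that K Apos
      by (simp add: p_def mult.commute mult.left_commute)
    have "q > 0" using q1 by simp
    show ?thesis unfolding r_def
      by (rule energy_step[OF K \<tau> pos(2,3,4) q_def Ka0 id1 id2 Wlow[OF k] Wlow[OF k'(1)]
          Alow[OF k'(4)] Alow[OF k'(3)] G_def G_def])
         (use yc[OF k k'(1), of 1] yc[OF k'(1) k'(1), of 1] yc[OF k'(1) k, of q]
           yd[OF k k'(1), of 1] yd[OF k'(1) k'(1), of 1] yd[OF k'(1) k, of q]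
           yf[OF k, of q] yf[OF k'(1), of 1] yp[OF k'(4), of q] yp[OF k'(3), of 1]
           yg[OF k'(4), of q] yg[OF k'(3), of 1] \<open>q > 0\<close> nn L0 K Apos in auto)
  qed

  \<comment> \<open>The dissipation recorded earlier is nonnegative and
    \<open>q\<^sup>2 \<ge> 1\<close>, so it can be carried along under the factor.\<close>
  have Zstep: "Z (Suc k) \<le> q\<^sup>2 * (Z k + r)" if "k < m" for k
  proof -
    let ?s = "\<Sum>j=1..k. B j + G j"
    have s0: "0 \<le> \<tau> / 4 * ?s" using \<tau> nn by (intro mult_nonneg_nonneg sum_nonneg) auto
    then have "1 * (\<tau> / 4 * ?s) \<le> q\<^sup>2 * (\<tau> / 4 * ?s)"
      using q1 by (intro mult_right_mono) auto
    moreover have "Z (Suc k) = 2 * W (Suc k) + A (Suc (Suc k)) / 2 + \<tau> / 2 * G (Suc k)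
        + \<tau> / 4 * (B (Suc k) + G (Suc k)) + \<tau> / 4 * ?s"
      by (simp add: Z_def algebra_simps)
    moreover have "q\<^sup>2 * (Z k + r) = q\<^sup>2 * (2 * W k + A (Suc k) / 2 + \<tau> / 2 * G k + r) + q\<^sup>2 * (\<tau> / 4 * ?s)"
      by (simp add: Z_def algebra_simps)
    ultimately show ?thesis using step[of k] that N by simp
  qed
  have r0: "r \<ge> 0" using \<tau> K Apos L0 by (simp add: r_def)
  have Zm: "Z m \<le> (q\<^sup>2) ^ m * (Z 0 + real m * r)"
    by (rule discrete_gronwall) (use q1 r0 Zstep in auto)

  \<comment> \<open>One factor \<open>T\<close> is the elapsed time \<open>m * \<tau>\<close>, the
    other is the bound for \<open>1 / K\<close>.\<close>
  have mr: "real m * r \<le> T\<^sup>2 * (L f + (L \<phi> / A1 + L g / A2) / 4)"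
  proof -
    let ?S = "L f + (L \<phi> / A1 + L g / A2) / 4"
    have S0: "0 \<le> ?S" using L0 Apos by simp
    have "r = \<tau> * (?S / K)" by (simp add: r_def add_divide_distrib ac_simps)
    then have "real m * r = (real m * \<tau>) * (?S / K)" by simp
    also have "\<dots> \<le> T * (?S / K)"
    proof (rule mult_right_mono)
      have "real m * \<tau> \<le> real N * \<tau>" using N \<tau> by (intro mult_right_mono) auto
      then show "real m * \<tau> \<le> T" using N by (simp add: \<tau>_def)
    qed (use S0 K in simp)
    also have "\<dots> \<le> T * (?S * T)"
    proof -
      have "?S * (1 / K) \<le> ?S * T"
        using KT K pos S0 by (intro mult_left_mono) (auto simp: field_simps)
      then show ?thesis using pos by (intro mult_left_mono) auto
    qed
    finally show ?thesis by (simp add: power2_eq_square mult.commute mult.left_commute)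
  qed
  let ?data = "displacement_data M \<sigma> CCont a0 d0 T \<tau> U f + temperature_data M \<gamma> \<gamma>0 a1 c1 T \<tau> \<Theta> \<phi>
      + pressure_data M \<gamma> \<gamma>0 a2 \<kappa> T \<tau> P g"
  \<comment> \<open>Here continuity of \<open>ah\<close> enters, bounding the initial elastic
    energy. The coefficients in the data leave room: for instance \<open>Z 0\<close> contains
    \<open>s 0\<close> only twice, the data six times.\<close>
  have data: "Z 0 + real m * r \<le> ?data"
  proof -
    have "W 0 \<le> s 0 + a0 * w 0 + d0 * CCont * (hnorm M \<sigma> (half U 0))\<^sup>2"
      using cont[of 0] N pos by (simp add: W_def mult.assoc)
    moreover have "0 \<le> d0 * CCont * (hnorm M \<sigma> (half U 0))\<^sup>2" "0 \<le> a0 * w 0"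
      using ah pos nn by (auto simp: ah_coercive_bounded_def)
    moreover have "A 1 \<le> (3 * a1 + \<bar>\<gamma>\<bar> / \<gamma>0) * t 1 + (3 * a2 + \<bar>\<gamma>\<bar> * \<gamma>0) * p 1"
    proof -
      have "(a1 + \<bar>\<gamma>\<bar> / \<gamma>0) * t 1 \<le> (3 * a1 + \<bar>\<gamma>\<bar> / \<gamma>0) * t 1"
        "(a2 + \<bar>\<gamma>\<bar> * \<gamma>0) * p 1 \<le> (3 * a2 + \<bar>\<gamma>\<bar> * \<gamma>0) * p 1"
        using pos nn by (auto intro!: mult_right_mono)
      then show ?thesis using Aup[of 1] N by linarith
    qed
    moreover have "\<tau> / 2 * G 0 \<le> c1 * \<tau> * \<theta> 0 + \<kappa> * \<tau> * \<pi> 0"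
    proof -
      have "0 \<le> \<tau> / 2 * G 0" using \<tau> nn by simp
      then show ?thesis by (simp add: G_def algebra_simps)
    qed
    moreover have "real m * r \<le> 4 * T\<^sup>2 * L f + T\<^sup>2 / A1 * L \<phi> + T\<^sup>2 / A2 * L g"
    proof -
      have eq: "T\<^sup>2 * (L f + (L \<phi> / A1 + L g / A2) / 4)
          = T\<^sup>2 * L f + 1 / 4 * (T\<^sup>2 / A1 * L \<phi>) + 1 / 4 * (T\<^sup>2 / A2 * L g)"
        by (simp add: algebra_simps add_divide_distrib)
      moreover have "0 \<le> T\<^sup>2 * L f" "0 \<le> T\<^sup>2 / A1 * L \<phi>" "0 \<le> T\<^sup>2 / A2 * L g"
        using L0 Apos by auto
      ultimately show ?thesis using mr unfolding eq by argo
    qed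
    moreover have "?data = 6 * s 0 + 4 * (a0 * w 0) + 4 * (d0 * CCont * (hnorm M \<sigma> (half U 0))\<^sup>2) + 4 * T\<^sup>2 * L f
        + (1 / 2 * ((3 * a1 + \<bar>\<gamma>\<bar> / \<gamma>0) * t 1) + c1 * \<tau> * \<theta> 0 + T\<^sup>2 / A1 * L \<phi>)
        + (1 / 2 * ((3 * a2 + \<bar>\<gamma>\<bar> * \<gamma>0) * p 1) + \<kappa> * \<tau> * \<pi> 0 + T\<^sup>2 / A2 * L g)"
      unfolding displacement_data_def temperature_data_def pressure_data_def nrm_sq
      by (simp add: s_def w_def t_def p_def \<theta>_def \<pi>_def L_def A1_def A2_def D_def S_def Q_def \<Omega>_def)
    moreover have "Z 0 = 2 * W 0 + A 1 / 2 + \<tau> / 2 * G 0" by (simp add: Z_def)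
    ultimately show ?thesis using nn(1)[of 0] by linarith
  qed
  have exp: "(q\<^sup>2) ^ m \<le> exp (2 * K * T)"
  proof -
    have "q \<le> exp (K * \<tau>)" unfolding q_def by (rule exp_ge_add_one_self)
    then have "(q\<^sup>2) ^ m \<le> exp (K * \<tau>) ^ (2 * m)"
      unfolding power_mult[symmetric] using q1 by (intro power_mono) auto
    \<comment> \<open>Raising the exponent from \<open>m\<close> to \<open>N\<close> removes the
      step size, because \<open>N * \<tau> = T\<close>.\<close>
    also have "\<dots> \<le> exp (K * \<tau>) ^ (2 * N)"
      using N K \<tau> by (intro power_increasing) auto
    also have "\<dots> = exp (2 * K * T)"
      using N by (simp add: exp_of_nat_mult[symmetric] \<tau>_def)
    finally show ?thesis .
  qed
  have W0: "0 \<le> W n" if "n < N" for n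
  proof -
    have "0 \<le> a0 * w n" using pos nn by simp
    then show ?thesis using Wlow[OF that] nn(1)[of n] by linarith
  qed
  have A0: "0 \<le> A n" if "n \<le> N" for n
  proof -
    have "0 \<le> A1 * t n" "0 \<le> A2 * p n" using Apos nn by simp_all
    then show ?thesis using Alow[OF that] by linarith
  qed
  \<comment> \<open>The sign is needed to enlarge both factors of the Gronwall bound at the same
    time.\<close>
  have Z0: "0 \<le> Z 0 + real m * r"
    using W0[of 0] A0[of 1] nn(7)[of 0] \<tau> r0 N by (simp add: Z_def)
  \<comment> \<open>Coercivity turns the elastic norm into \<open>ah\<close>. In
    \<open>4 * Z m\<close> the dissipation has weight exactly 1, while \<open>W\<close> and
    \<open>A\<close> have weights 8 and 2; the excess and the carried gradient term are
    nonnegative.\<close>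
  have "energy M \<sigma> CCoer a0 d0 \<gamma> \<gamma>0 a1 b1 c1 a2 \<kappa> \<tau> U \<Theta> P m \<le> 4 * Z m"
  proof -
    have "energy M \<sigma> CCoer a0 d0 \<gamma> \<gamma>0 a1 b1 c1 a2 \<kappa> \<tau> U \<Theta> P m =
        s m + a0 * w m + d0 * (CCoer * (hnorm M \<sigma> (half U m))\<^sup>2) + A1 * t (Suc m) + A2 * p (Suc m)
        + \<tau> * (\<Sum>k=1..m. B k + G k)"
      unfolding energy_def dissipation_def nrm_sq
      by (simp add: s_def w_def t_def p_def \<theta>_def \<pi>_def A1_def A2_def D_def S_def Q_def \<Omega>_def B_def G_def add.assoc mult.assoc)
    moreover have "d0 * (CCoer * (hnorm M \<sigma> (half U m))\<^sup>2) \<le> d0 * ah M \<sigma> (half U m) (half U m)"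
      using coer[OF N(2)] pos by (intro mult_left_mono) auto
    moreover have "0 \<le> W m" "0 \<le> A (Suc m)" "A1 * t (Suc m) + A2 * p (Suc m) \<le> A (Suc m)"
      using W0 A0 Alow N by auto
    moreover have "0 \<le> \<tau> / 2 * G m" using \<tau> nn by simp
    ultimately show ?thesis unfolding Z_def W_def[of m] by (simp add: algebra_simps)
  qed
  also have "\<dots> \<le> 4 * (exp (2 * K * T) * ?data)"
  proof -
    have "(q\<^sup>2) ^ m * (Z 0 + real m * r) \<le> exp (2 * K * T) * ?data"
      using exp data Z0 by (intro mult_mono) auto
    with Zm show ?thesis by simp
  qed
  finally show ?thesis by (simp add: \<tau>_def mult.assoc)
qed

theorem theorem3p6:
  fixes T a0 c1 \<alpha> \<beta> \<kappa> :: real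
  assumes "T > 0" "a0 > 0" "c1 > 0" "\<alpha> > 0" "\<beta> > 0" "\<kappa> > 0"
  shows "\<exists>C>0. \<forall>(d0::real) (a1::real) (b1::real) (a2::real) (\<gamma>::real) (\<gamma>0::real)
      (M::mesh) (\<rho>::real) (\<sigma>::real) (CCoer::real) (CCont::real)
      (J::sfun \<Rightarrow> sfun) (CJ::real) (C1::real \<Rightarrow> real) (N::nat)
      (f::real \<Rightarrow> sfun) (\<phi>::real \<Rightarrow> sfun) (g::real \<Rightarrow> sfun)
      (u0::sfun) (us0::sfun) (\<theta>0::sfun) (p0::sfun)
      (U::nat \<Rightarrow> sfun) (\<Theta>::nat \<Rightarrow> sfun) (P::nat \<Rightarrow> sfun) (m::nat).
      d0 > 0 \<and> a1 > 0 \<and> b1 > 0 \<and> a2 > 0 \<and> a1 * a2 - \<gamma>\<^sup>2 > 0 \<and>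
      \<gamma>0 > 0 \<and> a1 - \<bar>\<gamma>\<bar> / \<gamma>0 > 0 \<and> a2 - \<bar>\<gamma>\<bar> * \<gamma>0 > 0 \<and>
      is_mesh M \<and> shape_regular \<rho> M \<and> ah_coercive_bounded M \<sigma> CCoer CCont \<and>
      companion_operator M J CJ \<and> Q_approximation M \<sigma> J C1 \<and>
      N \<ge> 1 \<and>
      admissible_source T N (omega M) f \<and>
      admissible_source T N (omega M) \<phi> \<and>
      admissible_source T N (omega M) g \<and>
      u0 \<in> sobolev0 2 (omega M) \<and> us0 \<in> sobolev0 1 (omega M) \<and>
      \<theta>0 \<in> sobolev0 1 (omega M) \<and> p0 \<in> sobolev0 1 (omega M) \<and>
      scheme M \<sigma> J a0 d0 \<alpha> \<beta> \<gamma> a1 b1 c1 a2 \<kappa> T N f \<phi> g u0 us0 \<theta>0 p0 U \<Theta> P \<and>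
      1 \<le> m \<and> m \<le> N - 1
      \<longrightarrow> energy M \<sigma> CCoer a0 d0 \<gamma> \<gamma>0 a1 b1 c1 a2 \<kappa> (T / real N) U \<Theta> P m
          \<le> C * (displacement_data M \<sigma> CCont a0 d0 T (T / real N) U f
                 + temperature_data M \<gamma> \<gamma>0 a1 c1 T (T / real N) \<Theta> \<phi>
                 + pressure_data M \<gamma> \<gamma>0 a2 \<kappa> T (T / real N) P g)"
proof -
  \<comment> \<open>Only the parameters fixed in front of the existential quantifier occur, so the
    constant can be chosen before mesh, penalty, step number, data and solution.\<close>
  let ?K = "1 / T + (\<alpha>\<^sup>2 / c1 + \<beta>\<^sup>2 / \<kappa>) / a0"
  show ?thesis
    by (rule exI[of _ "4 * exp (2 * ?K * T)"], intro conjI allI impI, simp, elim conjE)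
       (rule stability_bound; (assumption | rule assms))
qed

end
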